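(* Let $\Omega\subset\mathbb C$ be a bounded, simply connected domain and let $\psi:\mathbb D\to\Omega$ be a conformal map of $\mathbb D$ onto $\Omega$ such that $|\psi'|^2\in \mathrm{B}_1(\mathbb D)$. Then for every $1<p<\infty$ and every weight $\sigma$ on $\Omega$, \[\|\Pi_\Omega\|_{\mathcal L(L^p(\Omega,\sigma))}\le C_p\left([|\psi'|^2]_{\mathrm{B}_1(\mathbb D)}^{\,p}\,[\sigma]_{\mathrm{B}_p(\Omega)}\right)^{\max\{1,\frac1{p-1}\}},\] where the constant $C_p$ depends only on $p$.
   Context: $\mathbb D$ is the open unit disc, $\mathbb T$ the unit circle, $dA$ is area measure normalized so that $A(\mathbb D)=1$. A weight is a locally integrable, almost everywhere positive function. For measurable $f$, $0<p<\infty$, a weight $v$ and a measurable set $E$, $\langle f\rangle_{p,v,E}=\big(\int_E|f|^pv\,dA\big)^{1/p}\big/\big(\int_Ev\,dA\big)^{1/p}$; for $p=\infty$ this means $\|f\|_{L^\infty(E)}$; the subscript $v$ is omitted when $v\equiv1$ and $p$ is omitted when $p=1$. For an arc $I\subset\mathbb T$ with center $e^{i\theta_0}$ and arclength $\ell(I)$ (normalized so $\ell(\mathbb T)=1$), the Carleson box is $Q_I=\{re^{i\theta}\in\mathbb D:1-r\le\ell(I),\ |\theta-\theta_0|\le \ell(I)/2\}$. For $1\le p<\infty$ and a weight $\sigma$ on $\mathbb D$, $[\sigma]_{\mathrm{B}_p(\mathbb D)}=\sup_I\langle\sigma\rangle_{Q_I}\langle\sigma^{-1}\rangle_{\frac1{p-1},Q_I}$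 (supremum over all arcs $I$; when $p=1$, $\frac1{p-1}=\infty$), and $\sigma\in\mathrm{B}_p(\mathbb D)$ means this is finite. For a weight $\sigma$ on $\Omega$, $[\sigma]_{\mathrm{B}_p(\Omega)}=\sup_I\langle\sigma\rangle_{\psi(Q_I)}\langle\sigma^{-1}\rangle_{\frac1{p-1},\psi(Q_I)}$. $\Pi_\Omega$ is the Bergman projection, the orthogonal projection of $L^2(\Omega,dA)$ onto its closed subspace of holomorphic functions; $L^p(\Omega,\sigma)$ is the $L^p$ space of $\sigma\,dA$ on $\Omega$, and $\|\Pi_\Omega\|_{\mathcal L(L^p(\Omega,\sigma))}$ is its operator norm on that space (possibly infinite).
   Formalization: The Carleson box is taken over the whole arc, i.e. |θ−θ₀| ≤ πℓ(I) in radians with ℓ(𝕋)=1 (so ℓ(I)=1 gives the whole disc), instead of the literal |θ−θ₀| ≤ ℓ(I)/2, for which the bound fails. *)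

theory Defs
  imports "HOL-Analysis.Analysis" "HOL-Complex_Analysis.Complex_Analysis"
begin

text \<open>Real powers of extended nonnegative reals (exponent r > 0): infinity stays infinity.\<close>
definition ennpowr :: "ennreal \<Rightarrow> real \<Rightarrow> ennreal" where
  "ennpowr x r = (if x = \<infinity> then \<infinity> else ennreal (enn2real x powr r))"

text \<open>Normalized area measure dA on the plane (A(D) = 1).\<close>
definition dA :: "complex measure" where
  "dA = density lebesgue (\<lambda>_. ennreal (1 / pi))"

definition avg :: "real \<Rightarrow> (complex \<Rightarrow> real) \<Rightarrow> complex set \<Rightarrow> (complex \<Rightarrow> real) \<Rightarrow> ennreal" where
  "avg p v E f =
     ennpowr (\<integral>\<^sup>+ z\<in>E. ennreal (\<bar>f z\<bar> powr p * v z) \<partial>dA) (1 / p)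
     / ennpowr (\<integral>\<^sup>+ z\<in>E. ennreal (v z) \<partial>dA) (1 / p)"

definition linf :: "complex set \<Rightarrow> (complex \<Rightarrow> real) \<Rightarrow> ennreal" where
  "linf E f = Inf {c. AE z in lebesgue. z \<in> E \<longrightarrow> ennreal \<bar>f z\<bar> \<le> c}"

text \<open>Carleson box over the arc with centre e^{i theta0} and normalized length l
  (the arc is {e^{i theta} : |theta - theta0| <= pi l}, of normalized length l).\<close>
definition carleson_box :: "real \<Rightarrow> real \<Rightarrow> complex set" where
  "carleson_box \<theta>0 l =
     {complex_of_real r * cis \<theta> | r \<theta>. 0 \<le> r \<and> r < 1 \<and> 1 - r \<le> l \<and> \<bar>\<theta> - \<theta>0\<bar> \<le> pi * l}"

definition carleson_boxes :: "complex set set" where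
  "carleson_boxes = {carleson_box \<theta>0 l | \<theta>0 l. 0 < l \<and> l \<le> 1}"

definition Bp_char :: "real \<Rightarrow> (complex \<Rightarrow> real) \<Rightarrow> complex set set \<Rightarrow> ennreal" where
  "Bp_char p \<sigma> \<Q> = (SUP Q\<in>\<Q>. avg 1 (\<lambda>_. 1) Q \<sigma> *
       (if p = 1 then linf Q (\<lambda>z. 1 / \<sigma> z)
        else avg (1 / (p - 1)) (\<lambda>_. 1) Q (\<lambda>z. 1 / \<sigma> z)))"

definition Bp_disc :: "real \<Rightarrow> (complex \<Rightarrow> real) \<Rightarrow> ennreal" where
  "Bp_disc p \<sigma> = Bp_char p \<sigma> carleson_boxes"

definition Bp_dom :: "(complex \<Rightarrow> complex) \<Rightarrow> real \<Rightarrow> (complex \<Rightarrow> real) \<Rightarrow> ennreal" where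
  "Bp_dom \<psi> p \<sigma> = Bp_char p \<sigma> ((\<lambda>Q. \<psi> ` Q) ` carleson_boxes)"

definition weight_on :: "complex set \<Rightarrow> (complex \<Rightarrow> real) \<Rightarrow> bool" where
  "weight_on \<Omega> \<sigma> \<longleftrightarrow> \<sigma> \<in> borel_measurable lebesgue \<and>
     (\<forall>K. compact K \<and> K \<subseteq> \<Omega> \<longrightarrow> set_integrable lebesgue K \<sigma>) \<and>
     (AE z in lebesgue. z \<in> \<Omega> \<longrightarrow> 0 < \<sigma> z)"

definition L2_on :: "complex set \<Rightarrow> (complex \<Rightarrow> complex) set" where
  "L2_on \<Omega> = {f. set_borel_measurable dA \<Omega> f \<and> set_integrable dA \<Omega> (\<lambda>z. (cmod (f z))\<^sup>2)}"

definition bergman_space :: "complex set \<Rightarrow> (complex \<Rightarrow> complex) set" where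
  "bergman_space \<Omega> = {h. h holomorphic_on \<Omega> \<and> h \<in> L2_on \<Omega>}"

definition bergman_proj :: "complex set \<Rightarrow> (complex \<Rightarrow> complex) \<Rightarrow> (complex \<Rightarrow> complex)" where
  "bergman_proj \<Omega> f = (SOME g. g \<in> bergman_space \<Omega> \<and>
      (\<forall>h\<in>bergman_space \<Omega>. (LINT z:\<Omega>|dA. (f z - g z) * cnj (h z)) = 0))"

definition wnorm :: "real \<Rightarrow> (complex \<Rightarrow> real) \<Rightarrow> complex set \<Rightarrow> (complex \<Rightarrow> complex) \<Rightarrow> ennreal" where
  "wnorm p \<sigma> \<Omega> f = ennpowr (\<integral>\<^sup>+ z\<in>\<Omega>. ennreal (cmod (f z) powr p * \<sigma> z) \<partial>dA) (1 / p)"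

text \<open>Operator norm of \<Pi>_\<Omega> on L^p(\<Omega>,\<sigma>), computed on the dense subspace
  L^2(\<Omega>) \<inter> L^p(\<Omega>,\<sigma>) (possibly infinite).\<close>
definition bergman_opnorm :: "complex set \<Rightarrow> real \<Rightarrow> (complex \<Rightarrow> real) \<Rightarrow> ennreal" where
  "bergman_opnorm \<Omega> p \<sigma> =
     (SUP f\<in>{f\<in>L2_on \<Omega>. 0 < wnorm p \<sigma> \<Omega> f \<and> wnorm p \<sigma> \<Omega> f < \<infinity>}.
        wnorm p \<sigma> \<Omega> (bergman_proj \<Omega> f) / wnorm p \<sigma> \<Omega> f)"

end

theory Submission
  imports Defs
begin

text \<open>The map \<open>f \<mapsto> (f \<circ> \<psi>) \<psi>'\<close> is an isometry of \<open>L\<^sup>2(\<Omega>)\<close> onto \<open>L\<^sup>2\<close> of the disc that respects holomorphy, so it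
  intertwines the two Bergman projections, and it turns the norm of \<open>L\<^sup>p(\<Omega>, \<sigma>)\<close> into that of \<open>L\<^sup>p(w)\<close> with
  \<open>w = |\<psi>'|\<^bsup>2-p\<^esup> (\<sigma> \<circ> \<psi>)\<close>. On a Carleson box \<open>|\<psi>'|\<^sup>2\<close> exceeds its average divided by the \<open>B\<^sub>1\<close> characteristic;
  inserting this lower bound into the two averages that define the \<open>B\<^sub>p\<close> characteristic of \<open>w\<close> produces the
  factor \<open>[|\<psi>'|\<^sup>2]\<^sup>p\<close>.

  On the disc the Bergman kernel is dominated by the sum of \<open>1\<^sub>Q(z) 1\<^sub>Q(u) / |Q|\<close> over the boxes \<open>Q\<close> of two
  dyadic grids. The top halves of the boxes are disjoint and of comparable area, so for \<open>p \<ge> 2\<close> Hoelder's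
  inequality on the top halves reduces the bilinear form to two weighted dyadic maximal functions, at the
  cost of one power of the \<open>B\<^sub>p\<close> characteristic. The case \<open>p < 2\<close> follows by duality. The unweighted case
  of the same estimate shows that the kernel operator is bounded on \<open>L\<^sup>2\<close>, hence is the Bergman projection.\<close>

section \<open>Weighted estimates for nested families\<close>

text \<open>The bound has to be linear in the characteristic when p >= 2, so no estimate may rely on
  doubling or on self-improvement of the weight. This is why the maximal functions are dyadic and
  are taken relative to the weighted measures themselves: their norms then depend on the exponent
  alone. The range p >= 2 enters because replacing the dual mass of a box by the dual mass of its
  top half is favourable only under a power \<open>2 - p <= 0\<close>; duality turns K into
  \<open>K powr (1 / (p - 1))\<close>, which explains the maximum in the exponent. All size
  estimates concern the modulus of the kernel and take values in \<open>ennreal\<close>. Tonelli is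
  then free, and the same positive operator later provides the absolute convergence needed to
  exchange integrals when the Bergman integral is shown to be the orthogonal projection. The power p
  of the B_1 characteristic splits evenly: weight and dual weight contribute p/2 each, since both
  contain a nonnegative power of the reciprocal Jacobian.\<close>

lemma weak_type_nested:
  fixes f :: "'a \<Rightarrow> ennreal"
  assumes fin: "finite \<Q>" and meas: "\<And>A. A \<in> \<Q> \<Longrightarrow> A \<in> sets M"
    and nested: "\<And>A B. A \<in> \<Q> \<Longrightarrow> B \<in> \<Q> \<Longrightarrow> A \<subseteq> B \<or> B \<subseteq> A \<or> A \<inter> B = {}"
    and f [measurable]: "f \<in> borel_measurable M"
    and le: "\<And>A. A \<in> \<Q> \<Longrightarrow> c * emeasure M A \<le> (\<integral>\<^sup>+x\<in>A. f x \<partial>M)"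
  shows "c * emeasure M (\<Union>\<Q>) \<le> (\<integral>\<^sup>+x\<in>\<Union>\<Q>. f x \<partial>M)"
proof -
  \<comment> \<open>The maximal members of a finite nested family are pairwise disjoint and have the
    same union. No covering constant is lost, so the bound is equally good for every
    measure.\<close>
  define \<T> where "\<T> = {A\<in>\<Q>. \<forall>B\<in>\<Q>. A \<subseteq> B \<longrightarrow> A = B}"
  have sub: "\<T> \<subseteq> \<Q>" and finT: "finite \<T>" using fin by (auto simp: \<T>_def)
  have un: "\<Union>\<Q> = (\<Union>A\<in>\<T>. A)"
  proof
    show "\<Union>\<Q> \<subseteq> (\<Union>A\<in>\<T>. A)"
    proof
      fix x assume "x \<in> \<Union>\<Q>"
      then obtain A where A: "A \<in> \<Q>" "x \<in> A" by blast
      obtain m where "m \<in> \<Q>" "A \<subseteq> m" "\<forall>b\<in>\<Q>. m \<subseteq> b \<longrightarrow> m = b"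
        using finite_has_maximal2[OF fin A(1)] by auto
      then show "x \<in> (\<Union>A\<in>\<T>. A)" using A by (auto simp: \<T>_def)
    qed
  qed (use sub in auto)
  have disj: "disjoint_family_on (\<lambda>A. A) \<T>"
  proof (unfold disjoint_family_on_def, intro ballI impI)
    fix A B assume "A \<in> \<T>" "B \<in> \<T>" "A \<noteq> B"
    with nested[of A B] show "A \<inter> B = {}" by (auto simp: \<T>_def)
  qed
  have mT: "(\<lambda>A. A) ` \<T> \<subseteq> sets M" using sub meas by auto
  have "c * emeasure M (\<Union>\<Q>) = (\<Sum>A\<in>\<T>. c * emeasure M A)"
    unfolding un by (subst sum_emeasure[symmetric, OF mT disj finT]) (simp add: sum_distrib_left)
  also have "\<dots> \<le> (\<Sum>A\<in>\<T>. emeasure (density M f) A)"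
    using sub le meas by (intro sum_mono) (auto simp: emeasure_density)
  also have "\<dots> = emeasure (density M f) (\<Union>A\<in>\<T>. A)"
    using mT disj finT by (intro sum_emeasure) auto
  also have "\<dots> = (\<integral>\<^sup>+x\<in>\<Union>\<Q>. f x \<partial>M)"
    unfolding un using sub meas finT by (subst emeasure_density) auto
  finally show ?thesis .
qed

lemma nn_integral_powr_from_0:
  fixes r c :: real
  assumes "r > -1" "c \<ge> 0"
  shows "(\<integral>\<^sup>+t\<in>{0<..<c}. ennreal (t powr r) \<partial>lborel) = ennreal (c powr (r + 1) / (r + 1))"
proof -
  have "((\<lambda>t. indicator {0..c} t * t powr r) has_integral (c powr (r + 1) / (r + 1))) UNIV"
    using has_integral_powr_from_0[OF assms] by (subst (asm) has_integral_restrict_UNIV[symmetric])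
      (auto simp: indicator_def of_bool_def if_distrib[of "\<lambda>u. u * _"] cong: if_cong)
  then have "(\<integral>\<^sup>+t. ennreal (indicator {0..c} t * t powr r) \<partial>lborel) = ennreal (c powr (r + 1) / (r + 1))"
    by (intro nn_integral_has_integral_lborel) auto
  moreover have "(\<integral>\<^sup>+t. ennreal (indicator {0..c} t * t powr r) \<partial>lborel) = (\<integral>\<^sup>+t\<in>{0<..<c}. ennreal (t powr r) \<partial>lborel)"
  proof (rule nn_integral_cong_AE)
    have "AE t in lborel. t \<noteq> (0::real)" "AE t in lborel. t \<noteq> c"
      by (auto intro: AE_lborel_singleton)
    then show "AE t in lborel. ennreal (indicator {0..c} t * t powr r) = ennreal (t powr r) * indicator {0<..<c} t"
      by eventually_elim (auto simp: indicator_def)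
  qed
  ultimately show ?thesis by simp
qed

text \<open>The \<open>a i\<close> are at most the averages of f over \<open>Q i\<close>, and the
  \<open>E i\<close> are disjoint subsets of the \<open>Q i\<close>, so the left side is dominated
  by the p-th power norm of a dyadic maximal function of f. The proof is Marcinkiewicz interpolation
  between the weak bound for nested families and the trivial bound for bounded functions. Only
  nestedness is used, so M may be any weighted measure.\<close>

theorem carleson_embedding:
  fixes f :: "'a \<Rightarrow> real" and a :: "'i \<Rightarrow> real"
  assumes M: "sigma_finite_measure M" and fin: "finite S" and p: "1 < p"
    and Q [measurable]: "\<And>i. i \<in> S \<Longrightarrow> Q i \<in> sets M"
    and Qfin: "\<And>i. i \<in> S \<Longrightarrow> emeasure M (Q i) < \<infinity>"
    and nested: "\<And>i j. i \<in> S \<Longrightarrow> j \<in> S \<Longrightarrow> Q i \<subseteq> Q j \<or> Q j \<subseteq> Q i \<or> Q i \<inter> Q j = {}"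
    and E: "\<And>i. i \<in> S \<Longrightarrow> E i \<in> sets M" "\<And>i. i \<in> S \<Longrightarrow> E i \<subseteq> Q i" "disjoint_family_on E S"
    and f [measurable]: "f \<in> borel_measurable M" and f0: "\<And>x. 0 \<le> f x"
    and a0: "\<And>i. i \<in> S \<Longrightarrow> 0 \<le> a i"
    and a: "\<And>i. i \<in> S \<Longrightarrow> ennreal (a i) * emeasure M (Q i) \<le> (\<integral>\<^sup>+x\<in>Q i. ennreal (f x) \<partial>M)"
  shows "(\<Sum>i\<in>S. ennreal (a i powr p) * emeasure M (E i))
     \<le> ennreal (2 powr p * p / (p - 1)) * (\<integral>\<^sup>+x. ennreal (f x powr p) \<partial>M)"
proof -
  interpret M: sigma_finite_measure M by fact
  interpret pair_sigma_finite lborel M by standard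
  define A where "A t = (\<Union>i\<in>{i\<in>S. t < a i}. Q i)" for t
  have A [measurable]: "A t \<in> sets M" for t using fin Q by (auto simp: A_def)
  \<comment> \<open>Only the part of f above t/2 matters: the rest contributes at most half of
    \<open>t * emeasure M (Q i)\<close>, and this half is absorbed on the left. Absorption requires
    finite measure of the \<open>Q i\<close>.\<close>
  have weak: "ennreal (t / 2) * emeasure M (A t) \<le> (\<integral>\<^sup>+x. ennreal (f x) * indicator {0<..<2 * f x} t \<partial>M)"
    if t: "0 < t" for t
  proof -
    let ?g = "\<lambda>x. ennreal (f x) * indicator {0<..<2 * f x} t"
    have [measurable]: "?g \<in> borel_measurable M"
    proof -
      have "(\<lambda>x. ennreal (f x) * (if 0 < t \<and> t < 2 * f x then 1 else 0)) \<in> borel_measurable M" by measurable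
      then show ?thesis by (simp add: indicator_def of_bool_def)
    qed
    have "ennreal (t / 2) * emeasure M (Q i) \<le> (\<integral>\<^sup>+x\<in>Q i. ?g x \<partial>M)" if i: "i \<in> S" "t < a i" for i
    proof -
      have "ennreal t * emeasure M (Q i) \<le> ennreal (a i) * emeasure M (Q i)"
        using i t by (intro mult_right_mono ennreal_leI) auto
      also note a[OF i(1)]
      also have "(\<integral>\<^sup>+x\<in>Q i. ennreal (f x) \<partial>M) \<le> (\<integral>\<^sup>+x. ?g x * indicator (Q i) x + ennreal (t / 2) * indicator (Q i) x \<partial>M)"
        using t f0 by (intro nn_integral_mono) (auto simp: indicator_def intro: ennreal_leI)
      also have "\<dots> = (\<integral>\<^sup>+x\<in>Q i. ?g x \<partial>M) + ennreal (t / 2) * emeasure M (Q i)"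
        using Q[OF i(1)] by (subst nn_integral_add) (auto simp: nn_integral_cmult)
      finally have le: "ennreal t * emeasure M (Q i) \<le> (\<integral>\<^sup>+x\<in>Q i. ?g x \<partial>M) + ennreal (t / 2) * emeasure M (Q i)" .
      have "ennreal t = ennreal (t / 2) + ennreal (t / 2)"
        using t by (simp flip: ennreal_plus)
      with le have "ennreal (t / 2) * emeasure M (Q i) + ennreal (t / 2) * emeasure M (Q i)
          \<le> ennreal (t / 2) * emeasure M (Q i) + (\<integral>\<^sup>+x\<in>Q i. ?g x \<partial>M)"
        by (simp add: distrib_right add.commute)
      moreover have "ennreal (t / 2) * emeasure M (Q i) \<noteq> \<infinity>"
        using Qfin[OF i(1)] by (simp add: ennreal_mult_eq_top_iff less_top)
      ultimately show ?thesis by (subst (asm) ennreal_add_left_cancel_le) auto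
    qed
    then have "ennreal (t / 2) * emeasure M (\<Union>(Q ` {i\<in>S. t < a i})) \<le> (\<integral>\<^sup>+x\<in>\<Union>(Q ` {i\<in>S. t < a i}). ?g x \<partial>M)"
    proof (intro weak_type_nested)
      show "A \<subseteq> B \<or> B \<subseteq> A \<or> A \<inter> B = {}" if "A \<in> Q ` {i\<in>S. t < a i}" "B \<in> Q ` {i\<in>S. t < a i}" for A B
        using that nested by force
    qed (use fin Q in auto)
    also have "\<dots> \<le> (\<integral>\<^sup>+x. ?g x \<partial>M)"
      by (intro nn_integral_mono) (auto simp: indicator_def)
    finally show ?thesis by (simp add: A_def)
  qed
  have layer: "ennreal (b powr p) = (\<integral>\<^sup>+t. ennreal (p * t powr (p - 1)) * indicator {0<..<b} t \<partial>lborel)"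
    if "0 \<le> b" for b :: real
  proof -
    have "(\<integral>\<^sup>+t. ennreal (p * t powr (p - 1)) * indicator {0<..<b} t \<partial>lborel)
        = ennreal p * (\<integral>\<^sup>+t\<in>{0<..<b}. ennreal (t powr (p - 1)) \<partial>lborel)"
      using p by (subst nn_integral_cmult[symmetric]) (auto simp: ennreal_mult mult.assoc)
    also have "\<dots> = ennreal (b powr p)"
      using p that by (subst nn_integral_powr_from_0) (auto simp flip: ennreal_mult)
    finally show ?thesis ..
  qed
  let ?s = "\<lambda>t. \<Sum>i\<in>S. ennreal (p * t powr (p - 1)) * indicator {0<..<a i} t * emeasure M (E i)"
    and ?r = "\<lambda>t x. ennreal (2 * p * t powr (p - 2)) * ennreal (f x) * indicator {0<..<2 * f x} t"
  have "(\<Sum>i\<in>S. ennreal (a i powr p) * emeasure M (E i))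
      = (\<integral>\<^sup>+t. ?s t \<partial>lborel)"
    using a0 by (subst nn_integral_sum) (auto simp: layer nn_integral_multc)
  also have "\<dots> \<le> (\<integral>\<^sup>+t. \<integral>\<^sup>+x. ?r t x \<partial>M \<partial>lborel)"
  proof (rule nn_integral_mono)
    fix t :: real
    show "?s t
      \<le> (\<integral>\<^sup>+x. ?r t x \<partial>M)"
    proof (cases "0 < t")
      case True
      let ?S = "{i\<in>S. t < a i}"
      have "?s t
        = ennreal (p * t powr (p - 1)) * (\<Sum>i\<in>?S. emeasure M (E i))"
        using fin True unfolding sum_distrib_left
        by (intro sum.mono_neutral_cong_right) (auto simp: indicator_def)
      also have "(\<Sum>i\<in>?S. emeasure M (E i)) = emeasure M (\<Union>i\<in>?S. E i)"
        using fin E by (intro sum_emeasure) (auto simp: disjoint_family_on_def)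
      also have "\<dots> \<le> emeasure M (A t)"
        using E by (intro emeasure_mono A) (auto simp: A_def)
      finally have "?s t
         \<le> ennreal (p * t powr (p - 1)) * emeasure M (A t)"
        by (simp add: mult_left_mono)
      \<comment> \<open>The factor t/2 is split off because the weak bound at height t is stated
        with it.\<close>
      also have "\<dots> = ennreal (2 * p * t powr (p - 2)) * (ennreal (t / 2) * emeasure M (A t))"
      proof -
        have "ennreal (p * t powr (p - 1)) = ennreal (2 * p * t powr (p - 2)) * ennreal (t / 2)"
          using p True by (simp flip: ennreal_mult add: powr_diff power2_eq_square)
        then show ?thesis by (simp add: mult.assoc)
      qed
      also have "\<dots> \<le> ennreal (2 * p * t powr (p - 2)) * (\<integral>\<^sup>+x. ennreal (f x) * indicator {0<..<2 * f x} t \<partial>M)"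
        using weak[OF True] by (rule mult_left_mono) auto
      also have "\<dots> = (\<integral>\<^sup>+x. ?r t x \<partial>M)"
        by (subst nn_integral_cmult[symmetric]) (auto simp: mult.assoc indicator_def)
      finally show ?thesis .
    qed (auto simp: indicator_def)
  qed
  also have "\<dots> = (\<integral>\<^sup>+x. \<integral>\<^sup>+t. ?r t x \<partial>lborel \<partial>M)"
  proof (rule Fubini'[symmetric])
    have "(\<lambda>z. ennreal (2 * p * fst z powr (p - 2)) * ennreal (f (snd z)) * (if 0 < fst z \<and> fst z < 2 * f (snd z) then 1 else 0))
      \<in> borel_measurable (lborel \<Otimes>\<^sub>M M)" by measurable
    then show "(\<lambda>(t, x). ?r t x)
      \<in> borel_measurable (lborel \<Otimes>\<^sub>M M)" by (simp add: case_prod_beta' indicator_def)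
  qed
  also have "\<dots> = (\<integral>\<^sup>+x. ennreal (2 powr p * p / (p - 1)) * ennreal (f x powr p) \<partial>M)"
  proof (rule nn_integral_cong)
    fix x
    have "(\<integral>\<^sup>+t. ?r t x \<partial>lborel)
      = ennreal (2 * p * f x) * (\<integral>\<^sup>+t\<in>{0<..<2 * f x}. ennreal (t powr (p - 2)) \<partial>lborel)"
      using p f0 by (subst nn_integral_cmult[symmetric]) (auto simp: ennreal_mult mult_ac)
    \<comment> \<open>The power \<open>t powr (p - 2)\<close> is integrable at 0 exactly because p >
      1; this is the origin of the denominator p - 1 in the constant.\<close>
    also have "\<dots> = ennreal (2 * p * f x * ((2 * f x) powr (p - 1) / (p - 1)))"
      using p f0[of x] by (subst nn_integral_powr_from_0) (auto simp flip: ennreal_mult)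
    also have "2 * p * f x * ((2 * f x) powr (p - 1) / (p - 1)) = (2 powr p * p / (p - 1)) * f x powr p"
      using p f0[of x] by (cases "f x = 0") (auto simp: powr_mult powr_diff field_simps)
    finally show "(\<integral>\<^sup>+t. ?r t x \<partial>lborel)
      = ennreal (2 powr p * p / (p - 1)) * ennreal (f x powr p)"
      using p by (subst ennreal_mult[symmetric]) auto
  qed
  also have "\<dots> = ennreal (2 powr p * p / (p - 1)) * (\<integral>\<^sup>+x. ennreal (f x powr p) \<partial>M)"
    by (subst nn_integral_cmult) auto
  finally show ?thesis .
qed

lemma holder_weights:
  fixes w s :: "'a \<Rightarrow> real"
  assumes p: "1 < p" and q: "q = p / (p - 1)"
    and [measurable]: "w \<in> borel_measurable M" "s \<in> borel_measurable M" "E \<in> sets M"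
    and pos: "\<And>x. 0 < w x" "\<And>x. 0 < s x" "\<And>x. w x * s x powr (p - 1) = 1"
    and e: "emeasure M E = ennreal e" "0 < e"
    and W: "(\<integral>\<^sup>+x\<in>E. ennreal (w x) \<partial>M) = ennreal W" "0 < W"
    and T: "(\<integral>\<^sup>+x\<in>E. ennreal (s x) \<partial>M) = ennreal T" "0 < T"
  shows "e \<le> W powr (1 / p) * T powr (1 / q)"
proof -
  define C where "C = W powr (1 / p) * T powr (1 / q)"
  have C: "0 < C" using W T by (simp add: C_def)
  have pq: "0 < q" "1 / p + 1 / q = 1" using p by (auto simp: q field_simps)
  \<comment> \<open>Young's inequality for the normalized densities w/W and s/T. Integrated over E,
    the right side becomes 1/p + 1/q = 1, which is Hoelder's inequality for
    \<open>1 = w powr (1 / p) * s powr (1 / q)\<close>.\<close>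
  have pt: "1 / C \<le> w x / (p * W) + s x / (q * T)" for x
  proof -
    have "1 = (w x * s x powr (p - 1)) powr (1 / p)" by (simp add: pos)
    also have "\<dots> = w x powr (1 / p) * s x powr (1 / q)"
      using p pos(1,2)[of x] by (simp add: powr_mult powr_powr q)
    finally have "1 / C = (w x / W) powr (1 / p) * (s x / T) powr (1 / q)"
      using W T pos by (simp add: C_def powr_divide less_imp_le)
    also have "\<dots> \<le> 1 / p * (w x / W) + 1 / q * (s x / T)"
      using p pq pos W T by (intro Youngs_inequality_0) auto
    finally show ?thesis by simp
  qed
  have "ennreal (1 / C) * ennreal e = (\<integral>\<^sup>+x. ennreal (1 / C) * indicator E x \<partial>M)"
    by (simp add: nn_integral_cmult e)
  also have "\<dots> \<le> (\<integral>\<^sup>+x. ennreal (1 / (p * W)) * (ennreal (w x) * indicator E x)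
                        + ennreal (1 / (q * T)) * (ennreal (s x) * indicator E x) \<partial>M)"
    using pt p pq W T pos
    by (intro nn_integral_mono) (auto simp: indicator_def less_imp_le intro!: ennreal_leI simp flip: ennreal_mult ennreal_plus)
  also have "\<dots> = ennreal (1 / (p * W)) * ennreal W + ennreal (1 / (q * T)) * ennreal T"
    by (subst nn_integral_add) (auto simp: nn_integral_cmult W T)
  also have "\<dots> = ennreal (1 / p + 1 / q)"
    using p pq W T by (simp flip: ennreal_mult ennreal_plus)
  finally have "ennreal (e / C) \<le> ennreal 1"
    using C e pq by (simp flip: ennreal_mult)
  then have "e / C \<le> 1" using C e by (subst (asm) ennreal_le_iff) auto
  then show ?thesis using C by (simp add: C_def)
qed

text \<open>Here m, W, T are the area, w-mass and s-mass of a box, and e, w, t the same quantities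
  for its top part. The term is the product of the weighted averages X/T and Y/W with the factor
  TW/m. The characteristic bounds this factor by \<open>K * m powr (p - 1) * T powr (2 - p)\<close>;
  passing to the top part and using h bounds it by a multiple of
  \<open>w powr (1 / q) * t powr (1 / p)\<close>. These powers are exactly the ones that distribute
  over the two averages.\<close>

lemma sparse_term_bound:
  fixes p :: real
  assumes p: "2 \<le> p" and q: "q = p / (p - 1)"
    and pos: "0 < m" "0 < e" "0 < W" "0 < T" "0 < w" "0 < t" "0 \<le> X" "0 \<le> Y" "0 \<le> K"
    and me: "m \<le> c * e" and tT: "t \<le> T"
    and K: "W * T powr (p - 1) \<le> K * m powr p"
    and h: "e \<le> w powr (1 / p) * t powr (1 / q)"
  shows "X * Y / m \<le> K * c powr (p - 1) * ((X / T) powr p * t + (Y / W) powr q * w)"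
proof -
  have q1: "1 < q" "1 / p + 1 / q = 1" using p by (auto simp: q field_simps)
  have c: "0 < c" using me pos by (smt (verit) mult_nonpos_nonneg)
  have "T * W / m = (W * T powr (p - 1)) * T powr (2 - p) / m"
    using pos by (simp add: powr_diff field_simps power2_eq_square)
  also have "\<dots> \<le> (K * m powr p) * T powr (2 - p) / m"
    using K pos by (intro divide_right_mono mult_right_mono) auto
  also have "\<dots> = K * m powr (p - 1) * T powr (2 - p)"
    using pos by (simp add: powr_diff)
  \<comment> \<open>The exponent 2 - p is nonpositive, so shrinking T to t increases the power; for
    p < 2 the inequality would point the wrong way.\<close>
  also have "\<dots> \<le> K * (c * e) powr (p - 1) * t powr (2 - p)"
    using pos me tT p c by (intro mult_mono powr_mono2 powr_mono2') auto
  also have "\<dots> = K * c powr (p - 1) * (e powr (p - 1) * t powr (2 - p))"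
    using pos c by (simp add: powr_mult)
  also have "\<dots> \<le> K * c powr (p - 1) * ((w powr (1 / p) * t powr (1 / q)) powr (p - 1) * t powr (2 - p))"
    using pos h p c by (intro mult_left_mono mult_right_mono powr_mono2) auto
  also have "(w powr (1 / p) * t powr (1 / q)) powr (p - 1) * t powr (2 - p) = w powr (1 / q) * t powr (1 / p)"
  proof -
    have "(p - 1) / q + (2 - p) = 1 / p" using p by (simp add: q field_simps)
    moreover have "(p - 1) / p = 1 / q" using p by (simp add: q)
    ultimately show ?thesis
      using pos by (simp add: powr_mult powr_powr powr_add[symmetric] mult.assoc)
  qed
  finally have TW: "T * W / m \<le> K * c powr (p - 1) * (w powr (1 / q) * t powr (1 / p))" .
  have "X * Y / m = (X / T) * (Y / W) * (T * W / m)"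
    using pos by simp
  also have "\<dots> \<le> (X / T) * (Y / W) * (K * c powr (p - 1) * (w powr (1 / q) * t powr (1 / p)))"
    using TW pos by (intro mult_left_mono) auto
  also have "\<dots> = K * c powr (p - 1) * (((X / T) * t powr (1 / p)) * ((Y / W) * w powr (1 / q)))"
    by simp
  \<comment> \<open>Young's inequality decouples the two functions: one summand will be embedded in
    \<open>L^p\<close> of the measure with density s, the other in \<open>L^q\<close> of the measure
    with density w.\<close>
  also have "\<dots> \<le> K * c powr (p - 1) * (((X / T) * t powr (1 / p)) powr p / p + ((Y / W) * w powr (1 / q)) powr q / q)"
    using p q1 pos by (intro mult_left_mono Youngs_inequality) auto
  also have "\<dots> \<le> K * c powr (p - 1) * (((X / T) * t powr (1 / p)) powr p + ((Y / W) * w powr (1 / q)) powr q)"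
    using p q1 pos by (intro mult_left_mono add_mono) (auto simp: divide_le_eq mult_le_cancel_left1 intro: mult_left_le)
  also have "\<dots> = K * c powr (p - 1) * ((X / T) powr p * t + (Y / W) powr q * w)"
    using p q1 pos by (subst (1 2) powr_mult) (auto simp add: powr_powr)
  finally show ?thesis .
qed

definition embed_const :: "real \<Rightarrow> real" where
  "embed_const p = 2 powr p * p / (p - 1)"

text \<open>The functions enter as \<open>f * s\<close> and \<open>g * w\<close> so that X/T and Y/W
  are true averages of f and g for the two weighted measures. Only finite families occur here, as
  the selection of maximal members requires; infinite sums follow by taking limits of partial
  sums.\<close>

theorem sparse_form_bound:
  fixes w s f g :: "'a \<Rightarrow> real"
  assumes M: "sigma_finite_measure M" and fin: "finite S" and p: "2 \<le> p" and q: "q = p / (p - 1)"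
    and ws [measurable]: "w \<in> borel_measurable M" "s \<in> borel_measurable M"
    and pos: "\<And>x. 0 < w x" "\<And>x. 0 < s x" "\<And>x. w x * s x powr (p - 1) = 1"
    and Q: "\<And>i. i \<in> S \<Longrightarrow> Q i \<in> sets M"
    and nested: "\<And>i j. i \<in> S \<Longrightarrow> j \<in> S \<Longrightarrow> Q i \<subseteq> Q j \<or> Q j \<subseteq> Q i \<or> Q i \<inter> Q j = {}"
    and E: "\<And>i. i \<in> S \<Longrightarrow> E i \<in> sets M" "\<And>i. i \<in> S \<Longrightarrow> E i \<subseteq> Q i" "disjoint_family_on E S"
    and m: "\<And>i. i \<in> S \<Longrightarrow> emeasure M (Q i) = ennreal (m i)"
    and e: "\<And>i. i \<in> S \<Longrightarrow> emeasure M (E i) = ennreal (e i)" "\<And>i. i \<in> S \<Longrightarrow> 0 < e i"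
           "\<And>i. i \<in> S \<Longrightarrow> m i \<le> c * e i" "\<And>i. i \<in> S \<Longrightarrow> 0 < m i"
    and W: "\<And>i. i \<in> S \<Longrightarrow> (\<integral>\<^sup>+x\<in>Q i. ennreal (w x) \<partial>M) = ennreal (W i)"
    and T: "\<And>i. i \<in> S \<Longrightarrow> (\<integral>\<^sup>+x\<in>Q i. ennreal (s x) \<partial>M) = ennreal (T i)"
    and K: "0 \<le> K" "\<And>i. i \<in> S \<Longrightarrow> W i * T i powr (p - 1) \<le> K * m i powr p"
    and fg [measurable]: "f \<in> borel_measurable M" "g \<in> borel_measurable M"
    and fg0: "\<And>x. 0 \<le> f x" "\<And>x. 0 \<le> g x"
    and f1: "(\<integral>\<^sup>+x. ennreal (f x powr p * s x) \<partial>M) \<le> 1"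
    and g1: "(\<integral>\<^sup>+x. ennreal (g x powr q * w x) \<partial>M) \<le> 1"
  shows "(\<Sum>i\<in>S. (\<integral>\<^sup>+x\<in>Q i. ennreal (f x * s x) \<partial>M) * (\<integral>\<^sup>+x\<in>Q i. ennreal (g x * w x) \<partial>M) / ennreal (m i))
     \<le> ennreal (K * c powr (p - 1) * (embed_const p + embed_const q))"
proof -
  interpret sigma_finite_measure M by fact
  have q1: "1 < q" using p by (auto simp: q field_simps)
  \<comment> \<open>The masses of the top parts must be positive: they occur under the nonpositive
    power 2 - p, and they force the masses of the full boxes, which appear as denominators, to be
    positive.\<close>
  have int_pos: "\<exists>r>0. (\<integral>\<^sup>+x\<in>E i. ennreal (u x) \<partial>M) = ennreal r \<and> r \<le> R"
    if "i \<in> S" and [measurable]: "u \<in> borel_measurable M" and u: "\<And>x. 0 < u x"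
      and R: "(\<integral>\<^sup>+x\<in>Q i. ennreal (u x) \<partial>M) = ennreal R" for i u R
  proof -
    note [measurable] = E(1)[OF that(1)]
    have le: "(\<integral>\<^sup>+x\<in>E i. ennreal (u x) \<partial>M) \<le> ennreal R"
      unfolding R[symmetric] using E(2)[OF that(1)] by (intro nn_integral_mono) (auto simp: indicator_def)
    then obtain r where r: "0 \<le> r" "(\<integral>\<^sup>+x\<in>E i. ennreal (u x) \<partial>M) = ennreal r"
      by (cases "\<integral>\<^sup>+x\<in>E i. ennreal (u x) \<partial>M") (auto simp: top_unique)
    have "r \<noteq> 0"
    proof
      assume "r = 0"
      with r have "(\<integral>\<^sup>+x\<in>E i. ennreal (u x) \<partial>M) = 0" by simp
      then have "AE x in M. ennreal (u x) * indicator (E i) x = 0"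
        by (subst (asm) nn_integral_0_iff_AE) auto
      moreover have "ennreal (u x) \<noteq> 0" for x using u[of x] by simp
      ultimately have "AE x in M. x \<notin> E i" by (auto simp: indicator_def)
      then have "emeasure M (E i) = 0"
        using E(1)[OF that(1)] by (simp add: AE_iff_measurable[OF _ refl] sets.sets_into_space AE_iff_null_sets null_setsD1)
      then show False using e[OF that(1)] by simp
    qed
    moreover have "0 < R" using le r \<open>r \<noteq> 0\<close> by (cases "0 < R") (auto simp: ennreal_neg not_less)
    moreover have "r \<le> R" using le r \<open>0 < R\<close> by simp
    ultimately show ?thesis using r by (intro exI[of _ r]) auto
  qed
  have "\<forall>i\<in>S. \<exists>r>0. (\<integral>\<^sup>+x\<in>E i. ennreal (w x) \<partial>M) = ennreal r \<and> r \<le> W i"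
    using int_pos[of _ w] pos W by auto
  then obtain we where we: "\<And>i. i \<in> S \<Longrightarrow> 0 < we i" "\<And>i. i \<in> S \<Longrightarrow> we i \<le> W i"
      "\<And>i. i \<in> S \<Longrightarrow> (\<integral>\<^sup>+x\<in>E i. ennreal (w x) \<partial>M) = ennreal (we i)" by metis
  have "\<forall>i\<in>S. \<exists>r>0. (\<integral>\<^sup>+x\<in>E i. ennreal (s x) \<partial>M) = ennreal r \<and> r \<le> T i"
    using int_pos[of _ s] pos T by auto
  then obtain te where te: "\<And>i. i \<in> S \<Longrightarrow> 0 < te i" "\<And>i. i \<in> S \<Longrightarrow> te i \<le> T i"
      "\<And>i. i \<in> S \<Longrightarrow> (\<integral>\<^sup>+x\<in>E i. ennreal (s x) \<partial>M) = ennreal (te i)" by metis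
  have int_fin: "\<exists>X\<ge>0. (\<integral>\<^sup>+x\<in>Q i. ennreal (h x * u x) \<partial>M) = ennreal X"
    if "i \<in> S" and [measurable]: "h \<in> borel_measurable M" "u \<in> borel_measurable M"
      and h0: "\<And>x. 0 \<le> h x" and u: "\<And>x. 0 < u x" and r: "1 < r"
      and 1: "(\<integral>\<^sup>+x. ennreal (h x powr r * u x) \<partial>M) \<le> 1" and R: "(\<integral>\<^sup>+x\<in>Q i. ennreal (u x) \<partial>M) = ennreal R"
    for i h u r R
  proof -
    note [measurable] = Q[OF that(1)]
    \<comment> \<open>Finiteness of the averages needs no Hoelder inequality; this crude pointwise
      bound suffices because u has finite mass on the box.\<close>
    have hr: "h x \<le> 1 + h x powr r" for x
    proof (cases "h x \<le> 1")
      case False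
      then have "h x powr 1 \<le> h x powr r" using r by (intro powr_mono) auto
      then show ?thesis using False by simp
    qed (use powr_ge_zero[of "h x" r] in linarith)
    have hru: "h x * u x \<le> u x + h x powr r * u x" for x
      using mult_right_mono[OF hr[of x] less_imp_le[OF u[of x]]] by (simp add: distrib_right)
    have "(\<integral>\<^sup>+x\<in>Q i. ennreal (h x * u x) \<partial>M) \<le> (\<integral>\<^sup>+x. ennreal (u x) * indicator (Q i) x + ennreal (h x powr r * u x) \<partial>M)"
      using hru u h0 by (intro nn_integral_mono)
        (auto simp: indicator_def less_imp_le intro!: ennreal_leI simp flip: ennreal_plus)
    also have "\<dots> = ennreal R + (\<integral>\<^sup>+x. ennreal (h x powr r * u x) \<partial>M)"
      by (subst nn_integral_add) (auto simp: R)
    also have "\<dots> \<le> ennreal R + 1" using 1 by (intro add_left_mono)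
    also have "\<dots> < \<infinity>" by simp
    finally show ?thesis by (cases "\<integral>\<^sup>+x\<in>Q i. ennreal (h x * u x) \<partial>M") auto
  qed
  have "\<forall>i\<in>S. \<exists>X\<ge>0. (\<integral>\<^sup>+x\<in>Q i. ennreal (f x * s x) \<partial>M) = ennreal X"
    using int_fin[of _ f s p] fg0 pos p f1 T by auto
  then obtain X where X: "\<And>i. i \<in> S \<Longrightarrow> 0 \<le> X i"
      "\<And>i. i \<in> S \<Longrightarrow> (\<integral>\<^sup>+x\<in>Q i. ennreal (f x * s x) \<partial>M) = ennreal (X i)" by metis
  have "\<forall>i\<in>S. \<exists>X\<ge>0. (\<integral>\<^sup>+x\<in>Q i. ennreal (g x * w x) \<partial>M) = ennreal X"
    using int_fin[of _ g w q] fg0 pos q1 g1 W by auto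
  then obtain Y where Y: "\<And>i. i \<in> S \<Longrightarrow> 0 \<le> Y i"
      "\<And>i. i \<in> S \<Longrightarrow> (\<integral>\<^sup>+x\<in>Q i. ennreal (g x * w x) \<partial>M) = ennreal (Y i)" by metis
  have embed: "(\<Sum>i\<in>S. ennreal ((Z i / R i) powr r * v i)) \<le> ennreal (embed_const r)"
    if [measurable]: "h \<in> borel_measurable M" "u \<in> borel_measurable M"
      and h0: "\<And>x. 0 \<le> h x" and u: "\<And>x. 0 < u x" and r: "1 < r"
      and 1: "(\<integral>\<^sup>+x. ennreal (h x powr r * u x) \<partial>M) \<le> 1"
      and R: "\<And>i. i \<in> S \<Longrightarrow> (\<integral>\<^sup>+x\<in>Q i. ennreal (u x) \<partial>M) = ennreal (R i)"
      and v: "\<And>i. i \<in> S \<Longrightarrow> (\<integral>\<^sup>+x\<in>E i. ennreal (u x) \<partial>M) = ennreal (v i)"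
      and v0: "\<And>i. i \<in> S \<Longrightarrow> 0 < v i" "\<And>i. i \<in> S \<Longrightarrow> v i \<le> R i"
      and Z0: "\<And>i. i \<in> S \<Longrightarrow> 0 \<le> Z i"
      and Z: "\<And>i. i \<in> S \<Longrightarrow> (\<integral>\<^sup>+x\<in>Q i. ennreal (h x * u x) \<partial>M) = ennreal (Z i)"
    for h u r Z R v
  proof -
    \<comment> \<open>The embedding is applied in the measure with density u. There
      \<open>Z i / R i\<close> is exactly the average of h, so the constant does not depend on
      u.\<close>
    let ?N = "density M (\<lambda>x. ennreal (u x))"
    have N: "sigma_finite_measure ?N"
      using sigma_finite_iff_density_finite[of u] M by simp
    have em: "emeasure ?N (Q i) = ennreal (R i)" "emeasure ?N (E i) = ennreal (v i)" if "i \<in> S" for i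
      using R[OF that] v[OF that] Q[OF that] E(1)[OF that] by (simp_all add: emeasure_density)
    have Rpos: "0 < R i" if "i \<in> S" for i using v0[OF that] by linarith
    have "(\<Sum>i\<in>S. ennreal ((Z i / R i) powr r * v i)) = (\<Sum>i\<in>S. ennreal ((Z i / R i) powr r) * emeasure ?N (E i))"
      by (intro sum.cong refl) (auto simp: em ennreal_mult'' v0 less_imp_le)
    also have "\<dots> \<le> ennreal (2 powr r * r / (r - 1)) * (\<integral>\<^sup>+x. ennreal (h x powr r) \<partial>?N)"
    proof (rule carleson_embedding[OF N fin r, where Q = Q])
      show "ennreal (Z i / R i) * emeasure ?N (Q i) \<le> (\<integral>\<^sup>+x\<in>Q i. ennreal (h x) \<partial>?N)" if "i \<in> S" for i
      proof -
        have "(\<integral>\<^sup>+x\<in>Q i. ennreal (h x) \<partial>?N) = (\<integral>\<^sup>+x. ennreal (u x) * (ennreal (h x) * indicator (Q i) x) \<partial>M)"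
          using Q[OF that] by (subst nn_integral_density) auto
        also have "\<dots> = ennreal (Z i)"
          unfolding Z[OF that, symmetric] using u h0 by (intro nn_integral_cong) (auto simp: ennreal_mult less_imp_le indicator_def mult.commute)
        finally show ?thesis
          using Rpos[OF that] Z0[OF that] by (simp add: em that flip: ennreal_mult)
      qed
      show "0 \<le> Z i / R i" if "i \<in> S" for i using Z0[OF that] Rpos[OF that] by simp
      show "Q i \<subseteq> Q j \<or> Q j \<subseteq> Q i \<or> Q i \<inter> Q j = {}" if "i \<in> S" "j \<in> S" for i j
        using nested[OF that] .
    qed (use E Q em h0 in auto)
    also have "(\<integral>\<^sup>+x. ennreal (h x powr r) \<partial>?N) = (\<integral>\<^sup>+x. ennreal (h x powr r * u x) \<partial>M)"
      using u by (subst nn_integral_density) (auto intro!: nn_integral_cong simp: ennreal_mult'' less_imp_le mult.commute)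
    also have "ennreal (2 powr r * r / (r - 1)) * \<dots> \<le> ennreal (embed_const r) * 1"
      unfolding embed_const_def using 1 by (intro mult_left_mono) auto
    finally show ?thesis by simp
  qed
  let ?A = "\<lambda>i. (X i / T i) powr p * te i" and ?B = "\<lambda>i. (Y i / W i) powr q * we i"
  let ?k = "K * c powr (p - 1)"
  have "(\<Sum>i\<in>S. (\<integral>\<^sup>+x\<in>Q i. ennreal (f x * s x) \<partial>M) * (\<integral>\<^sup>+x\<in>Q i. ennreal (g x * w x) \<partial>M) / ennreal (m i))
     \<le> (\<Sum>i\<in>S. ennreal ?k * (ennreal (?A i) + ennreal (?B i)))"
  proof (rule sum_mono)
    fix i assume i: "i \<in> S"
    note p' = p order.strict_trans2[OF _ p, of 1]
    have WT: "0 < W i" "0 < T i" using we(1,2)[OF i] te(1,2)[OF i] by auto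
    have "X i * Y i / m i \<le> ?k * (?A i + ?B i)"
    proof (rule sparse_term_bound[OF p q e(4,2)[OF i] WT we(1)[OF i] te(1)[OF i] X(1)[OF i] Y(1)[OF i] K(1) e(3)[OF i] te(2)[OF i] K(2)[OF i]])
      show "e i \<le> we i powr (1 / p) * te i powr (1 / q)"
        by (rule holder_weights[of p q w M s "E i"]) (use p' q pos e we te E(1) i in auto)
    qed
    then have "ennreal (X i * Y i / m i) \<le> ennreal (?k * (?A i + ?B i))" by (rule ennreal_leI)
    also have "\<dots> = ennreal ?k * (ennreal (?A i) + ennreal (?B i))"
      using K(1) we(1)[OF i] te(1)[OF i] by (subst ennreal_mult) (auto simp: ennreal_plus less_imp_le)
    finally show "(\<integral>\<^sup>+x\<in>Q i. ennreal (f x * s x) \<partial>M) * (\<integral>\<^sup>+x\<in>Q i. ennreal (g x * w x) \<partial>M) / ennreal (m i)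
      \<le> ennreal ?k * (ennreal (?A i) + ennreal (?B i))"
      using X[OF i] Y[OF i] e(4)[OF i] by (simp add: divide_ennreal flip: ennreal_mult)
  qed
  also have "\<dots> = ennreal ?k * ((\<Sum>i\<in>S. ennreal (?A i)) + (\<Sum>i\<in>S. ennreal (?B i)))"
    by (simp add: sum.distrib flip: sum_distrib_left)
  also have "\<dots> \<le> ennreal ?k * (ennreal (embed_const p) + ennreal (embed_const q))"
  proof (intro mult_left_mono add_mono)
    show "(\<Sum>i\<in>S. ennreal (?A i)) \<le> ennreal (embed_const p)"
      by (rule embed[of f s]) (use fg0 pos p f1 T te X in auto)
    show "(\<Sum>i\<in>S. ennreal (?B i)) \<le> ennreal (embed_const q)"
      by (rule embed[of g w]) (use fg0 pos q1 g1 W we Y in auto)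
  qed auto
  also have "\<dots> = ennreal (?k * (embed_const p + embed_const q))"
    using K(1) p q1 by (subst ennreal_mult) (auto simp: embed_const_def ennreal_plus)
  finally show ?thesis .
qed

section \<open>Area formula for conformal maps\<close>

text \<open>The change of variables formula used below is stated on Cartesian powers of the reals
  with a matrix determinant. These two maps carry Lebesgue measure back and forth between that
  setting and the complex plane.\<close>

definition cvec :: "complex \<Rightarrow> real^2" where
  "cvec z = vector [Re z, Im z]"

definition vecc :: "real^2 \<Rightarrow> complex" where
  "vecc x = Complex (x $ 1) (x $ 2)"

lemma cvec_vecc [simp]: "cvec (vecc x) = x" and vecc_cvec [simp]: "vecc (cvec z) = z"
  by (simp_all add: cvec_def vecc_def vec_eq_iff forall_2)

lemma bounded_linear_cvec: "bounded_linear cvec"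
  by (intro linear_conv_bounded_linear[THEN iffD1] linearI) (auto simp: cvec_def vec_eq_iff forall_2)

lemma bounded_linear_vecc: "bounded_linear vecc"
  by (intro linear_conv_bounded_linear[THEN iffD1] linearI) (auto simp: vecc_def complex_eq_iff)

lemma continuous_on_vecc [continuous_intros]: "continuous_on A vecc"
  using bounded_linear_vecc by (rule linear_continuous_on)

lemma measurable_vecc [measurable]: "vecc \<in> borel_measurable borel"
  by (intro borel_measurable_continuous_onI continuous_intros)

lemma cvec_image: "cvec ` A = vecc -` A"
  by (auto simp: image_iff) (metis cvec_vecc)

lemma lborel_distr_vecc: "distr lborel borel vecc = (lborel :: complex measure)"
proof (rule lborel_eqI[symmetric])
  fix l u :: complex
  have box: "vecc -` box l u = box (cvec l) (cvec u)"
    by (auto simp: in_box_complex_iff mem_box_cart cvec_def vecc_def forall_2)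
  assume "\<And>b. b \<in> Basis \<Longrightarrow> l \<bullet> b \<le> u \<bullet> b"
  from this[of 1] this[of \<i>] have le: "Re l \<le> Re u" "Im l \<le> Im u" by (auto simp: Basis_complex_def)
  have B: "(Basis :: (real^2) set) = {axis 1 1, axis 2 1}"
    by (auto simp: Basis_vec_def) (metis exhaust_2)
  have ne: "axis 1 1 \<noteq> (axis 2 1 :: real^2)" by (simp add: axis_eq_axis)
  have "emeasure (distr lborel borel vecc) (box l u) = emeasure lborel (box (cvec l) (cvec u))"
    by (subst emeasure_distr) (auto simp: box)
  also have "\<dots> = (\<Prod>b\<in>Basis. (cvec u - cvec l) \<bullet> b)"
    using le by (intro emeasure_lborel_box) (auto simp: B inner_axis cvec_def)
  also have "\<dots> = (\<Prod>b\<in>Basis. (u - l) \<bullet> b)"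
    using ne by (simp add: B inner_axis cvec_def Basis_complex_def)
  finally show "emeasure (distr lborel borel vecc) (box l u) = (\<Prod>b\<in>Basis. (u - l) \<bullet> b)" .
qed simp

lemma cvec_image_lebesgue: "A \<in> sets lebesgue \<Longrightarrow> cvec ` A \<in> sets lebesgue"
  by (rule differentiable_image_in_sets_lebesgue)
     (auto intro: bounded_linear_imp_differentiable_on bounded_linear_cvec)

lemma emeasure_cvec_image:
  assumes "A \<in> sets lebesgue"
  shows "emeasure lebesgue (cvec ` A) = emeasure lebesgue A"
proof -
  have borel: "emeasure lborel (cvec ` B) = emeasure lborel B" if "B \<in> sets borel" for B
    using that by (subst lborel_distr_vecc[symmetric], subst emeasure_distr) (auto simp: cvec_image)
  have cborel: "cvec ` B \<in> sets borel" if "B \<in> sets borel" for B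
    unfolding cvec_image using measurable_sets[OF measurable_vecc that] by simp
  \<comment> \<open>Equality of the measures is known on Borel sets; a Lebesgue set differs from a
    Borel set by a subset of a Borel null set, and that null set is handled by the Borel
    case.\<close>
  obtain B N N' where A: "A = B \<union> N" "N \<subseteq> N'" "N' \<in> null_sets lborel" "B \<in> sets lborel"
    using sets_completionE[OF assms] by metis
  have N': "cvec ` N' \<in> null_sets lborel"
    using A(3) borel[of N'] cborel[of N'] by (auto simp: null_sets_def)
  have null: "N \<in> null_sets lebesgue" "cvec ` N \<in> null_sets lebesgue"
    using A(2,3) N' null_sets_completionI completion.complete2
    by (metis null_sets_completion_iff2, metis null_sets_completion_iff2 image_mono)
  have Bm: "B \<in> sets lebesgue" "cvec ` B \<in> sets lebesgue"
    using A(4) cborel[of B] by auto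
  have "emeasure lebesgue (cvec ` A) = emeasure lebesgue (cvec ` B)"
    unfolding A(1) image_Un by (rule emeasure_Un_null_set[OF Bm(2) null(2)])
  also have "\<dots> = emeasure lebesgue B"
    using A(4) cborel[of B] borel[of B] by (simp add: emeasure_completion main_part_sets)
  also have "\<dots> = emeasure lebesgue A"
    unfolding A(1) by (rule emeasure_Un_null_set[OF Bm(1) null(1), symmetric])
  finally show ?thesis .
qed

lemma measurable_vecc_lebesgue [measurable]: "vecc \<in> lebesgue \<rightarrow>\<^sub>M lebesgue"
  by (rule measurableI) (use cvec_image_lebesgue in \<open>auto simp: cvec_image\<close>)

lemma lebesgue_distr_vecc: "distr lebesgue lebesgue vecc = lebesgue"
proof (rule measure_eqI)
  fix A :: "complex set" assume A: "A \<in> sets (distr lebesgue lebesgue vecc)"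
  then show "emeasure (distr lebesgue lebesgue vecc) A = emeasure lebesgue A"
    using emeasure_cvec_image[of A] by (subst emeasure_distr) (auto simp: cvec_image)
qed simp

text \<open>The real derivative of \<psi> is multiplication by the complex number
  \<open>deriv \<psi> z\<close>, whose matrix has determinant
  \<open>(cmod (deriv \<psi> z))\<^sup>2\<close>; the rest is the area formula for injective
  differentiable maps. Both sides may be infinite.\<close>

lemma emeasure_holomorphic_image:
  fixes \<psi> :: "complex \<Rightarrow> complex"
  assumes S: "open S" and hol: "\<psi> holomorphic_on S" and inj: "inj_on \<psi> S"
    and E: "E \<in> sets lebesgue" "E \<subseteq> S"
  shows "\<psi> ` E \<in> sets lebesgue"
    and "emeasure lebesgue (\<psi> ` E) = (\<integral>\<^sup>+z\<in>E. ennreal ((cmod (deriv \<psi> z))\<^sup>2) \<partial>lebesgue)"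
proof -
  define g where "g = cvec \<circ> \<psi> \<circ> vecc"
  define g' where "g' x = cvec \<circ> (\<lambda>h. deriv \<psi> (vecc x) * h) \<circ> vecc" for x
  define J where "J z = (cmod (deriv \<psi> z))\<^sup>2" for z
  have der\<psi>: "(\<psi> has_derivative (\<lambda>h. deriv \<psi> z * h)) (at z)" if "z \<in> S" for z
    using holomorphic_derivI[OF hol S that, of UNIV] by (simp add: has_field_derivative_def)
  have \<psi>E: "\<psi> ` E \<in> sets lebesgue"
    using der\<psi> E by (intro differentiable_image_in_sets_lebesgue)
      (auto simp: differentiable_on_def differentiable_def intro: has_derivative_at_withinI)
  then show "\<psi> ` E \<in> sets lebesgue" .
  have E': "cvec ` E \<in> sets lebesgue" using E cvec_image_lebesgue by blast
  have der: "(g has_derivative g' x) (at x within cvec ` E)" if "x \<in> cvec ` E" for x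
  proof -
    have "vecc x \<in> S" using that E by auto
    from der\<psi>[OF this] show ?thesis unfolding g_def g'_def
      by (intro diff_chain_within has_derivative_at_withinI[OF bounded_linear_imp_has_derivative] bounded_linear_vecc
             bounded_linear_cvec) (auto intro: has_derivative_at_withinI)
  qed
  have inj': "inj_on g (cvec ` E)"
    using inj E unfolding g_def inj_on_def by (auto simp: subset_iff) (metis vecc_cvec)
  have det: "\<bar>det (matrix (g' x))\<bar> = J (vecc x)" for x
    unfolding J_def cmod_power2
    by (simp add: det_2 matrix_def g'_def cvec_def vecc_def axis_def power2_eq_square)
  have img: "g ` cvec ` E = cvec ` \<psi> ` E" by (simp add: g_def image_comp)
  have gE: "cvec ` \<psi> ` E \<in> sets lebesgue" using \<psi>E cvec_image_lebesgue by blast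
  note iff = has_measure_differentiable_image[OF E' der inj', unfolded det img]
  have Jcont: "continuous_on S J"
    unfolding J_def using hol S by (intro continuous_intros holomorphic_on_imp_continuous_on holomorphic_deriv)
  have Jm: "(\<lambda>z. ennreal (J z) * indicator E z) \<in> borel_measurable lebesgue"
  proof -
    have "J \<in> borel_measurable (lebesgue_on S)"
      using Jcont S by (intro continuous_imp_measurable_on_sets_lebesgue) auto
    then have "J \<in> borel_measurable (lebesgue_on E)"
      using E(2) by (rule measurable_restrict_mono)
    then have "(\<lambda>z. J z * indicator E z) \<in> borel_measurable lebesgue"
      using E(1) by (subst (asm) borel_measurable_restrict_space_iff) (auto simp: mult.commute)
    then have "(\<lambda>z. ennreal (J z * indicator E z)) \<in> borel_measurable lebesgue" by measurable
    moreover have "(\<lambda>z. ennreal (J z * indicator E z)) = (\<lambda>z. ennreal (J z) * indicator E z)"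
      by (auto simp: indicator_def)
    ultimately show ?thesis by simp
  qed
  have tr: "(\<integral>\<^sup>+z\<in>E. ennreal (J z) \<partial>lebesgue) = (\<integral>\<^sup>+x. ennreal (J (vecc x) * indicator (cvec ` E) x) \<partial>lebesgue)"
    by (subst lebesgue_distr_vecc[symmetric], subst nn_integral_distr)
       (use Jm in \<open>auto intro!: nn_integral_cong simp: cvec_image indicator_def\<close>)
  have Jm': "(\<lambda>x. J (vecc x) * indicator (cvec ` E) x) \<in> borel_measurable lebesgue"
  proof -
    have "(\<lambda>x. enn2real (ennreal (J (vecc x)) * indicator E (vecc x))) \<in> borel_measurable lebesgue"
      using measurable_compose[OF measurable_vecc_lebesgue Jm] by measurable
    moreover have "(\<lambda>x. enn2real (ennreal (J (vecc x)) * indicator E (vecc x))) = (\<lambda>x. J (vecc x) * indicator (cvec ` E) x)"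
      by (auto simp: indicator_def cvec_image J_def)
    ultimately show ?thesis by simp
  qed
  have hi: "((\<lambda>x. J (vecc x) * indicator (cvec ` E) x) has_integral r) UNIV \<longleftrightarrow> ((\<lambda>x. J (vecc x)) has_integral r) (cvec ` E)" for r
  proof -
    have "(\<lambda>x. J (vecc x) * indicator (cvec ` E) x) = (\<lambda>x. if x \<in> cvec ` E then J (vecc x) else 0)"
      by (auto simp: indicator_def)
    then show ?thesis by (simp add: has_integral_restrict_UNIV)
  qed
  have "emeasure lebesgue (cvec ` \<psi> ` E) = (\<integral>\<^sup>+z\<in>E. ennreal (J z) \<partial>lebesgue)"
  \<comment> \<open>The underlying formula is an equivalence about finite measure and integrability.
    If the image has infinite measure, a finite integral would make the image measurable with finite
    measure, which is absurd.\<close>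
  proof (cases "emeasure lebesgue (cvec ` \<psi> ` E) < \<infinity>")
    case True
    then have lm: "cvec ` \<psi> ` E \<in> lmeasurable" using gE by (simp add: fmeasurable_def)
    then have "((\<lambda>x. J (vecc x)) has_integral measure lebesgue (cvec ` \<psi> ` E)) (cvec ` E)"
      using iff by blast
    then have "(\<integral>\<^sup>+x. ennreal (J (vecc x) * indicator (cvec ` E) x) \<partial>lebesgue) = ennreal (measure lebesgue (cvec ` \<psi> ` E))"
      unfolding hi[symmetric] by (subst (asm) has_integral_iff_nn_integral_lebesgue) (auto simp: J_def)
    then show ?thesis using lm by (simp add: tr emeasure_eq_measure2)
  next
    case False
    have "(\<integral>\<^sup>+x. ennreal (J (vecc x) * indicator (cvec ` E) x) \<partial>lebesgue) = \<infinity>"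
    proof (rule ccontr)
      assume "\<not> ?thesis"
      then obtain r where r: "0 \<le> r" "(\<integral>\<^sup>+x. ennreal (J (vecc x) * indicator (cvec ` E) x) \<partial>lebesgue) = ennreal r"
        by (cases "\<integral>\<^sup>+x. ennreal (J (vecc x) * indicator (cvec ` E) x) \<partial>lebesgue") auto
      have "integrable lebesgue (\<lambda>x. J (vecc x) * indicator (cvec ` E) x)"
        using Jm' r by (intro integrableI_nonneg) (auto simp: J_def)
      then have "(\<lambda>x. J (vecc x) * indicator (cvec ` E) x) integrable_on UNIV"
        by (rule integrable_on_lebesgue)
      then have "cvec ` \<psi> ` E \<in> lmeasurable" using hi iff unfolding integrable_on_def by blast
      with False show False by (auto simp: fmeasurable_def)
    qed
    with False show ?thesis by (simp add: tr not_less top_unique)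
  qed
  then show "emeasure lebesgue (\<psi> ` E) = (\<integral>\<^sup>+z\<in>E. ennreal ((cmod (deriv \<psi> z))\<^sup>2) \<partial>lebesgue)"
    by (simp add: emeasure_cvec_image[OF \<psi>E] J_def)
qed

section \<open>Normalized area measure and conformal change of variables\<close>

lemma sets_dA [simp, measurable_cong]: "sets dA = sets lebesgue" and space_dA [simp]: "space dA = UNIV"
  by (simp_all add: dA_def)

lemma emeasure_dA: "A \<in> sets lebesgue \<Longrightarrow> emeasure dA A = ennreal (1 / pi) * emeasure lebesgue A"
  by (simp add: dA_def emeasure_density nn_integral_cmult)

lemma nn_integral_dA:
  "f \<in> borel_measurable lebesgue \<Longrightarrow> (\<integral>\<^sup>+z. f z \<partial>dA) = ennreal (1 / pi) * (\<integral>\<^sup>+z. f z \<partial>lebesgue)"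
  by (simp add: dA_def nn_integral_density nn_integral_cmult)

lemma AE_dA_iff: "(AE z in dA. P z) \<longleftrightarrow> (AE z in lebesgue. P z)"
  unfolding dA_def by (subst AE_density) auto

lemma emeasure_dA_cball: "0 \<le> r \<Longrightarrow> emeasure dA (cball z r) = ennreal (r\<^sup>2)"
  and emeasure_dA_ball: "0 \<le> r \<Longrightarrow> emeasure dA (ball z r) = ennreal (r\<^sup>2)"
  by (simp_all add: emeasure_dA emeasure_cball emeasure_ball eval_unit_ball_vol flip: ennreal_mult)

abbreviation area_on :: "complex set \<Rightarrow> complex measure" where
  "area_on S \<equiv> restrict_space dA S"

lemma measurable_deriv_sq:
  assumes "open S" "\<psi> holomorphic_on S"
  shows "(\<lambda>z. (cmod (deriv \<psi> z))\<^sup>2) \<in> borel_measurable (area_on S)"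
proof -
  have "continuous_on S (\<lambda>z. (cmod (deriv \<psi> z))\<^sup>2)"
    using assms by (intro continuous_intros holomorphic_on_imp_continuous_on holomorphic_deriv)
  then have "(\<lambda>z. (cmod (deriv \<psi> z))\<^sup>2) \<in> borel_measurable (lebesgue_on S)"
    using assms by (intro continuous_imp_measurable_on_sets_lebesgue) auto
  then show ?thesis
    by (rule measurable_cong_sets[THEN equalityD1, THEN subsetD, rotated -1]) (auto simp: sets_restrict_space)
qed

context
  fixes S \<psi>
  assumes S: "open S" and hol: "\<psi> holomorphic_on S" and inj: "inj_on \<psi> S"
begin

lemma conformal_image_open: "open (\<psi> ` S)"
  by (rule open_mapping_thm3[OF hol S inj])

lemma conformal_measurable [measurable]: "\<psi> \<in> area_on S \<rightarrow>\<^sub>M area_on (\<psi> ` S)"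
proof (rule measurableI)
  fix A assume A: "A \<in> sets (area_on (\<psi> ` S))"
  \<comment> \<open>The preimage of a set under \<psi> is its image under the holomorphic inverse,
    and holomorphic images of Lebesgue sets are Lebesgue sets. Continuity of \<psi> alone would
    handle Borel sets only.\<close>
  obtain h where h: "h holomorphic_on (\<psi> ` S)" "\<And>z. z \<in> S \<Longrightarrow> h (\<psi> z) = z"
    using holomorphic_has_inverse[OF hol S inj] by metis
  have A': "A \<in> sets lebesgue" "A \<subseteq> \<psi> ` S"
    using A conformal_image_open by (auto simp: sets_restrict_space_iff)
  have inj': "inj_on h (\<psi> ` S)" using h(2) by (auto simp: inj_on_def)
  have "h ` A \<in> sets lebesgue"
    by (rule emeasure_holomorphic_image(1)[OF conformal_image_open h(1) inj' A'])
  moreover have "\<psi> -` A \<inter> S = h ` A" using h(2) A'(2) by force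
  ultimately show "\<psi> -` A \<inter> space (area_on S) \<in> sets (area_on S)"
    using S by (auto simp: sets_restrict_space_iff space_restrict_space)
qed (auto simp: space_restrict_space)

text \<open>The area formula restated as an equality of measures: nonnegative integrals, Bochner
  integrals and almost everywhere statements then transfer by the general facts on
  \<open>distr\<close> and \<open>density\<close>.\<close>

lemma conformal_distr:
  "distr (density (area_on S) (\<lambda>z. ennreal ((cmod (deriv \<psi> z))\<^sup>2))) (area_on (\<psi> ` S)) \<psi> = area_on (\<psi> ` S)" (is "?N = _")
proof (rule measure_eqI)
  note [measurable] = measurable_deriv_sq[OF S hol]
  fix A assume "A \<in> sets ?N"
  then have A: "A \<in> sets (area_on (\<psi> ` S))" by simp
  have A': "A \<in> sets lebesgue" "A \<subseteq> \<psi> ` S"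
    using A conformal_image_open by (auto simp: sets_restrict_space_iff)
  let ?E = "\<psi> -` A \<inter> S"
  have Er: "?E \<in> sets (area_on S)"
    using measurable_sets[OF conformal_measurable A] by (simp add: space_restrict_space)
  then have E: "?E \<in> sets lebesgue" "?E \<subseteq> S"
    using S by (auto simp: sets_restrict_space_iff)
  have img: "\<psi> ` ?E = A" using A'(2) by auto
  let ?d = "\<lambda>z. ennreal ((cmod (deriv \<psi> z))\<^sup>2)"
  have m: "(\<lambda>z. ?d z * indicator ?E z) \<in> borel_measurable lebesgue"
  proof -
    have "(\<lambda>z. ?d z * indicator ?E z) \<in> borel_measurable (area_on S)"
      using Er by measurable
    then have "(\<lambda>z. (?d z * indicator ?E z) * indicator S z) \<in> borel_measurable dA"
      using S by (subst (asm) borel_measurable_restrict_space_iff_ennreal) auto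
    moreover have "(\<lambda>z. (?d z * indicator ?E z) * indicator S z) = (\<lambda>z. ?d z * indicator ?E z)"
      by (auto simp: indicator_def)
    ultimately show ?thesis by simp
  qed
  have "emeasure ?N A
     = (\<integral>\<^sup>+z. ?d z * indicator ?E z \<partial>area_on S)"
    using A Er by (subst emeasure_distr) (auto simp: emeasure_density space_restrict_space)
  also have "\<dots> = (\<integral>\<^sup>+z. ?d z * indicator ?E z \<partial>dA)"
    using S by (subst nn_integral_restrict_space) (auto intro!: nn_integral_cong simp: indicator_def)
  also have "\<dots> = ennreal (1 / pi) * emeasure lebesgue (\<psi> ` ?E)"
    unfolding emeasure_holomorphic_image(2)[OF S hol inj E] using m by (rule nn_integral_dA)
  also have "\<dots> = emeasure (area_on (\<psi> ` S)) A"
    unfolding img using A' conformal_image_open by (subst emeasure_restrict_space) (auto simp: emeasure_dA)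
  finally show "emeasure ?N A
     = emeasure (area_on (\<psi> ` S)) A" .
qed simp

lemma conformal_nn_integral:
  assumes [measurable]: "f \<in> borel_measurable (area_on (\<psi> ` S))"
  shows "(\<integral>\<^sup>+z. f z \<partial>area_on (\<psi> ` S)) = (\<integral>\<^sup>+z. ennreal ((cmod (deriv \<psi> z))\<^sup>2) * f (\<psi> z) \<partial>area_on S)"
proof -
  note [measurable] = measurable_deriv_sq[OF S hol]
  show ?thesis
    by (subst conformal_distr[symmetric], subst nn_integral_distr) (auto simp: nn_integral_density)
qed

lemma conformal_integral:
  fixes f :: "complex \<Rightarrow> complex"
  assumes [measurable]: "f \<in> borel_measurable (area_on (\<psi> ` S))"
  shows "(\<integral>z. f z \<partial>area_on (\<psi> ` S)) = (\<integral>z. (cmod (deriv \<psi> z))\<^sup>2 *\<^sub>R f (\<psi> z) \<partial>area_on S)"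
proof -
  note [measurable] = measurable_deriv_sq[OF S hol]
  show ?thesis
    by (subst conformal_distr[symmetric], subst integral_distr) (auto simp: integral_density)
qed

lemma conformal_deriv_nonzero: "z \<in> S \<Longrightarrow> deriv \<psi> z \<noteq> 0"
  using holomorphic_injective_imp_regular[OF hol S inj] by blast

text \<open>The density is strictly positive because an injective holomorphic map has no critical
  points, so null sets of the image pull back to null sets.\<close>

lemma conformal_AE:
  assumes "AE z in area_on (\<psi> ` S). P z"
  shows "AE z in area_on S. P (\<psi> z)"
proof -
  note [measurable] = measurable_deriv_sq[OF S hol]
  have "AE z in density (area_on S) (\<lambda>z. ennreal ((cmod (deriv \<psi> z))\<^sup>2)). P (\<psi> z)"
  proof (rule AE_distrD[where M' = "area_on (\<psi> ` S)"])
    show "AE z in distr (density (area_on S) (\<lambda>z. ennreal ((cmod (deriv \<psi> z))\<^sup>2))) (area_on (\<psi> ` S)) \<psi>. P z"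
      unfolding conformal_distr by (rule assms)
  qed simp
  then have "AE z in area_on S. 0 < ennreal ((cmod (deriv \<psi> z))\<^sup>2) \<longrightarrow> P (\<psi> z)"
    by (subst (asm) AE_density) auto
  then show ?thesis
    by (rule AE_mp) (auto intro!: AE_I2 simp: space_restrict_space conformal_deriv_nonzero)
qed

end

section \<open>Dyadic Carleson boxes\<close>

text \<open>The argument measured in full turns, with values in [0,1), to match the normalization of
  arc length.\<close>

definition ang :: "complex \<Rightarrow> real" where
  "ang z = Arg2pi z / (2 * pi)"

lemma ang_polar: "z = of_real (cmod z) * cis (2 * pi * ang z)"
  using Arg2pi_eq[of z] by (simp add: ang_def cis_conv_exp)

lemma ang_cis:
  assumes "0 < r" "z = of_real r * cis (2 * pi * t)"
  shows "ang z = frac t"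
proof -
  have "cis (2 * pi * t) = cis (2 * pi * frac t) * cis (2 * pi * of_int \<lfloor>t\<rfloor>)"
    by (simp add: cis_mult frac_def algebra_simps)
  also have "cis (2 * pi * of_int \<lfloor>t\<rfloor>) = 1"
    by (rule cis_multiple_2pi) simp
  finally have "of_real r * exp (\<i> * of_real (2 * pi * frac t)) = z"
    using assms by (simp add: cis_conv_exp)
  then have "Arg2pi z = 2 * pi * frac t"
    using assms(1) frac_lt_1[of t] by (intro Arg2pi_unique) auto
  then show ?thesis by (simp add: ang_def)
qed

lemma ang_rotate:
  assumes "z \<noteq> 0"
  shows "ang (z * cis (2 * pi * t)) = frac (ang z + t)"
proof (rule ang_cis)
  show "z * cis (2 * pi * t) = of_real (cmod z) * cis (2 * pi * (ang z + t))"
    by (subst ang_polar[of z]) (simp add: cis_mult algebra_simps)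
qed (use assms in auto)

lemma measurable_ang [measurable]: "ang \<in> borel_measurable borel"
proof -
  have "Arg2pi \<in> borel_measurable borel"
    by (rule borel_measurableI_greater) (use open_Arg2pi2pi_gt in auto)
  then show ?thesis unfolding ang_def by measurable
qed

text \<open>Dyadic box of generation n and sector j, in the angular grid rotated by s. Taking the
  floor makes the sectors half-open, so two boxes of one grid are exactly nested or disjoint.
  Generation 0 is the whole disc, and sectors with j >= 2^n are empty, which permits indexing by all
  pairs of naturals.\<close>

definition dbox :: "real \<Rightarrow> nat \<times> nat \<Rightarrow> complex set" where
  "dbox s i = {z\<in>ball 0 1. 1 - cmod z \<le> 1 / 2 ^ fst i \<and> \<lfloor>2 ^ fst i * frac (ang z + s)\<rfloor> = int (snd i)}"

text \<open>For fixed s these top halves tile the disc: the radius determines the generation and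
  then the angle determines the sector. They are the disjoint sets \<open>E i\<close> of the
  embedding.\<close>

definition dtop :: "real \<Rightarrow> nat \<times> nat \<Rightarrow> complex set" where
  "dtop s i = {z\<in>dbox s i. 1 / 2 ^ Suc (fst i) < 1 - cmod z}"

lemma dbox_borel [measurable]: "dbox s i \<in> sets borel"
proof -
  have [measurable]: "(\<lambda>x::real. frac x) \<in> borel_measurable borel" unfolding frac_def by measurable
  have "{z::complex. cmod z < 1 \<and> 1 - cmod z \<le> 1 / 2 ^ fst i \<and> \<lfloor>2 ^ fst i * frac (ang z + s)\<rfloor> = int (snd i)} \<in> sets borel"
    by measurable
  then show ?thesis by (simp add: dbox_def)
qed

lemma dtop_borel [measurable]: "dtop s i \<in> sets borel"
proof -
  have "dtop s i = dbox s i \<inter> {z. 1 / 2 ^ Suc (fst i) < 1 - cmod z}" by (auto simp: dtop_def)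
  moreover have "{z::complex. 1 / 2 ^ Suc (fst i) < 1 - cmod z} \<in> sets borel" by measurable
  ultimately show ?thesis by auto
qed

lemma dtop_subset: "dtop s i \<subseteq> dbox s i"
  by (auto simp: dtop_def)

text \<open>The coarse cell containing x is determined by the fine one through integer division of
  its number; this is the source of nestedness.\<close>

lemma floor_dyadic_div:
  assumes "m \<le> n"
  shows "\<lfloor>2 ^ m * (x::real)\<rfloor> = \<lfloor>2 ^ n * x\<rfloor> div 2 ^ (n - m)"
proof -
  have "(2::real) ^ n = 2 ^ m * 2 ^ (n - m)" using assms by (simp flip: power_add)
  then have "2 ^ m * x = (2 ^ n * x) / of_int (2 ^ (n - m))" by simp
  then show ?thesis by (metis floor_divide_real_eq_div zero_le_numeral zero_le_power)
qed

lemma dbox_nested: "dbox s i \<subseteq> dbox s j \<or> dbox s j \<subseteq> dbox s i \<or> dbox s i \<inter> dbox s j = {}"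
proof -
  have *: "dbox s i \<subseteq> dbox s j \<or> dbox s i \<inter> dbox s j = {}" if le: "fst j \<le> fst i" for i j
  proof (cases "int (snd i) div 2 ^ (fst i - fst j) = int (snd j)")
    case True
    have "(1::real) / 2 ^ fst i \<le> 1 / 2 ^ fst j"
      using le by (intro divide_left_mono power_increasing) auto
    then have "dbox s i \<subseteq> dbox s j"
      using True by (auto simp: dbox_def floor_dyadic_div[OF le])
    then show ?thesis ..
  next
    case False
    then show ?thesis by (auto simp: dbox_def floor_dyadic_div[OF le])
  qed
  show ?thesis using *[of i j] *[of j i] nat_le_linear[of "fst i" "fst j"] by blast
qed

lemma dtop_disjoint: "disjoint_family (dtop s)"
proof (unfold disjoint_family_on_def, intro ballI impI)
  fix i j :: "nat \<times> nat" assume ne: "i \<noteq> j"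
  have lvl: "fst i \<le> fst j" if "z \<in> dtop s i" "z \<in> dtop s j" for z i j
  proof (rule ccontr)
    assume "\<not> ?thesis"
    then have "(1::real) / 2 ^ fst i \<le> 1 / 2 ^ Suc (fst j)"
      by (intro divide_left_mono power_increasing) auto
    then show False using that by (auto simp: dtop_def dbox_def)
  qed
  have "fst i = fst j" "snd i = snd j" if "z \<in> dtop s i" "z \<in> dtop s j" for z
  proof -
    show "fst i = fst j" using lvl[OF that] lvl[OF that(2,1)] by simp
    then show "snd i = snd j" using that by (auto simp: dtop_def dbox_def)
  qed
  then show "dtop s i \<inter> dtop s j = {}" using ne by (auto simp: prod_eq_iff)
qed

text \<open>The centre is the midpoint of the arc below the sector, and the length is unchanged.
  Hence bounds over genuine Carleson boxes control the dyadic ones.\<close>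

lemma dbox_subset_carleson:
  "dbox s i \<subseteq> carleson_box (2 * pi * ((real (snd i) + 1 / 2) / 2 ^ fst i - s)) (1 / 2 ^ fst i)"
proof
  fix z assume z: "z \<in> dbox s i"
  define x where "x = frac (ang z + s)"
  define k where "k = \<lfloor>ang z + s\<rfloor>"
  have ang: "ang z = x - s + k" by (simp add: x_def k_def frac_def)
  have "cis (2 * pi * ang z) = cis (2 * pi * (x - s)) * cis (2 * pi * of_int k)"
    by (simp add: ang cis_mult algebra_simps)
  also have "cis (2 * pi * of_int k) = 1" by (rule cis_multiple_2pi) simp
  finally have zeq: "z = of_real (cmod z) * cis (2 * pi * (x - s))"
    using ang_polar[of z] by simp
  have fl: "\<lfloor>2 ^ fst i * x\<rfloor> = int (snd i)" using z by (simp add: dbox_def x_def)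
  have "real (snd i) \<le> 2 ^ fst i * x" "2 ^ fst i * x < real (snd i) + 1"
    using fl by (auto simp: floor_eq_iff)
  then have "\<bar>2 ^ fst i * x - (real (snd i) + 1 / 2)\<bar> \<le> 1 / 2" by linarith
  then have "\<bar>2 ^ fst i * x - (real (snd i) + 1 / 2)\<bar> / 2 ^ fst i \<le> 1 / 2 / 2 ^ fst i"
    by (intro divide_right_mono) auto
  also have "\<bar>2 ^ fst i * x - (real (snd i) + 1 / 2)\<bar> / 2 ^ fst i = \<bar>x - (real (snd i) + 1 / 2) / 2 ^ fst i\<bar>"
  proof -
    have "x - (real (snd i) + 1 / 2) / 2 ^ fst i = (2 ^ fst i * x - (real (snd i) + 1 / 2)) / 2 ^ fst i"
      by (simp add: diff_divide_distrib)
    then show ?thesis by (simp only: abs_divide) simp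
  qed
  finally have "2 * pi * \<bar>x - (real (snd i) + 1 / 2) / 2 ^ fst i\<bar> \<le> 2 * pi * (1 / 2 / 2 ^ fst i)"
    by (intro mult_left_mono) auto
  then have "\<bar>2 * pi * (x - s) - 2 * pi * ((real (snd i) + 1 / 2) / 2 ^ fst i - s)\<bar> \<le> pi * (1 / 2 ^ fst i)"
    by (simp add: abs_mult flip: right_diff_distrib)
  moreover have "0 \<le> cmod z" "cmod z < 1" "1 - cmod z \<le> 1 / 2 ^ fst i" using z by (auto simp: dbox_def)
  ultimately show "z \<in> carleson_box (2 * pi * ((real (snd i) + 1 / 2) / 2 ^ fst i - s)) (1 / 2 ^ fst i)"
    unfolding carleson_box_def using zeq by blast
qed

section \<open>Measurability and area of the boxes\<close>

lemma carleson_box_borel [measurable]: "carleson_box \<theta> l \<in> sets borel"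
proof -
  \<comment> \<open>Closing the radial interval at 1 makes the polar rectangle compact; the open
    disc removes the added boundary points.\<close>
  have "carleson_box \<theta> l = (\<lambda>(r, t). of_real r * cis t) ` ({max 0 (1 - l)..1} \<times> {\<theta> - pi * l..\<theta> + pi * l}) \<inter> ball 0 1" (is "_ = ?R")
  proof
    show "carleson_box \<theta> l \<subseteq> ?R"
      by (force simp: carleson_box_def norm_mult abs_le_iff)
    show "?R \<subseteq> carleson_box \<theta> l"
      by (force simp: carleson_box_def norm_mult abs_le_iff)
  qed
  moreover have "compact ((\<lambda>(r, t). of_real r * cis t) ` ({max 0 (1 - l)..1} \<times> {\<theta> - pi * l..\<theta> + pi * l}))"
    unfolding case_prod_beta by (intro compact_continuous_image compact_Times continuous_intros) auto
  ultimately show ?thesis by (metis borel_compact borel_open open_ball sets.Int)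
qed

lemma carleson_box_subset: "carleson_box \<theta> l \<subseteq> ball 0 1"
  by (auto simp: carleson_box_def norm_mult)

lemma carleson_box_1: "carleson_box 0 1 = ball 0 1"
proof
  show "ball 0 1 \<subseteq> carleson_box 0 1"
  proof
    fix z :: complex assume z: "z \<in> ball 0 1"
    have "\<bar>Arg z\<bar> \<le> pi" using mpi_less_Arg[of z] Arg_le_pi[of z] by linarith
    moreover have "z = of_real (cmod z) * cis (Arg z)" using rcis_cmod_Arg[of z] by (simp add: rcis_def)
    ultimately have "z = of_real (cmod z) * cis (Arg z) \<and> 0 \<le> cmod z \<and> cmod z < 1 \<and> 1 - cmod z \<le> 1 \<and> \<bar>Arg z - 0\<bar> \<le> pi * 1"
      using z by simp
    then show "z \<in> carleson_box 0 1" unfolding carleson_box_def by blast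
  qed
qed (rule carleson_box_subset)

lemma carleson_box_area:
  assumes "0 < l"
  shows "emeasure dA (carleson_box \<theta> l) \<le> ennreal ((1 + pi)\<^sup>2 * l\<^sup>2)"
proof -
  \<comment> \<open>The angular displacement from the centre of the arc costs at most pi l and the
    radial one at most l; this is where 1 + pi comes from.\<close>
  have "carleson_box \<theta> l \<subseteq> cball (cis \<theta>) ((1 + pi) * l)"
  proof
    fix z assume "z \<in> carleson_box \<theta> l"
    then obtain r t where z: "z = of_real r * cis t" "0 \<le> r" "r < 1" "1 - r \<le> l" "\<bar>t - \<theta>\<bar> \<le> pi * l"
      by (auto simp: carleson_box_def)
    have "cmod (cis \<theta> - cis t) = cmod (cis t * (cis (\<theta> - t) - 1))"
      by (simp add: algebra_simps cis_mult)
    also have "\<dots> \<le> \<bar>\<theta> - t\<bar>"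
      unfolding norm_mult using dist_exp_i_1[of "\<theta> - t"] abs_sin_x_le_abs_x[of "(\<theta> - t) / 2"]
      by (simp add: cis_conv_exp)
    finally have 1: "cmod (cis \<theta> - cis t) \<le> pi * l" using z by linarith
    have "cmod (cis t - z) = cmod (of_real (1 - r) * cis t)" by (simp add: z algebra_simps)
    also have "\<dots> = 1 - r" unfolding norm_mult norm_of_real using z by simp
    finally have 2: "cmod (cis t - z) \<le> l" using z by simp
    have "cmod (cis \<theta> - z) \<le> cmod (cis \<theta> - cis t) + cmod (cis t - z)"
      using norm_triangle_ineq[of "cis \<theta> - cis t" "cis t - z"] by simp
    then have "cmod (cis \<theta> - z) \<le> (1 + pi) * l" using 1 2 by (simp add: algebra_simps)
    then show "z \<in> cball (cis \<theta>) ((1 + pi) * l)" by (simp add: dist_norm)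
  qed
  then have "emeasure dA (carleson_box \<theta> l) \<le> emeasure dA (cball (cis \<theta>) ((1 + pi) * l))"
    by (intro emeasure_mono) auto
  also have "\<dots> = ennreal ((1 + pi)\<^sup>2 * l\<^sup>2)"
    using assms by (subst emeasure_dA_cball) (auto simp: power_mult_distrib)
  finally show ?thesis .
qed

lemma emeasure_dA_rotate:
  assumes "A \<in> sets lebesgue"
  shows "(\<lambda>z. z * cis t) ` A \<in> sets lebesgue" "emeasure dA ((\<lambda>z. z * cis t) ` A) = emeasure dA A"
proof -
  have d: "deriv (\<lambda>z. z * cis t) z = cis t" for z
    by (rule DERIV_imp_deriv) (auto intro!: derivative_eq_intros)
  have i: "inj_on (\<lambda>z. z * cis t) UNIV" by (auto simp: inj_on_def)
  have h: "(\<lambda>z. z * cis t) holomorphic_on UNIV" by (intro holomorphic_intros)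
  show m: "(\<lambda>z. z * cis t) ` A \<in> sets lebesgue"
    by (rule emeasure_holomorphic_image(1)[OF _ h i assms]) auto
  have "emeasure lebesgue ((\<lambda>z. z * cis t) ` A) = emeasure lebesgue A"
    using assms by (subst emeasure_holomorphic_image(2)[OF _ h i assms]) (auto simp: d)
  then show "emeasure dA ((\<lambda>z. z * cis t) ` A) = emeasure dA A" using m assms by (simp add: emeasure_dA)
qed

lemma dtop_rotate:
  assumes "i < 2 ^ n" "j < 2 ^ n"
  shows "emeasure dA (dtop s (n, i)) \<le> emeasure dA (dtop s (n, j))"
\<comment> \<open>At generation 0 both indices are 0. From generation 1 on the boxes avoid the
  origin, the one point whose angle does not change under rotation.\<close>
proof (cases "n = 0")
  case False
  define t where "t = (real j - real i) / 2 ^ n"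
  have "(\<lambda>z. z * cis (2 * pi * t)) ` dtop s (n, i) \<subseteq> dtop s (n, j)"
  proof (rule image_subsetI)
    fix z assume z: "z \<in> dtop s (n, i)"
    have "(1::real) / 2 ^ n \<le> 1 / 2 ^ 1" using False by (intro divide_left_mono power_increasing) auto
    then have z0: "z \<noteq> 0" using z by (auto simp: dtop_def dbox_def)
    define x where "x = frac (ang z + s)"
    have "\<lfloor>2 ^ n * x\<rfloor> = int i" using z by (simp add: dtop_def dbox_def x_def)
    then have x: "real i \<le> 2 ^ n * x" "2 ^ n * x < real i + 1" by (auto simp: floor_eq_iff)
    have xt: "2 ^ n * (x + t) = 2 ^ n * x + (real j - real i)" by (simp add: t_def distrib_left)
    \<comment> \<open>The target sector ends at or before 1, so the rotated angle stays in [0,1) and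
      \<open>frac\<close> does not wrap.\<close>
    have j1: "real j + 1 \<le> 2 ^ n"
      using assms(2) by (metis of_nat_Suc Suc_leI of_nat_le_iff of_nat_numeral of_nat_power add.commute)
    have "0 \<le> 2 ^ n * (x + t)" "2 ^ n * (x + t) < 2 ^ n * 1" unfolding xt using x j1 by linarith+
    then have "0 \<le> x + t" "x + t < 1"
      using mult_pos_neg[of "2 ^ n" "x + t"] by (force simp: not_le[symmetric], simp)
    then have "frac (x + t) = x + t" by (simp add: frac_eq)
    moreover have "frac (ang (z * cis (2 * pi * t)) + s) = frac (x + t)"
      using z0 by (simp add: ang_rotate x_def add_ac)
    ultimately have "\<lfloor>2 ^ n * frac (ang (z * cis (2 * pi * t)) + s)\<rfloor> = int j"
      by (intro floor_unique) (use x xt in auto)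
    then show "z * cis (2 * pi * t) \<in> dtop s (n, j)"
      using z by (auto simp: dtop_def dbox_def norm_mult)
  qed
  then have "emeasure dA ((\<lambda>z. z * cis (2 * pi * t)) ` dtop s (n, i)) \<le> emeasure dA (dtop s (n, j))"
    by (intro emeasure_mono) auto
  then show ?thesis by (subst (asm) emeasure_dA_rotate) auto
qed (use assms in auto)

text \<open>Polar integration is avoided: the 2^n top halves of one generation tile an annulus of
  area at least h/4 with h = 2^-n, and by rotation no top half is smaller than another, so each has
  at least the share h of this area.\<close>

lemma dtop_area:
  assumes j: "j < 2 ^ n"
  shows "ennreal ((1 / 2 ^ n)\<^sup>2 / 4) \<le> emeasure dA (dtop s (n, j))"
proof -
  define h :: real where "h = 1 / 2 ^ n"
  have h: "0 < h" "h \<le> 1" by (auto simp: h_def)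
  have un: "(\<Union>i\<in>{..<2 ^ n}. dtop s (n, i)) = ball 0 (1 - h / 2) - ball 0 (1 - h)"
  proof (intro equalityI subsetI)
    fix z :: complex assume z: "z \<in> ball 0 (1 - h / 2) - ball 0 (1 - h)"
    define x where "x = frac (ang z + s)"
    have x: "0 \<le> x" "x < 1" by (auto simp: x_def frac_lt_1)
    define i where "i = nat \<lfloor>2 ^ n * x\<rfloor>"
    have i: "int i = \<lfloor>2 ^ n * x\<rfloor>" using x by (simp add: i_def)
    have "\<lfloor>2 ^ n * x\<rfloor> < 2 ^ n" using x by (simp add: floor_less_iff)
    then have "i < 2 ^ n" using i by (metis of_nat_less_iff of_nat_numeral of_nat_power)
    moreover have "z \<in> dtop s (n, i)"
      using z i h by (auto simp: dtop_def dbox_def h_def x_def)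
    ultimately show "z \<in> (\<Union>i\<in>{..<2 ^ n}. dtop s (n, i))" by blast
  qed (use h in \<open>auto simp: dtop_def dbox_def h_def\<close>)
  have "ennreal (h / 4) \<le> ennreal ((1 - h / 2)\<^sup>2 - (1 - h)\<^sup>2)"
  proof (rule ennreal_leI)
    have "(1 - h / 2)\<^sup>2 - (1 - h)\<^sup>2 = h - 3 / 4 * (h * h)"
      by (simp add: power2_eq_square algebra_simps)
    moreover have "h * h \<le> h * 1" using h by (intro mult_left_mono) auto
    ultimately show "h / 4 \<le> (1 - h / 2)\<^sup>2 - (1 - h)\<^sup>2" by linarith
  qed
  also have "\<dots> = emeasure dA (ball 0 (1 - h / 2)) - emeasure dA (ball 0 (1 - h))"
    using h by (simp add: emeasure_dA_ball ennreal_minus)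
  also have "\<dots> = emeasure dA (ball 0 (1 - h / 2) - ball 0 (1 - h))"
    using h by (intro emeasure_Diff[symmetric]) (auto simp: emeasure_dA_ball)
  also have "\<dots> = (\<Sum>i<2 ^ n. emeasure dA (dtop s (n, i)))"
    unfolding un[symmetric]
    by (intro sum_emeasure[symmetric]) (use dtop_disjoint[of s] in \<open>auto simp: disjoint_family_on_def\<close>)
  also have "\<dots> \<le> (\<Sum>i<2 ^ n :: nat. emeasure dA (dtop s (n, j)))"
    using j by (intro sum_mono dtop_rotate) auto
  also have "\<dots> = ennreal (2 ^ n) * emeasure dA (dtop s (n, j))"
    by (simp flip: ennreal_power)
  finally have "ennreal h * ennreal (h / 4) \<le> ennreal h * (ennreal (2 ^ n) * emeasure dA (dtop s (n, j)))"
    by (rule mult_left_mono) auto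
  also have "\<dots> = emeasure dA (dtop s (n, j))"
    using h by (simp add: h_def flip: mult.assoc ennreal_mult)
  finally show ?thesis using h by (simp add: h_def[symmetric] power2_eq_square flip: ennreal_mult)
qed

text \<open>The one-third trick: points of the grids of mesh \<open>2\<^sup>-\<^sup>n\<close> based at 0 and at 1/3 are at least
  \<open>2\<^sup>-\<^sup>n / 3\<close> apart, since 3 does not divide \<open>2\<^sup>n\<close>.\<close>

lemma one_third_trick:
  fixes x y :: real
  assumes "\<bar>x - y\<bar> < 1 / 2 ^ n / 3"
  shows "\<lfloor>2 ^ n * x\<rfloor> = \<lfloor>2 ^ n * y\<rfloor> \<or> \<lfloor>2 ^ n * (x + 1 / 3)\<rfloor> = \<lfloor>2 ^ n * (y + 1 / 3)\<rfloor>"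
proof -
  have *: "\<lfloor>2 ^ n * x\<rfloor> = \<lfloor>2 ^ n * y\<rfloor> \<or> \<lfloor>2 ^ n * (x + 1 / 3)\<rfloor> = \<lfloor>2 ^ n * (y + 1 / 3)\<rfloor>"
    if xy: "x \<le> y" "y - x < 1 / 2 ^ n / 3" for x y :: real
  proof (rule ccontr)
    assume "\<not> ?thesis"
    then have ne: "\<lfloor>2 ^ n * x\<rfloor> \<noteq> \<lfloor>2 ^ n * y\<rfloor>" "\<lfloor>2 ^ n * (x + 1 / 3)\<rfloor> \<noteq> \<lfloor>2 ^ n * (y + 1 / 3)\<rfloor>" by auto
    define a where "a = \<lfloor>2 ^ n * y\<rfloor>"
    define b where "b = \<lfloor>2 ^ n * (y + 1 / 3)\<rfloor>"
    have le: "2 ^ n * x \<le> 2 ^ n * y" "2 ^ n * (x + 1 / 3) \<le> 2 ^ n * (y + 1 / 3)"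
      using xy by auto
    have "\<lfloor>2 ^ n * x\<rfloor> < a" "\<lfloor>2 ^ n * (x + 1 / 3)\<rfloor> < b"
      using floor_mono[OF le(1)] floor_mono[OF le(2)] ne unfolding a_def b_def by auto
    then have lo: "2 ^ n * x < a" "2 ^ n * (x + 1 / 3) < b" by (simp_all add: floor_less_iff)
    have hi: "a \<le> 2 ^ n * y" "b \<le> 2 ^ n * (y + 1 / 3)" by (simp_all add: a_def b_def)
    have d: "2 ^ n * y - 2 ^ n * x < 1 / 3"
      using mult_strict_left_mono[OF xy(2), of "2 ^ n"] by (simp add: algebra_simps)
    have "\<bar>real_of_int (3 * (b - a)) - 2 ^ n\<bar> < 1"
      using lo hi d by (simp add: abs_less_iff distrib_left)
    then have "\<bar>real_of_int (3 * (b - a) - 2 ^ n)\<bar> < 1" by simp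
    then have "3 * (b - a) = 2 ^ n" by linarith
    then have "(3::int) dvd 2 ^ n" by (metis dvd_triv_left)
    then have "(3::int) dvd 2" using prime_dvd_power[of "3::int" 2 n] by auto
    then show False by simp
  qed
  show ?thesis
    using *[of x y] *[of y x] assms by (cases "x \<le> y") (auto simp: abs_if split: if_splits)
qed

text \<open>A common dyadic cell forces a common integer part. This lets statements about grids on
  the line be read modulo full turns.\<close>

lemma floor_frac_cong:
  fixes x y :: real
  assumes "\<lfloor>2 ^ n * x\<rfloor> = \<lfloor>2 ^ n * y\<rfloor>"
  shows "\<lfloor>2 ^ n * frac x\<rfloor> = \<lfloor>2 ^ n * frac y\<rfloor>"
proof -
  have "\<lfloor>x\<rfloor> = \<lfloor>y\<rfloor>"
    using floor_dyadic_div[of 0 n x] floor_dyadic_div[of 0 n y] assms by simp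
  moreover have "2 ^ n * frac u = 2 ^ n * u - of_int (2 ^ n * \<lfloor>u\<rfloor>)" for u :: real
    by (simp add: frac_def right_diff_distrib)
  ultimately show ?thesis using assms by (simp only: floor_diff_of_int)
qed

text \<open>The kernel denominator dominates the three distances that decide membership in a common
  box: those of the two points to the circle and their angular distance, where the integer k
  accounts for angles meeting across the cut.\<close>

lemma kernel_denominator_bounds:
  assumes "z \<in> ball 0 1" "u \<in> ball 0 1"
  shows "1 - cmod z \<le> cmod (1 - z * cnj u)" "1 - cmod u \<le> cmod (1 - z * cnj u)"
    and "\<exists>k::int. \<bar>ang z - ang u + k\<bar> \<le> cmod (1 - z * cnj u)"
proof -
  have z: "cmod z < 1" "cmod u < 1" using assms by auto
  have le1: "cmod z * cmod u \<le> cmod z" "cmod z * cmod u \<le> cmod u"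
    using z by (auto intro: mult_left_le mult_left_le_one_le)
  have ge: "1 - cmod z * cmod u \<le> cmod (1 - z * cnj u)"
    using norm_triangle_ineq2[of 1 "z * cnj u"] by (simp add: norm_mult)
  show 1: "1 - cmod z \<le> cmod (1 - z * cnj u)" "1 - cmod u \<le> cmod (1 - z * cnj u)"
    using ge le1 by linarith+
  define \<rho> where "\<rho> = cmod z * cmod u"
  define t where "t = ang z - ang u"
  \<comment> \<open>The representative of the angular difference nearest to 0, so that the sine
    bound on [0, 1/2] applies.\<close>
  define \<delta> where "\<delta> = t - round t"
  have \<delta>: "\<bar>\<delta>\<bar> \<le> 1 / 2" using of_int_round_abs_le[of t] by (simp add: \<delta>_def abs_minus_commute)
  have zu: "z * cnj u = of_real \<rho> * cis (2 * pi * t)"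
    by (subst ang_polar[of z], subst ang_polar[of u])
       (simp add: \<rho>_def t_def cis_cnj cis_mult right_diff_distrib)
  have cis\<delta>: "cis (2 * pi * t) = cis (2 * pi * \<delta>)"
  proof -
    have "cis (2 * pi * t) = cis (2 * pi * \<delta>) * cis (2 * pi * of_int (round t))"
      by (simp add: \<delta>_def cis_mult algebra_simps)
    also have "cis (2 * pi * of_int (round t)) = 1" by (rule cis_multiple_2pi) simp
    finally show ?thesis by simp
  qed
  \<comment> \<open>Moving the product radially to the unit circle costs at most the denominator
    again. The resulting factor 2 cancels against the 2 in the chord length
    \<open>2 * \<bar>sin (pi * \<delta>)\<bar>\<close>.\<close>
  have "cmod (1 - cis (2 * pi * \<delta>)) \<le> cmod (1 - z * cnj u) + cmod (z * cnj u - cis (2 * pi * \<delta>))"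
    using norm_triangle_ineq[of "1 - z * cnj u" "z * cnj u - cis (2 * pi * \<delta>)"] by simp
  also have "cmod (z * cnj u - cis (2 * pi * \<delta>)) = cmod (of_real (\<rho> - 1) * cis (2 * pi * \<delta>))"
    by (simp add: zu cis\<delta> left_diff_distrib)
  also have "\<dots> = 1 - \<rho>" unfolding norm_mult norm_of_real using le1 z by (simp add: \<rho>_def)
  also have "\<dots> \<le> cmod (1 - z * cnj u)" using ge by (simp add: \<rho>_def)
  finally have "cmod (1 - cis (2 * pi * \<delta>)) \<le> 2 * cmod (1 - z * cnj u)" by simp
  moreover have "cmod (1 - cis (2 * pi * \<delta>)) = 2 * \<bar>sin (pi * \<delta>)\<bar>"
  proof -
    have "cmod (1 - cis (2 * pi * \<delta>)) = cmod (exp (\<i> * of_real (2 * pi * \<delta>)) - 1)"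
      by (simp add: cis_conv_exp norm_minus_commute)
    also have "\<dots> = 2 * \<bar>sin (2 * pi * \<delta> / 2)\<bar>"
      using dist_exp_i_1[of "2 * pi * \<delta>"] by simp
    finally show ?thesis by simp
  qed
  moreover have "\<bar>\<delta>\<bar> \<le> \<bar>sin (pi * \<delta>)\<bar>"
  proof -
    \<comment> \<open>With y = pi x <= 2, Taylor's formula gives sin y >= y - y^3/6 >= y/3, and y >=
      3x.\<close>
    have sin: "x \<le> sin (pi * x)" if x: "0 \<le> x" "x \<le> 1 / 2" for x
    proof -
      define y where "y = pi * x"
      have "pi * x \<le> pi * (1 / 2)" using x by (intro mult_left_mono) auto
      then have y: "0 \<le> y" "y \<le> 2" using x pi_less_4 unfolding y_def by (simp, linarith)
      have "\<bar>sin y - (\<Sum>m<3. sin_coeff m * y ^ m)\<bar> \<le> inverse (fact 3) * \<bar>y\<bar> ^ 3"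
        by (rule Maclaurin_sin_bound)
      then have "\<bar>sin y - y\<bar> \<le> y * (y * y) / 6"
        using y by (simp add: numeral_3_eq_3 sin_coeff_def fact_numeral)
      then have "y - y * (y * y) / 6 \<le> sin y" by linarith
      moreover have "y * (y * y) \<le> y * (2 * 2)" using y by (intro mult_left_mono mult_mono) auto
      ultimately have "y / 3 \<le> sin y" by linarith
      moreover have "3 * x \<le> y" unfolding y_def using x pi_gt3 by (intro mult_right_mono) auto
      ultimately show ?thesis by (simp add: y_def)
    qed
    show ?thesis using sin[of "\<bar>\<delta>\<bar>"] \<delta> by (cases "0 \<le> \<delta>") auto
  qed
  ultimately have "\<bar>\<delta>\<bar> \<le> cmod (1 - z * cnj u)" by simp
  then show "\<exists>k::int. \<bar>ang z - ang u + k\<bar> \<le> cmod (1 - z * cnj u)"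
    by (intro exI[of _ "- round t"]) (simp add: \<delta>_def t_def)
qed

text \<open>Take the finest generation whose mesh still exceeds three times the denominator d. The
  one-third trick then puts both points into one sector of one of the two grids, and minimality
  makes the mesh at most 6d.\<close>

lemma kernel_box:
  assumes z: "z \<in> ball 0 1" and u: "u \<in> ball 0 1"
  shows "\<exists>s\<in>{0, 1 / 3}. \<exists>n. \<exists>j<2 ^ n. z \<in> dbox s (n, j) \<and> u \<in> dbox s (n, j) \<and> 1 / 2 ^ n \<le> 6 * cmod (1 - z * cnj u)"
proof -
  define d where "d = cmod (1 - z * cnj u)"
  note b = kernel_denominator_bounds[OF z u, folded d_def]
  have d0: "0 < d" using b(1) z by simp
  \<comment> \<open>Generation 0 needs no smallness, since its box is the whole disc; this covers
    large d. In the other generations the same inequality yields the radial conditions and the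
    hypothesis of the one-third trick.\<close>
  have ex: "\<exists>s\<in>{0, 1 / 3}. \<exists>j<2 ^ n. z \<in> dbox s (n, j) \<and> u \<in> dbox s (n, j)"
    if n: "n = 0 \<or> d < 1 / 2 ^ n / 3" for n
  proof -
    have dn: "d \<le> 1 / 2 ^ n" if "n \<noteq> 0"
    proof -
      have "a / 3 \<le> a" if "0 \<le> a" for a :: real using that by simp
      from this[of "1 / 2 ^ n"] have "1 / 2 ^ n / 3 \<le> (1::real) / 2 ^ n" by simp
      with n that show ?thesis by linarith
    qed
    have zn: "1 - cmod z \<le> 1 / 2 ^ n" "1 - cmod u \<le> 1 / 2 ^ n"
      using dn b by (cases "n = 0"; force)+
    have "\<exists>s\<in>{0, 1 / 3}. \<lfloor>2 ^ n * frac (ang z + s)\<rfloor> = \<lfloor>2 ^ n * frac (ang u + s)\<rfloor>"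
    proof (cases "n = 0")
      case True
      have "\<lfloor>frac x\<rfloor> = 0" for x :: real using frac_lt_1[of x] by (simp add: floor_eq_iff)
      then show ?thesis using True by (intro bexI[of _ 0]) auto
    next
      case False
      from b(3) obtain k :: int where k: "\<bar>ang z - ang u + k\<bar> \<le> d" by blast
      have "\<bar>(ang z + k) - ang u\<bar> < 1 / 2 ^ n / 3"
        using k n False d0 by (auto simp: algebra_simps)
      from one_third_trick[OF this] have "\<exists>s\<in>{0, 1 / 3}. \<lfloor>2 ^ n * (ang z + k + s)\<rfloor> = \<lfloor>2 ^ n * (ang u + s)\<rfloor>"
        by auto
      then obtain s where s: "s \<in> {0, 1 / 3}" "\<lfloor>2 ^ n * (ang z + k + s)\<rfloor> = \<lfloor>2 ^ n * (ang u + s)\<rfloor>" by blast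
      have "frac (x + of_int k) = frac x" for x :: real by (simp add: frac_def)
      from this[of "ang z + s"] have "frac (ang z + k + s) = frac (ang z + s)" by (simp add: add_ac)
      with floor_frac_cong[OF s(2)] show ?thesis by (intro bexI[OF _ s(1)]) simp
    qed
    then obtain s where s: "s \<in> {0, 1 / 3}" "\<lfloor>2 ^ n * frac (ang z + s)\<rfloor> = \<lfloor>2 ^ n * frac (ang u + s)\<rfloor>" by blast
    define j where "j = nat \<lfloor>2 ^ n * frac (ang z + s)\<rfloor>"
    have j: "int j = \<lfloor>2 ^ n * frac (ang z + s)\<rfloor>" by (simp add: j_def)
    have "\<lfloor>2 ^ n * frac (ang z + s)\<rfloor> < 2 ^ n" using frac_lt_1[of "ang z + s"] by (simp add: floor_less_iff)
    then have "j < 2 ^ n" using j by (metis of_nat_less_iff of_nat_numeral of_nat_power)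
    then show ?thesis using s(2) j zn z u by (intro bexI[OF _ s(1)] exI[of _ j]) (auto simp: dbox_def)
  qed
  show ?thesis
  proof (cases "1 / 6 \<le> d")
    case True
    then show ?thesis using ex[of 0] unfolding d_def by (auto intro!: exI[of _ "0::nat"])
  next
    case False
    obtain N where N: "(1 / 2) ^ N < 3 * d" using real_arch_pow_inv[of "3 * d" "1 / 2"] d0 by auto
    \<comment> \<open>The generation sought is the predecessor of m: its mesh is above 3d because m
      is least, and it is twice the mesh at m, hence at most 6d.\<close>
    define m where "m = (LEAST N. (1 / 2) ^ N \<le> 3 * d)"
    have m: "(1 / 2) ^ m \<le> 3 * d" unfolding m_def by (rule LeastI[of _ N]) (use N in auto)
    have "m \<noteq> 0" using m False by (intro notI) auto
    then obtain n where n: "m = Suc n" by (cases m) auto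
    have "\<not> (1 / 2) ^ n \<le> 3 * d" using not_less_Least[of n "\<lambda>N. (1 / 2) ^ N \<le> 3 * d"] n by (auto simp: m_def)
    then have "d < 1 / 2 ^ n / 3" by (simp add: power_divide)
    moreover have "1 / 2 ^ n \<le> 6 * d" using m by (simp add: n power_divide field_simps)
    ultimately show ?thesis using ex[of n] unfolding d_def by blast
  qed
qed

section \<open>The kernel form on the disc\<close>

abbreviation disc :: "complex measure" where
  "disc \<equiv> area_on (ball 0 1)"

lemma space_disc [simp]: "space disc = ball 0 1"
  by (simp add: space_restrict_space)

lemma emeasure_disc: "A \<subseteq> ball 0 1 \<Longrightarrow> emeasure disc A = emeasure dA A"
  by (rule emeasure_restrict_space) auto

lemma finite_measure_disc: "finite_measure disc"
  by (rule finite_measureI) (simp add: emeasure_disc emeasure_dA_ball)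

lemma sigma_finite_disc: "sigma_finite_measure disc"
  using finite_measure_disc by (rule finite_measure.axioms)

interpretation disc: finite_measure disc by (rule finite_measure_disc)

interpretation disc_pair: pair_sigma_finite disc disc by standard

lemma sets_disc_borel: "A \<in> sets borel \<Longrightarrow> A \<subseteq> ball 0 1 \<Longrightarrow> A \<in> sets disc"
  by (auto simp: sets_restrict_space_iff)

lemma measurable_disc_borel [measurable (raw)]: "f \<in> borel_measurable borel \<Longrightarrow> f \<in> borel_measurable disc"
  by (intro measurable_restrict_space1) (auto simp: measurable_completion dA_def)

lemma dbox_disc [measurable]: "dbox s i \<in> sets disc"
  by (rule sets_disc_borel[OF dbox_borel]) (auto simp: dbox_def)

lemma dtop_disc [measurable]: "dtop s i \<in> sets disc"
  by (rule sets_disc_borel[OF dtop_borel]) (auto simp: dbox_def dtop_def)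

lemma carleson_box_disc [measurable]: "carleson_box \<theta> l \<in> sets disc"
  by (rule sets_disc_borel[OF carleson_box_borel carleson_box_subset])

text \<open>The modulus of the Bergman kernel of the disc; there is no factor 1/pi because
  \<open>dA\<close> is normalized.\<close>

definition kern :: "complex \<Rightarrow> complex \<Rightarrow> real" where
  "kern z u = 1 / (cmod (1 - z * cnj u))\<^sup>2"

lemma kern_sym: "kern z u = kern u z"
proof -
  have "cmod (1 - z * cnj u) = cmod (cnj (1 - z * cnj u))" by (rule complex_mod_cnj[symmetric])
  also have "cnj (1 - z * cnj u) = 1 - u * cnj z" by simp
  finally show ?thesis by (simp add: kern_def)
qed

lemma measurable_kern [measurable]: "(\<lambda>(z, u). kern z u) \<in> borel_measurable (disc \<Otimes>\<^sub>M disc)"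
proof -
  have [measurable]: "(\<lambda>x. fst x) \<in> borel_measurable (disc \<Otimes>\<^sub>M disc)" "(\<lambda>x. snd x) \<in> borel_measurable (disc \<Otimes>\<^sub>M disc)"
    using measurable_compose[OF measurable_fst measurable_disc_borel[of "\<lambda>x. x"]]
      measurable_compose[OF measurable_snd measurable_disc_borel[of "\<lambda>x. x"]] by auto
  have [measurable]: "cnj \<in> borel_measurable borel" by (intro borel_measurable_continuous_onI continuous_intros)
  show ?thesis unfolding kern_def case_prod_beta by measurable
qed

lemma dbox_empty: "2 ^ n \<le> j \<Longrightarrow> dbox s (n, j) = {}"
proof -
  assume "2 ^ n \<le> j"
  then have j: "(2::int) ^ n \<le> int j" by (metis of_nat_le_iff of_nat_numeral of_nat_power)
  have "\<lfloor>2 ^ n * frac x\<rfloor> < 2 ^ n" for x :: real using frac_lt_1[of x] by (simp add: floor_less_iff)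
  then have "\<lfloor>2 ^ n * frac x\<rfloor> \<noteq> int j" for x :: real using j by (metis leD)
  then show ?thesis by (simp add: dbox_def)
qed

lemma dbox_measures:
  assumes "j < 2 ^ n"
  shows "\<exists>m e. emeasure disc (dbox s (n, j)) = ennreal m \<and> emeasure disc (dtop s (n, j)) = ennreal e \<and>
     0 < e \<and> 0 < m \<and> m \<le> (1 + pi)\<^sup>2 * (1 / 2 ^ n)\<^sup>2 \<and> (1 / 2 ^ n)\<^sup>2 / 4 \<le> e \<and> e \<le> m"
proof -
  have sub: "dbox s (n, j) \<subseteq> ball 0 1" "dtop s (n, j) \<subseteq> ball 0 1" by (auto simp: dbox_def dtop_def)
  define h :: real where "h = 1 / 2 ^ n"
  have h: "0 < h" by (simp add: h_def)
  obtain m e where m: "0 \<le> m" "emeasure disc (dbox s (n, j)) = ennreal m"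
      and e: "0 \<le> e" "emeasure disc (dtop s (n, j)) = ennreal e"
    by (metis disc.emeasure_eq_measure measure_nonneg)
  have "emeasure disc (dbox s (n, j)) \<le> emeasure dA (carleson_box (2 * pi * ((real j + 1 / 2) / 2 ^ n - s)) h)"
    using dbox_subset_carleson[of s "(n, j)"] sub by (auto intro!: emeasure_mono simp: emeasure_disc h_def)
  also have "\<dots> \<le> ennreal ((1 + pi)\<^sup>2 * h\<^sup>2)" by (rule carleson_box_area[OF h])
  finally have 1: "m \<le> (1 + pi)\<^sup>2 * h\<^sup>2" using m by simp
  have 2: "h\<^sup>2 / 4 \<le> e" using dtop_area[OF assms, of s] e sub by (simp add: emeasure_disc h_def)
  have "emeasure disc (dtop s (n, j)) \<le> emeasure disc (dbox s (n, j))"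
    by (intro emeasure_mono dtop_subset) auto
  then have 3: "e \<le> m" using m e by simp
  have "0 < h\<^sup>2 / 4" using h by simp
  then have "0 < e" "0 < m" using 2 3 by linarith+
  then show ?thesis using m e 1 2 3 unfolding h_def by blast
qed

text \<open>The number 36 is the square of the 6 in \<open>kernel_box\<close>; the other factor
  compares the area of a box with the square of its mesh.\<close>

definition kern_const :: real where "kern_const = 36 * (1 + pi)\<^sup>2"

text \<open>A single term of the double series already dominates the kernel, namely the box of
  \<open>kernel_box\<close>: its area is at most a constant times the squared denominator. The map
  \<open>prod_decode\<close> turns the family of boxes into a series; boxes that are empty
  contribute 0.\<close>

lemma kern_le_dyadic:
  assumes z: "z \<in> ball 0 1" "u \<in> ball 0 1"
  shows "ennreal (kern z u) \<le> ennreal kern_const * (\<Sum>s\<in>{0, 1 / 3}. \<Sum>k.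
     indicator (dbox s (prod_decode k)) z * indicator (dbox s (prod_decode k)) u / emeasure disc (dbox s (prod_decode k)))"
    (is "_ \<le> _ * (\<Sum>s\<in>_. \<Sum>k. ?t s k)")
proof -
  obtain s n j where s: "s \<in> {0, 1 / 3}" and j: "j < 2 ^ n" and mem: "z \<in> dbox s (n, j)" "u \<in> dbox s (n, j)"
    and le: "1 / 2 ^ n \<le> 6 * cmod (1 - z * cnj u)"
    using kernel_box[OF z] by metis
  define d where "d = cmod (1 - z * cnj u)"
  obtain m where m: "emeasure disc (dbox s (n, j)) = ennreal m" "0 < m" "m \<le> (1 + pi)\<^sup>2 * (1 / 2 ^ n)\<^sup>2"
    using dbox_measures[OF j, of s] by blast
  have d: "0 < d" using kernel_denominator_bounds(1)[OF z] z(1) unfolding d_def mem_ball_0 by linarith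
  have "m \<le> (1 + pi)\<^sup>2 * (6 * d)\<^sup>2"
    by (rule order.trans[OF m(3)]) (intro mult_left_mono power_mono, use le in \<open>auto simp: d_def\<close>)
  then have "m \<le> kern_const * d\<^sup>2" by (simp add: kern_const_def power_mult_distrib)
  then have "kern z u \<le> kern_const / m"
    using d m by (simp add: kern_def d_def[symmetric] field_simps)
  then have "ennreal (kern z u) \<le> ennreal (kern_const / m)" by (rule ennreal_leI)
  also have "\<dots> = ennreal kern_const * ennreal (1 / m)"
    using m by (simp add: kern_const_def flip: ennreal_mult)
  also have "ennreal (1 / m) = ?t s (prod_encode (n, j))"
    using mem m divide_ennreal[of 1 m] by simp
  also have "?t s (prod_encode (n, j)) \<le> (\<Sum>k. ?t s k)"
    using sum_le_suminf[of "?t s" "{prod_encode (n, j)}"] by simp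
  also have "(\<Sum>k. ?t s k) \<le> (\<Sum>s\<in>{0, 1 / 3}. \<Sum>k. ?t s k)"
    by (rule member_le_sum[OF s]) auto
  finally show ?thesis by (simp add: mult_left_mono)
qed

lemma form_le_dyadic:
  assumes [measurable]: "X \<in> borel_measurable disc" "Y \<in> borel_measurable disc"
  shows "(\<integral>\<^sup>+z. \<integral>\<^sup>+u. ennreal (kern z u) * X u * Y z \<partial>disc \<partial>disc)
    \<le> ennreal kern_const * (\<Sum>s\<in>{0, 1 / 3}. \<Sum>k. (\<integral>\<^sup>+u\<in>dbox s (prod_decode k). X u \<partial>disc) *
         (\<integral>\<^sup>+z\<in>dbox s (prod_decode k). Y z \<partial>disc) / emeasure disc (dbox s (prod_decode k)))"
proof -
  let ?Q = "\<lambda>s k. dbox s (prod_decode k)"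
  let ?m = "\<lambda>s k. inverse (emeasure disc (?Q s k))"
  let ?S = "\<lambda>z u. \<Sum>s\<in>{0, 1 / 3}. \<Sum>k. (indicator (?Q s k) z * Y z) * (X u * indicator (?Q s k) u) * ?m s k"
  have "(\<integral>\<^sup>+z. \<integral>\<^sup>+u. ennreal (kern z u) * X u * Y z \<partial>disc \<partial>disc)
    \<le> (\<integral>\<^sup>+z. \<integral>\<^sup>+u. ennreal kern_const * ?S z u \<partial>disc \<partial>disc)"
  proof (intro nn_integral_mono)
    fix z u assume zu: "z \<in> space disc" "u \<in> space disc"
    have "ennreal (kern z u) * (X u * Y z) \<le> ennreal kern_const * (\<Sum>s\<in>{0, 1 / 3}. \<Sum>k.
        indicator (?Q s k) z * indicator (?Q s k) u / emeasure disc (?Q s k)) * (X u * Y z)"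
      using kern_le_dyadic[of z u] zu by (intro mult_right_mono) auto
    also have "\<dots> = ennreal kern_const * ?S z u"
      unfolding mult.assoc sum_distrib_right
      by (intro arg_cong[where f = "\<lambda>x. ennreal kern_const * x"] sum.cong refl, subst ennreal_suminf_multc[symmetric])
         (simp add: divide_ennreal_def mult_ac)
    finally show "ennreal (kern z u) * X u * Y z \<le> ennreal kern_const * ?S z u"
      by (simp add: mult.assoc)
  qed
  also have "\<dots> = (\<integral>\<^sup>+z. ennreal kern_const * (\<Sum>s\<in>{0, 1 / 3}. \<Sum>k. (indicator (?Q s k) z * Y z) * (\<integral>\<^sup>+u\<in>?Q s k. X u \<partial>disc) * ?m s k) \<partial>disc)"
    by (simp add: nn_integral_cmult nn_integral_multc nn_integral_add nn_integral_suminf)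
  also have "\<dots> = ennreal kern_const * (\<Sum>s\<in>{0, 1 / 3}. \<Sum>k. (\<integral>\<^sup>+z. indicator (?Q s k) z * Y z \<partial>disc) * (\<integral>\<^sup>+u\<in>?Q s k. X u \<partial>disc) * ?m s k)"
    by (simp add: nn_integral_cmult nn_integral_multc nn_integral_add nn_integral_suminf)
  finally show ?thesis by (simp add: divide_ennreal_def mult_ac)
qed

text \<open>\<open>s\<close> stands for the dual weight \<open>w powr (- 1 / (p - 1))\<close>.\<close>

definition Bp_bound :: "real \<Rightarrow> (complex \<Rightarrow> real) \<Rightarrow> (complex \<Rightarrow> real) \<Rightarrow> real \<Rightarrow> bool" where
  "Bp_bound p w s K \<longleftrightarrow> (\<forall>\<theta> l. 0 < l \<and> l \<le> 1 \<longrightarrow> (\<exists>W T. 0 \<le> W \<and> 0 \<le> T \<and>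
      (\<integral>\<^sup>+z\<in>carleson_box \<theta> l. ennreal (w z) \<partial>disc) = ennreal W \<and>
      (\<integral>\<^sup>+z\<in>carleson_box \<theta> l. ennreal (s z) \<partial>disc) = ennreal T \<and>
      W * T powr (p - 1) \<le> K * measure disc (carleson_box \<theta> l) powr p))"

text \<open>Raise the inequality to the power 1/(p - 1), which equals q - 1 for the conjugate
  exponent q. This is the origin of the exponent 1/(p - 1) in the final estimate.\<close>

lemma Bp_bound_dual:
  assumes p: "1 < p" and K: "0 \<le> K" and b: "Bp_bound p w s K"
  shows "Bp_bound (p / (p - 1)) s w (K powr (1 / (p - 1)))"
  unfolding Bp_bound_def
proof (intro allI impI)
  fix \<theta> l :: real assume l: "0 < l \<and> l \<le> 1"
  let ?m = "measure disc (carleson_box \<theta> l)"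
  obtain W T where WT: "0 \<le> W" "0 \<le> T"
      "(\<integral>\<^sup>+z\<in>carleson_box \<theta> l. ennreal (w z) \<partial>disc) = ennreal W"
      "(\<integral>\<^sup>+z\<in>carleson_box \<theta> l. ennreal (s z) \<partial>disc) = ennreal T"
      and le: "W * T powr (p - 1) \<le> K * ?m powr p"
    using b l unfolding Bp_bound_def by meson
  have "(W * T powr (p - 1)) powr (1 / (p - 1)) \<le> (K * ?m powr p) powr (1 / (p - 1))"
    using le WT p by (intro powr_mono2) auto
  then have "T * W powr (p / (p - 1) - 1) \<le> K powr (1 / (p - 1)) * ?m powr (p / (p - 1))"
    using p WT K by (simp add: powr_mult powr_powr divide_diff_eq_iff mult.commute)
  then show "\<exists>W T. 0 \<le> W \<and> 0 \<le> T \<and>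
      (\<integral>\<^sup>+z\<in>carleson_box \<theta> l. ennreal (s z) \<partial>disc) = ennreal W \<and>
      (\<integral>\<^sup>+z\<in>carleson_box \<theta> l. ennreal (w z) \<partial>disc) = ennreal T \<and>
      W * T powr (p / (p - 1) - 1) \<le> K powr (1 / (p - 1)) * ?m powr (p / (p - 1))"
    using WT by blast
qed

text \<open>Masses only decrease from the enclosing Carleson box to the dyadic box, while the area
  of the former is at most \<open>4 * (1 + pi)\<^sup>2\<close> times that of the latter; this ratio
  enters to the power p.\<close>

lemma Bp_bound_dbox:
  assumes p: "1 < p" and K: "0 \<le> K" and b: "Bp_bound p w s K" and j: "j < 2 ^ n"
    and m: "emeasure disc (dbox c (n, j)) = ennreal m" "0 < m"
  shows "\<exists>W T. (\<integral>\<^sup>+z\<in>dbox c (n, j). ennreal (w z) \<partial>disc) = ennreal W \<and>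
      (\<integral>\<^sup>+z\<in>dbox c (n, j). ennreal (s z) \<partial>disc) = ennreal T \<and>
      W * T powr (p - 1) \<le> K * (4 * (1 + pi)\<^sup>2) powr p * m powr p"
proof -
  define h :: real where "h = 1 / 2 ^ n"
  have h: "0 < h" "h \<le> 1" by (auto simp: h_def)
  define Q where "Q = carleson_box (2 * pi * ((real j + 1 / 2) / 2 ^ n - c)) h"
  have sub: "dbox c (n, j) \<subseteq> Q" using dbox_subset_carleson[of c "(n, j)"] by (simp add: Q_def h_def)
  obtain W T where WT: "0 \<le> W" "0 \<le> T"
      "(\<integral>\<^sup>+z\<in>Q. ennreal (w z) \<partial>disc) = ennreal W" "(\<integral>\<^sup>+z\<in>Q. ennreal (s z) \<partial>disc) = ennreal T"
      and le: "W * T powr (p - 1) \<le> K * measure disc Q powr p"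
    using b h unfolding Bp_bound_def Q_def by meson
  have mono: "\<exists>V. 0 \<le> V \<and> V \<le> R \<and> (\<integral>\<^sup>+z\<in>dbox c (n, j). ennreal (v z) \<partial>disc) = ennreal V"
    if "(\<integral>\<^sup>+z\<in>Q. ennreal (v z) \<partial>disc) = ennreal R" "0 \<le> R" for v R
  proof -
    have le: "(\<integral>\<^sup>+z\<in>dbox c (n, j). ennreal (v z) \<partial>disc) \<le> ennreal R"
      unfolding that(1)[symmetric] using sub by (intro nn_integral_mono) (auto simp: indicator_def)
    then show ?thesis using that(2)
      by (cases "\<integral>\<^sup>+z\<in>dbox c (n, j). ennreal (v z) \<partial>disc") (auto simp: top_unique)
  qed
  obtain W' where W': "0 \<le> W'" "W' \<le> W" "(\<integral>\<^sup>+z\<in>dbox c (n, j). ennreal (w z) \<partial>disc) = ennreal W'"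
    using mono[OF WT(3,1)] by blast
  obtain T' where T': "0 \<le> T'" "T' \<le> T" "(\<integral>\<^sup>+z\<in>dbox c (n, j). ennreal (s z) \<partial>disc) = ennreal T'"
    using mono[OF WT(4,2)] by blast
  have hm: "h\<^sup>2 \<le> 4 * m"
  proof -
    obtain m' e where "emeasure disc (dbox c (n, j)) = ennreal m'" "0 < m'" "h\<^sup>2 / 4 \<le> e" "e \<le> m'"
      using dbox_measures[OF j, of c] by (auto simp: h_def)
    then show ?thesis using m by simp
  qed
  have "emeasure disc Q \<le> ennreal ((1 + pi)\<^sup>2 * h\<^sup>2)"
    using carleson_box_area[OF h(1)] carleson_box_subset by (simp add: Q_def emeasure_disc)
  then have "measure disc Q \<le> (1 + pi)\<^sup>2 * h\<^sup>2" by (simp add: disc.emeasure_eq_measure)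
  also have "\<dots> \<le> 4 * (1 + pi)\<^sup>2 * m" using mult_left_mono[OF hm, of "(1 + pi)\<^sup>2"] by simp
  finally have Qm: "measure disc Q \<le> 4 * (1 + pi)\<^sup>2 * m" .
  have "W' * T' powr (p - 1) \<le> W * T powr (p - 1)"
    using W' T' p by (intro mult_mono powr_mono2) auto
  also note le
  also have "K * measure disc Q powr p \<le> K * (4 * (1 + pi)\<^sup>2 * m) powr p"
    using K Qm p by (intro mult_left_mono powr_mono2) auto
  also have "\<dots> = K * (4 * (1 + pi)\<^sup>2) powr p * m powr p"
    using m by (simp add: powr_mult)
  finally show ?thesis using W'(3) T'(3) by blast
qed

text \<open>The factors are: two grids, the kernel domination, the passage from dyadic to Carleson
  boxes (power p), the ratio of a box to its top half (power p - 1), and the two embedding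
  constants.\<close>

definition form_const :: "real \<Rightarrow> real" where
  "form_const p = 2 * kern_const * (4 * (1 + pi)\<^sup>2) powr p * (4 * (1 + pi)\<^sup>2) powr (p - 1) *
     (embed_const p + embed_const (p / (p - 1)))"

lemma kernel_form_bound_ge_2:
  fixes w s f g :: "complex \<Rightarrow> real"
  assumes p: "2 \<le> p" and q: "q = p / (p - 1)"
    and ws [measurable]: "w \<in> borel_measurable disc" "s \<in> borel_measurable disc"
    and pos: "\<And>x. 0 < w x" "\<And>x. 0 < s x" "\<And>x. w x * s x powr (p - 1) = 1"
    and K: "0 \<le> K" and b: "Bp_bound p w s K"
    and fg [measurable]: "f \<in> borel_measurable disc" "g \<in> borel_measurable disc"
    and fg0: "\<And>x. 0 \<le> f x" "\<And>x. 0 \<le> g x"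
    and f1: "(\<integral>\<^sup>+x. ennreal (f x powr p * s x) \<partial>disc) \<le> 1"
    and g1: "(\<integral>\<^sup>+x. ennreal (g x powr q * w x) \<partial>disc) \<le> 1"
  shows "(\<integral>\<^sup>+z. \<integral>\<^sup>+u. ennreal (kern z u) * ennreal (f u * s u) * ennreal (g z * w z) \<partial>disc \<partial>disc)
     \<le> ennreal (form_const p * K)"
proof -
  let ?I = "\<lambda>c i. (\<integral>\<^sup>+x\<in>dbox c i. ennreal (f x * s x) \<partial>disc) * (\<integral>\<^sup>+x\<in>dbox c i. ennreal (g x * w x) \<partial>disc) / emeasure disc (dbox c i)"
  define a where "a = (4 * (1 + pi)\<^sup>2) powr (p - 1) * (embed_const p + embed_const q)"
  define K' where "K' = K * (4 * (1 + pi)\<^sup>2) powr p"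
  have p1: "1 < p" "1 < q" using p by (auto simp: q field_simps)
  have K': "0 \<le> K'" using K by (simp add: K'_def)
  have a0: "0 \<le> a" using p1 by (simp add: a_def embed_const_def)
  \<comment> \<open>A finite set of indices may contain pairs that name empty boxes; these
    contribute nothing and are discarded, since the masses of the others have to be
    positive.\<close>
  have fin: "(\<Sum>i\<in>S. ?I c i) \<le> ennreal (K' * a)" if "finite S" for c S
  proof -
    let ?S = "{i\<in>S. snd i < 2 ^ fst i}"
    define m where "m i = measure disc (dbox c i)" for i
    define e where "e i = measure disc (dtop c i)" for i
    have me: "0 < e i" "0 < m i" "m i \<le> 4 * (1 + pi)\<^sup>2 * e i" if iS: "i \<in> ?S" for i
    proof -
      obtain n j where i: "i = (n, j)" "j < 2 ^ n" using iS by (metis (lifting) mem_Collect_eq prod.collapse)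
      obtain m' e' where *: "emeasure disc (dbox c (n, j)) = ennreal m'" "emeasure disc (dtop c (n, j)) = ennreal e'"
        "0 < e'" "0 < m'" "m' \<le> (1 + pi)\<^sup>2 * (1 / 2 ^ n)\<^sup>2" "(1 / 2 ^ n)\<^sup>2 / 4 \<le> e'"
        using dbox_measures[OF i(2), of c] by blast
      then have eq: "m i = m'" "e i = e'" by (auto simp: m_def e_def i measure_def)
      show "0 < e i" "0 < m i" using * by (auto simp: eq)
      have "(1 + pi)\<^sup>2 * (1 / 2 ^ n)\<^sup>2 \<le> (1 + pi)\<^sup>2 * (4 * e')" using *(6) by (intro mult_left_mono) auto
      then show "m i \<le> 4 * (1 + pi)\<^sup>2 * e i" using *(5) unfolding eq by simp
    qed
    let ?P = "\<lambda>i W T. (\<integral>\<^sup>+z\<in>dbox c i. ennreal (w z) \<partial>disc) = ennreal W \<and>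
      (\<integral>\<^sup>+z\<in>dbox c i. ennreal (s z) \<partial>disc) = ennreal T \<and> W * T powr (p - 1) \<le> K' * m i powr p"
    have "\<forall>i\<in>?S. \<exists>W T. ?P i W T"
    proof
      fix i assume i: "i \<in> ?S"
      obtain n j where ij: "i = (n, j)" "j < 2 ^ n" using i by (metis (lifting) mem_Collect_eq prod.collapse)
      show "\<exists>W T. ?P i W T"
        unfolding K'_def using Bp_bound_dbox[OF p1(1) K b ij(2), of c "m i"] me(2)[OF i]
        by (simp add: ij(1) m_def disc.emeasure_eq_measure)
    qed
    from bchoice[OF this] obtain W where "\<forall>i\<in>?S. \<exists>T. ?P i (W i) T" ..
    from bchoice[OF this] obtain T where WT': "\<forall>i\<in>?S. ?P i (W i) (T i)" ..
    have WT: "\<And>i. i \<in> ?S \<Longrightarrow> (\<integral>\<^sup>+z\<in>dbox c i. ennreal (w z) \<partial>disc) = ennreal (W i)"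
      "\<And>i. i \<in> ?S \<Longrightarrow> (\<integral>\<^sup>+z\<in>dbox c i. ennreal (s z) \<partial>disc) = ennreal (T i)"
      "\<And>i. i \<in> ?S \<Longrightarrow> W i * T i powr (p - 1) \<le> K' * m i powr p" using WT' by auto
    have zero: "?I c i = 0" if "\<not> snd i < 2 ^ fst i" for i
      using dbox_empty[of "fst i" "snd i" c] that by (simp add: not_less)
    have "(\<Sum>i\<in>S. ?I c i) = (\<Sum>i\<in>?S. ?I c i)"
      using that zero by (intro sum.mono_neutral_right) auto
    also have "\<dots> = (\<Sum>i\<in>?S. (\<integral>\<^sup>+x\<in>dbox c i. ennreal (f x * s x) \<partial>disc) * (\<integral>\<^sup>+x\<in>dbox c i. ennreal (g x * w x) \<partial>disc) / ennreal (m i))"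
      by (simp add: m_def disc.emeasure_eq_measure)
    also have "\<dots> \<le> ennreal (K' * (4 * (1 + pi)\<^sup>2) powr (p - 1) * (embed_const p + embed_const q))"
    proof (rule sparse_form_bound[OF sigma_finite_disc _ p q ws pos, where E = "dtop c" and e = e and W = W and T = T])
      show "dbox c i \<subseteq> dbox c j \<or> dbox c j \<subseteq> dbox c i \<or> dbox c i \<inter> dbox c j = {}" for i j by (rule dbox_nested)
      show "disjoint_family_on (dtop c) ?S" using dtop_disjoint[of c] by (auto simp: disjoint_family_on_def)
    qed (use that me WT K' fg fg0 f1 g1 dtop_subset in \<open>auto simp: m_def e_def disc.emeasure_eq_measure\<close>)
    finally show ?thesis by (simp add: a_def mult.assoc)
  qed
  have inf: "(\<Sum>k. ?I c (prod_decode k)) \<le> ennreal (K' * a)" for c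
  proof (rule suminf_le_const)
    fix n
    have "(\<Sum>k<n. ?I c (prod_decode k)) = (\<Sum>i\<in>prod_decode ` {..<n}. ?I c i)"
      by (subst sum.reindex) (auto simp: inj_on_def)
    also have "\<dots> \<le> ennreal (K' * a)" by (rule fin) auto
    finally show "(\<Sum>k<n. ?I c (prod_decode k)) \<le> ennreal (K' * a)" .
  qed auto
  have "(\<integral>\<^sup>+z. \<integral>\<^sup>+u. ennreal (kern z u) * ennreal (f u * s u) * ennreal (g z * w z) \<partial>disc \<partial>disc)
    \<le> ennreal kern_const * (\<Sum>c\<in>{0, 1 / 3}. \<Sum>k. ?I c (prod_decode k))"
    by (rule form_le_dyadic) auto
  also have "\<dots> \<le> ennreal kern_const * (\<Sum>c\<in>{0, 1 / 3 :: real}. ennreal (K' * a))"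
    by (intro mult_left_mono sum_mono inf) auto
  also have "(\<Sum>c\<in>{0, 1 / 3 :: real}. ennreal (K' * a)) = ennreal (2 * (K' * a))"
    by (simp add: ennreal_mult'[of 2])
  also have "ennreal kern_const * \<dots> = ennreal (form_const p * K)"
  proof -
    have "0 \<le> kern_const" "0 \<le> 2 * (K' * a)" using K' a0 by (auto simp: kern_const_def)
    from ennreal_mult[OF this, symmetric] show ?thesis
      by (simp add: form_const_def K'_def a_def q mult_ac)
  qed
  finally show ?thesis .
qed

section \<open>Symmetry of the form, exponents below 2, and operator bounds\<close>

lemma form_swap:
  assumes [measurable]: "X \<in> borel_measurable disc" "Y \<in> borel_measurable disc"
  shows "(\<integral>\<^sup>+z. \<integral>\<^sup>+u. ennreal (kern z u) * X u * Y z \<partial>disc \<partial>disc)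
     = (\<integral>\<^sup>+z. \<integral>\<^sup>+u. ennreal (kern z u) * Y u * X z \<partial>disc \<partial>disc)"
proof -
  have "(\<integral>\<^sup>+z. \<integral>\<^sup>+u. ennreal (kern z u) * X u * Y z \<partial>disc \<partial>disc)
    = (\<integral>\<^sup>+u. \<integral>\<^sup>+z. ennreal (kern z u) * X u * Y z \<partial>disc \<partial>disc)"
    by (rule disc_pair.Fubini'[symmetric]) measurable
  also have "\<dots> = (\<integral>\<^sup>+z. \<integral>\<^sup>+u. ennreal (kern z u) * Y u * X z \<partial>disc \<partial>disc)"
    by (intro nn_integral_cong) (simp add: kern_sym mult_ac)
  finally show ?thesis .
qed

definition disc_const :: "real \<Rightarrow> real" where
  "disc_const p = form_const (if 2 \<le> p then p else p / (p - 1))"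

text \<open>For p < 2 the conjugate exponent exceeds 2. The kernel is symmetric, so the form is
  unchanged when (f, s) and (g, w) trade places, and the characteristic of the exchanged pair is
  \<open>K powr (1 / (p - 1))\<close>.\<close>

theorem kernel_form_bound:
  fixes w s F g :: "complex \<Rightarrow> real"
  assumes p: "1 < p"
    and ws [measurable]: "w \<in> borel_measurable disc" "s \<in> borel_measurable disc"
    and pos: "\<And>x. 0 < w x" "\<And>x. 0 < s x" "\<And>x. w x * s x powr (p - 1) = 1"
    and K: "0 \<le> K" and b: "Bp_bound p w s K"
    and Fg [measurable]: "F \<in> borel_measurable disc" "g \<in> borel_measurable disc"
    and Fg0: "\<And>x. 0 \<le> F x" "\<And>x. 0 \<le> g x"
    and F1: "(\<integral>\<^sup>+x. ennreal (F x powr p * w x) \<partial>disc) \<le> 1"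
    and g1: "(\<integral>\<^sup>+x. ennreal (g x powr (p / (p - 1)) * w x) \<partial>disc) \<le> 1"
  shows "(\<integral>\<^sup>+z. \<integral>\<^sup>+u. ennreal (kern z u) * ennreal (F u) * ennreal (g z * w z) \<partial>disc \<partial>disc)
     \<le> ennreal (disc_const p * K powr max 1 (1 / (p - 1)))"
proof -
  \<comment> \<open>Since \<open>w * s powr p = s\<close>, the norm of f in \<open>L^p\<close> for
    the density s equals the norm of F for the density w. This puts the form into the symmetric
    shape required by the sparse estimate.\<close>
  define f where "f x = F x / s x" for x
  have [measurable]: "f \<in> borel_measurable disc" unfolding f_def by measurable
  have f0: "0 \<le> f x" for x using Fg0(1)[of x] pos(2)[of x] by (simp add: f_def)
  have fs: "F x = f x * s x" for x using pos(2)[of x] by (simp add: f_def)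
  have "f x powr p * s x = F x powr p * w x" for x
  proof -
    have "s x powr p = s x powr (p - 1) * s x" using pos(2)[of x] by (simp add: powr_diff)
    then have "w x * s x powr p = s x" using pos(3)[of x] by (metis mult.assoc mult_1)
    moreover have "F x powr p = f x powr p * s x powr p"
      unfolding fs using f0[of x] pos(2)[of x] by (simp add: powr_mult)
    ultimately show ?thesis by (metis mult.assoc mult.commute)
  qed
  then have f1: "(\<integral>\<^sup>+x. ennreal (f x powr p * s x) \<partial>disc) \<le> 1" using F1 by simp
  show ?thesis
  proof (cases "2 \<le> p")
    case True
    then have "1 / (p - 1) \<le> 1" by simp
    then have "K powr max 1 (1 / (p - 1)) = K" using K by (simp add: max_def)
    then show ?thesis
      using kernel_form_bound_ge_2[OF True refl ws pos K b _ Fg(2) f0 Fg0(2) f1 g1] True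
      by (simp add: fs disc_const_def)
  next
    case False
    define q where "q = p / (p - 1)"
    have q: "2 \<le> q" "p = q / (q - 1)" using p False by (auto simp: q_def field_simps)
    have mx: "max 1 (1 / (p - 1)) = 1 / (p - 1)" using p False by (simp add: max_def)
    have pos': "s x * w x powr (q - 1) = 1" for x
    proof -
      have "(w x * s x powr (p - 1)) powr (1 / (p - 1)) = 1" by (simp add: pos(3))
      then have "w x powr (1 / (p - 1)) * s x = 1"
        using p pos(1,2)[of x] by (simp add: powr_mult powr_powr)
      moreover have "q - 1 = 1 / (p - 1)" using p by (simp add: q_def field_simps)
      ultimately show ?thesis by (simp add: mult.commute)
    qed
    have "(\<integral>\<^sup>+z. \<integral>\<^sup>+u. ennreal (kern z u) * ennreal (F u) * ennreal (g z * w z) \<partial>disc \<partial>disc)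
      = (\<integral>\<^sup>+z. \<integral>\<^sup>+u. ennreal (kern z u) * ennreal (g u * w u) * ennreal (f z * s z) \<partial>disc \<partial>disc)"
      unfolding fs by (rule form_swap) auto
    also have "\<dots> \<le> ennreal (form_const q * K powr (1 / (p - 1)))"
    proof (rule kernel_form_bound_ge_2[OF q ws(2,1) pos(2,1) pos'])
      show "Bp_bound q s w (K powr (1 / (p - 1)))"
        unfolding q_def by (rule Bp_bound_dual[OF p K b])
    qed (use Fg0 f0 f1 g1 in \<open>auto simp: q_def\<close>)
    finally show ?thesis using False by (simp add: mx disc_const_def q_def)
  qed
qed

lemma disc_const_pos: "1 < p \<Longrightarrow> 0 < disc_const p"
proof -
  have *: "0 < form_const r" if "1 < r" for r
  proof -
    have "1 < r / (r - 1)" using that by (simp add: field_simps)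
    then have "0 < embed_const r" "0 < embed_const (r / (r - 1))"
      using that unfolding embed_const_def by (intro divide_pos_pos mult_pos_pos; simp)+
    moreover have "0 < 1 + pi" using pi_gt_zero by linarith
    ultimately show ?thesis unfolding form_const_def kern_const_def
      by (intro mult_pos_pos add_pos_pos) auto
  qed
  assume "1 < p"
  moreover from this have "1 < p / (p - 1)" by (simp add: field_simps)
  ultimately show ?thesis using * by (simp add: disc_const_def)
qed

text \<open>Duality: test the form against \<open>min G n powr (p - 1)\<close>; the truncation makes its norm finite, as \<open>w\<close> is
  integrable over the whole disc (the box of length 1).\<close>

theorem kernel_operator_bound:
  fixes w s F G :: "complex \<Rightarrow> real"
  assumes p: "1 < p"
    and ws [measurable]: "w \<in> borel_measurable disc" "s \<in> borel_measurable disc"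
    and pos: "\<And>x. 0 < w x" "\<And>x. 0 < s x" "\<And>x. w x * s x powr (p - 1) = 1"
    and K: "0 \<le> K" and b: "Bp_bound p w s K"
    and FG [measurable]: "F \<in> borel_measurable disc" "G \<in> borel_measurable disc"
    and F0: "\<And>x. 0 \<le> F x" "\<And>x. 0 \<le> G x"
    and G: "\<And>z. z \<in> ball 0 1 \<Longrightarrow> ennreal (G z) \<le> (\<integral>\<^sup>+u. ennreal (kern z u) * ennreal (F u) \<partial>disc)"
    and a: "(\<integral>\<^sup>+x. ennreal (F x powr p * w x) \<partial>disc) \<le> ennreal a" "0 < a"
  shows "(\<integral>\<^sup>+x. ennreal (G x powr p * w x) \<partial>disc) \<le> ennreal ((disc_const p * K powr max 1 (1 / (p - 1))) powr p * a)"
proof -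
  define R where "R = disc_const p * K powr max 1 (1 / (p - 1))"
  have R0: "0 \<le> R" using disc_const_pos[OF p] by (simp add: R_def)
  define q where "q = p / (p - 1)"
  have q: "1 < q" "1 / p + 1 / q = 1" "(p - 1) * q = p" using p by (auto simp: q_def field_simps)
  obtain Wtot where Wtot: "(\<integral>\<^sup>+x. ennreal (w x) \<partial>disc) = ennreal Wtot"
  proof -
    have "\<exists>W. (\<integral>\<^sup>+z\<in>carleson_box 0 1. ennreal (w z) \<partial>disc) = ennreal W"
      using b[unfolded Bp_bound_def, rule_format, of 1 0] by auto
    moreover have "(\<integral>\<^sup>+z\<in>carleson_box 0 1. ennreal (w z) \<partial>disc) = (\<integral>\<^sup>+x. ennreal (w x) \<partial>disc)"
      unfolding carleson_box_1 by (intro nn_integral_cong) auto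
    ultimately show ?thesis using that by auto
  qed
  have fin: "(\<integral>\<^sup>+x. ennreal (min (G x) (real n) powr p * w x) \<partial>disc) \<le> ennreal (R powr p * a)" for n
  proof -
    let ?g = "\<lambda>x. min (G x) (real n)"
    have g0: "0 \<le> ?g x" for x using F0(2)[of x] by simp
    have "(\<integral>\<^sup>+x. ennreal (?g x powr p * w x) \<partial>disc) \<le> (\<integral>\<^sup>+x. ennreal (real n powr p) * ennreal (w x) \<partial>disc)"
      using g0 p pos(1) by (intro nn_integral_mono)
        (auto simp: less_imp_le intro!: ennreal_leI mult_right_mono powr_mono2 simp flip: ennreal_mult)
    also have "\<dots> = ennreal (real n powr p) * ennreal Wtot" by (simp add: nn_integral_cmult Wtot)
    also have "\<dots> < \<infinity>" by (simp add: ennreal_mult_less_top)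
    finally obtain x where x: "0 \<le> x" "(\<integral>\<^sup>+x. ennreal (?g x powr p * w x) \<partial>disc) = ennreal x"
      by (cases "\<integral>\<^sup>+x. ennreal (?g x powr p * w x) \<partial>disc") auto
    show ?thesis
    proof (cases "x = 0")
      case False
      then have x0: "0 < x" using x by simp
      define A where "A = a powr (1 / p)"
      define B where "B = x powr (1 / q)"
      have AB: "0 < A" "0 < B" using a x0 by (auto simp: A_def B_def)
      have Ap: "A powr p = a" "B powr q = x" using p q a x0 by (auto simp: A_def B_def powr_powr)
      let ?k = "\<lambda>z u. ennreal (kern z u) * ennreal (F u / A) * ennreal (?g z powr (p - 1) / B * w z)"
      have form: "(\<integral>\<^sup>+z. \<integral>\<^sup>+u. ?k z u \<partial>disc \<partial>disc) \<le> ennreal R"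
        unfolding R_def
      proof (rule kernel_form_bound[OF p ws pos K b])
        have "(\<integral>\<^sup>+x. ennreal ((F x / A) powr p * w x) \<partial>disc) = (\<integral>\<^sup>+x. ennreal (1 / a) * ennreal (F x powr p * w x) \<partial>disc)"
          using AB a F0 by (intro nn_integral_cong) (auto simp: powr_divide Ap less_imp_le simp flip: ennreal_mult')
        also have "\<dots> = ennreal (1 / a) * (\<integral>\<^sup>+x. ennreal (F x powr p * w x) \<partial>disc)" by (simp add: nn_integral_cmult)
        also have "\<dots> \<le> ennreal (1 / a) * ennreal a" using a by (intro mult_left_mono) auto
        also have "\<dots> = 1" using a by (simp flip: ennreal_mult)
        finally show "(\<integral>\<^sup>+x. ennreal ((F x / A) powr p * w x) \<partial>disc) \<le> 1" .
        have gq: "(?g z powr (p - 1) / B) powr q = ?g z powr p / x" for z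
          using g0[of z] AB q by (simp add: powr_divide powr_powr Ap)
        have "(\<integral>\<^sup>+z. ennreal ((?g z powr (p - 1) / B) powr q * w z) \<partial>disc) = (\<integral>\<^sup>+z. ennreal (1 / x) * ennreal (?g z powr p * w z) \<partial>disc)"
          unfolding gq using x0 by (intro nn_integral_cong) (auto simp flip: ennreal_mult')
        also have "\<dots> = ennreal (1 / x) * ennreal x" by (simp add: nn_integral_cmult x)
        also have "\<dots> = 1" using x0 by (simp flip: ennreal_mult)
        finally show "(\<integral>\<^sup>+z. ennreal ((?g z powr (p - 1) / B) powr (p / (p - 1)) * w z) \<partial>disc) \<le> 1"
          by (simp add: q_def)
      qed (use AB F0 g0 in auto)
      have "ennreal (1 / (A * B)) * ennreal x = (\<integral>\<^sup>+z. ennreal (1 / (A * B)) * ennreal (?g z powr p * w z) \<partial>disc)"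
        by (simp add: nn_integral_cmult x)
      also have "\<dots> \<le> (\<integral>\<^sup>+z. \<integral>\<^sup>+u. ?k z u \<partial>disc \<partial>disc)"
      proof (rule nn_integral_mono)
        fix z assume z: "z \<in> space disc"
        have [measurable]: "(\<lambda>u. kern z u) \<in> borel_measurable disc"
          using measurable_compose[OF measurable_Pair1'[OF z] measurable_kern] by simp
        have gp: "?g z powr p \<le> G z * ?g z powr (p - 1)"
        proof (cases "?g z = 0")
          case False
          then have "?g z powr p = ?g z * ?g z powr (p - 1)" using g0[of z] by (simp add: powr_diff)
          also have "\<dots> \<le> G z * ?g z powr (p - 1)" by (intro mult_right_mono) auto
          finally show ?thesis .
        qed (use F0 p in auto)
        have "ennreal (1 / (A * B)) * ennreal (?g z powr p * w z) \<le> ennreal (G z) * (ennreal (1 / A) * ennreal (?g z powr (p - 1) / B * w z))"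
        proof -
          have "1 / (A * B) * (?g z powr p * w z) \<le> 1 / (A * B) * ((G z * ?g z powr (p - 1)) * w z)"
            using gp AB pos(1)[of z] by (intro mult_left_mono mult_right_mono) (auto simp: less_imp_le)
          also have "\<dots> = G z * (1 / A * (?g z powr (p - 1) / B * w z))" by (simp add: field_simps)
          finally show ?thesis using AB F0(2)[of z] pos(1)[of z]
            by (simp add: ennreal_leI less_imp_le flip: ennreal_mult)
        qed
        also have "\<dots> \<le> (\<integral>\<^sup>+u. ennreal (kern z u) * ennreal (F u) \<partial>disc) * (ennreal (1 / A) * ennreal (?g z powr (p - 1) / B * w z))"
          using G[of z] z by (intro mult_right_mono) auto
        also have "\<dots> = (\<integral>\<^sup>+u. ennreal (kern z u) * ennreal (F u) * (ennreal (1 / A) * ennreal (?g z powr (p - 1) / B * w z)) \<partial>disc)"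
          by (rule nn_integral_multc[symmetric]) measurable
        also have "\<dots> = (\<integral>\<^sup>+u. ?k z u \<partial>disc)"
        proof (rule nn_integral_cong)
          fix u
          have "ennreal (F u / A) = ennreal (F u) * ennreal (1 / A)"
            using F0(1)[of u] AB by (simp flip: ennreal_mult)
          then show "ennreal (kern z u) * ennreal (F u) * (ennreal (1 / A) * ennreal (?g z powr (p - 1) / B * w z))
            = ?k z u"
            by (simp only: mult.assoc)
        qed
        finally show "ennreal (1 / (A * B)) * ennreal (?g z powr p * w z)
          \<le> (\<integral>\<^sup>+u. ?k z u \<partial>disc)" .
      qed
      also note form
      finally have "ennreal (x / (A * B)) \<le> ennreal R" using AB x0 by (simp flip: ennreal_mult)
      then have xR: "x / (A * B) \<le> R" using R0 by simp
      \<comment> \<open>Dividing by \<open>B = x powr (1 / q)\<close> turns the bound on the form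
        into one on the norm, because 1 - 1/q = 1/p.\<close>
      have "x = x powr (1 / p) * B"
        using x0 q(2) by (simp add: B_def flip: powr_add)
      then have "x / (A * B) = x powr (1 / p) * B / (A * B)" by simp
      also have "\<dots> = x powr (1 / p) / A" using AB by simp
      finally have "x powr (1 / p) \<le> R * A" using xR AB by (simp add: pos_divide_le_eq)
      then have "(x powr (1 / p)) powr p \<le> (R * A) powr p" using p by (intro powr_mono2) auto
      then have "x \<le> R powr p * a" using p x0 R0 AB by (simp add: powr_powr powr_mult Ap)
      then show ?thesis unfolding x by (rule ennreal_leI)
    qed (simp add: x)
  qed
  have sup: "(\<integral>\<^sup>+x. ennreal (G x powr p * w x) \<partial>disc) = (SUP n. \<integral>\<^sup>+x. ennreal (min (G x) (real n) powr p * w x) \<partial>disc)"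
  proof -
    have "(\<integral>\<^sup>+x. ennreal (G x powr p * w x) \<partial>disc) = (\<integral>\<^sup>+x. (SUP n. ennreal (min (G x) (real n) powr p * w x)) \<partial>disc)"
    proof (rule nn_integral_cong)
      fix x
      have le: "ennreal (min (G x) (real n) powr p * w x) \<le> ennreal (G x powr p * w x)" for n
        using F0(2)[of x] p pos(1)[of x] by (intro ennreal_leI mult_right_mono powr_mono2) auto
      obtain n where n: "G x \<le> real n" using real_arch_simple by blast
      show "ennreal (G x powr p * w x) = (SUP n. ennreal (min (G x) (real n) powr p * w x))"
      proof (rule antisym)
        show "ennreal (G x powr p * w x) \<le> (SUP n. ennreal (min (G x) (real n) powr p * w x))"
          by (rule SUP_upper2[of n]) (use n in \<open>auto simp: min_absorb1\<close>)
      qed (rule SUP_least, rule le)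
    qed
    also have "\<dots> = (SUP n. \<integral>\<^sup>+x. ennreal (min (G x) (real n) powr p * w x) \<partial>disc)"
    proof (rule nn_integral_monotone_convergence_SUP)
      show "incseq (\<lambda>n x. ennreal (min (G x) (real n) powr p * w x))"
      proof (rule incseq_SucI, rule le_funI)
        fix n x
        show "ennreal (min (G x) (real n) powr p * w x) \<le> ennreal (min (G x) (real (Suc n)) powr p * w x)"
          using F0(2)[of x] p pos(1)[of x] by (intro ennreal_leI mult_right_mono powr_mono2) auto
      qed
    qed measurable
    finally show ?thesis .
  qed
  show ?thesis unfolding sup R_def[symmetric] by (rule SUP_least) (rule fin)
qed

lemma Bp_bound_one: "Bp_bound 2 (\<lambda>_. 1) (\<lambda>_. 1) 1"
  unfolding Bp_bound_def
proof (intro allI impI)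
  fix \<theta> l :: real
  let ?m = "measure disc (carleson_box \<theta> l)"
  have "(\<integral>\<^sup>+z\<in>carleson_box \<theta> l. ennreal 1 \<partial>disc) = ennreal ?m"
    by (simp add: disc.emeasure_eq_measure)
  moreover have "?m * ?m powr (2 - 1) \<le> 1 * ?m powr 2" by (simp add: power2_eq_square)
  ultimately show "\<exists>W T. 0 \<le> W \<and> 0 \<le> T \<and> (\<integral>\<^sup>+z\<in>carleson_box \<theta> l. ennreal 1 \<partial>disc) = ennreal W \<and>
      (\<integral>\<^sup>+z\<in>carleson_box \<theta> l. ennreal 1 \<partial>disc) = ennreal T \<and> W * T powr (2 - 1) \<le> 1 * ?m powr 2"
    using measure_nonneg by blast
qed

lemma kernel_operator_L2:
  fixes F G :: "complex \<Rightarrow> real"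
  assumes [measurable]: "F \<in> borel_measurable disc" "G \<in> borel_measurable disc"
    and F0: "\<And>x. 0 \<le> F x" "\<And>x. 0 \<le> G x"
    and G: "\<And>z. z \<in> ball 0 1 \<Longrightarrow> ennreal (G z) \<le> (\<integral>\<^sup>+u. ennreal (kern z u) * ennreal (F u) \<partial>disc)"
    and F: "(\<integral>\<^sup>+x. ennreal ((F x)\<^sup>2) \<partial>disc) < \<infinity>"
  shows "(\<integral>\<^sup>+x. ennreal ((G x)\<^sup>2) \<partial>disc) < \<infinity>"
proof -
  obtain a where a: "0 \<le> a" "(\<integral>\<^sup>+x. ennreal ((F x)\<^sup>2) \<partial>disc) = ennreal a"
    using F by (cases "\<integral>\<^sup>+x. ennreal ((F x)\<^sup>2) \<partial>disc") auto
  have sq: "(\<lambda>x. ennreal (H x powr 2 * 1)) = (\<lambda>x. ennreal ((H x)\<^sup>2))" if "\<And>x. 0 \<le> H x" for H :: "complex \<Rightarrow> real"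
    using that by simp
  \<comment> \<open>The bound a + 1 is used instead of a because the operator estimate asks for a
    strictly positive bound and F may vanish.\<close>
  have "(\<integral>\<^sup>+x. ennreal (G x powr 2 * 1) \<partial>disc) \<le> ennreal ((disc_const 2 * 1 powr max 1 (1 / (2 - 1))) powr 2 * (a + 1))"
  proof (rule kernel_operator_bound[where w = "\<lambda>_. 1" and s = "\<lambda>_. 1" and F = F])
    show "(\<integral>\<^sup>+x. ennreal (F x powr 2 * 1) \<partial>disc) \<le> ennreal (a + 1)"
      unfolding sq[OF F0(1)] a(2) using a(1) by (intro ennreal_leI) simp
  qed (use F0 G a Bp_bound_one in auto)
  also have "\<dots> < \<infinity>" by simp
  finally show ?thesis unfolding sq[OF F0(2)] .
qed

section \<open>The Bergman projection of the disc\<close>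

lemma holomorphic_measurable_disc:
  assumes "h holomorphic_on ball 0 1"
  shows "(\<lambda>z. indicator (ball 0 1) z *\<^sub>R h z) \<in> borel_measurable borel" "h \<in> borel_measurable disc"
proof -
  show b: "(\<lambda>z. indicator (ball 0 1) z *\<^sub>R h z) \<in> borel_measurable borel"
    using assms by (intro borel_measurable_continuous_on_indicator) (auto intro: holomorphic_on_imp_continuous_on)
  have "(\<lambda>z. indicator (ball 0 1) z *\<^sub>R h z) \<in> borel_measurable disc" using b by (rule measurable_disc_borel)
  then show "h \<in> borel_measurable disc" by (rule measurable_cong[THEN iffD1, rotated]) auto
qed

text \<open>Cauchy's formula at 0 for the function sending w to h(zw), which is holomorphic on the
  closed unit disc because |z| < 1. The circle of integration is always the unit circle, so z = 0
  needs no separate treatment.\<close>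

lemma circle_mean:
  assumes h: "h holomorphic_on ball 0 1" and z: "z \<in> ball 0 1"
  shows "(\<integral>t. h (z * cis (2 * pi * t)) \<partial>lebesgue_on {0..1}) = h 0"
proof -
  have sub: "z * w \<in> ball 0 1" if "w \<in> cball 0 1" for w
  proof -
    have "cmod z * cmod w \<le> cmod z * 1" using that by (intro mult_left_mono) auto
    then show ?thesis using z by (simp add: norm_mult)
  qed
  have "(h \<circ> (\<lambda>w. z * w)) holomorphic_on cball 0 1"
    using sub by (intro holomorphic_on_compose_gen[OF _ h] holomorphic_intros) auto
  then have f: "(\<lambda>w. h (z * w)) holomorphic_on cball 0 1" by (simp add: o_def)
  have e: "exp (2 * of_real pi * \<i> * of_real t) = cis (2 * pi * t)" for t
    by (simp add: cis_conv_exp mult_ac)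
  have "((\<lambda>u. h (z * u) / (u - 0)) has_contour_integral (2 * of_real pi * \<i> * h 0)) (circlepath 0 1)"
    using Cauchy_integral_circlepath_simple[OF f, of 0] by simp
  then have "((\<lambda>t. (2 * of_real pi * \<i>) * h (z * cis (2 * pi * t))) has_integral ((2 * of_real pi * \<i>) * h 0)) {0..1}"
    unfolding has_contour_integral_def
  proof (rule has_integral_eq[rotated])
    fix t :: real assume "t \<in> {0..1}"
    then have vd: "vector_derivative (circlepath 0 1) (at t within {0..1}) = 2 * of_real pi * \<i> * cis (2 * pi * t)"
      by (simp add: vector_derivative_circlepath01 e)
    show "h (z * circlepath 0 1 t) / (circlepath 0 1 t - 0) * vector_derivative (circlepath 0 1) (at t within {0..1})
        = (2 * of_real pi * \<i>) * h (z * cis (2 * pi * t))"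
      unfolding vd by (simp add: circlepath e)
  qed
  then have "((\<lambda>t. (1 / (2 * of_real pi * \<i>)) * ((2 * of_real pi * \<i>) * h (z * cis (2 * pi * t))))
      has_integral (1 / (2 * of_real pi * \<i>)) * ((2 * of_real pi * \<i>) * h 0)) {0..1}"
    by (rule has_integral_mult_right)
  then have hi: "((\<lambda>t. h (z * cis (2 * pi * t))) has_integral h 0) {0..1}" by simp
  have "continuous_on {0..1} (\<lambda>t. h (z * cis (2 * pi * t)))"
    using sub by (intro continuous_on_compose2[OF holomorphic_on_imp_continuous_on[OF h]] continuous_intros) auto
  then have "integrable (lebesgue_on {0..1}) (\<lambda>t. h (z * cis (2 * pi * t)))"
    using absolutely_integrable_continuous_real by (subst integrable_restrict_space) (auto simp: set_integrable_def)
  then show ?thesis using hi by (simp add: lebesgue_integral_eq_integral integral_unique)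
qed

lemma rotate_ball: "(\<lambda>z. z * cis t) ` ball 0 1 = ball 0 1"
proof (intro equalityI subsetI)
  fix z :: complex assume "z \<in> ball 0 1"
  then show "z \<in> (\<lambda>z. z * cis t) ` ball 0 1"
    by (intro image_eqI[of _ _ "z * cis (- t)"]) (auto simp: norm_mult cis_mult mult.assoc)
qed (auto simp: norm_mult)

lemma disc_rotate:
  fixes f :: "complex \<Rightarrow> complex"
  assumes f: "f \<in> borel_measurable disc"
  shows "(\<integral>z. f (z * cis t) \<partial>disc) = (\<integral>z. f z \<partial>disc)"
    and "(\<integral>\<^sup>+z. ennreal (cmod (f (z * cis t))) \<partial>disc) = (\<integral>\<^sup>+z. ennreal (cmod (f z)) \<partial>disc)"
proof -
  have d: "deriv (\<lambda>z. z * cis t) z = cis t" for z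
    by (rule DERIV_imp_deriv) (auto intro!: derivative_eq_intros)
  have c: "open (ball 0 1 :: complex set)" "(\<lambda>z. z * cis t) holomorphic_on ball 0 1" "inj_on (\<lambda>z. z * cis t) (ball 0 1)"
    by (auto intro!: holomorphic_intros simp: inj_on_def)
  show "(\<integral>z. f (z * cis t) \<partial>disc) = (\<integral>z. f z \<partial>disc)"
    using conformal_integral[OF c, of f] f by (simp add: rotate_ball d)
  show "(\<integral>\<^sup>+z. ennreal (cmod (f (z * cis t))) \<partial>disc) = (\<integral>\<^sup>+z. ennreal (cmod (f z)) \<partial>disc)"
    using conformal_nn_integral[OF c, of "\<lambda>z. ennreal (cmod (f z))"] f by (simp add: rotate_ball d)
qed

lemma measure_disc: "measure disc (ball 0 1) = 1"
  by (simp add: measure_def emeasure_disc emeasure_dA_ball)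

text \<open>Area is rotation invariant, so the integral equals its average over all rotations. After
  Fubini the inner average is a circular mean, equal to h(0) at every point; no polar coordinates
  are needed.\<close>

lemma disc_mean_value:
  assumes h: "h holomorphic_on ball 0 1" and int: "integrable disc h"
  shows "(\<integral>z. h z \<partial>disc) = h 0"
proof -
  let ?U = "lebesgue_on {0..1::real}"
  interpret U: finite_measure ?U by (rule finite_measureI) (simp add: emeasure_restrict_space)
  interpret P: pair_sigma_finite ?U disc by standard
  have mU: "measure ?U {0..1} = 1" by (simp add: measure_restrict_space)
  define f where "f t z = h (z * cis (2 * pi * t))" for t :: real and z
  have meas: "case_prod f \<in> borel_measurable (?U \<Otimes>\<^sub>M disc)"
  proof -
    note [measurable] = holomorphic_measurable_disc(1)[OF h]
    have [measurable]: "(\<lambda>t. cis (2 * pi * t)) \<in> borel_measurable borel"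
      by (intro borel_measurable_continuous_onI continuous_intros)
    have [measurable]: "fst \<in> borel_measurable (?U \<Otimes>\<^sub>M disc)" "snd \<in> borel_measurable (?U \<Otimes>\<^sub>M disc)"
    proof -
      have U: "(\<lambda>t. t) \<in> borel_measurable ?U"
        by (intro measurable_restrict_space1 measurable_completion) simp
      show "fst \<in> borel_measurable (?U \<Otimes>\<^sub>M disc)" "snd \<in> borel_measurable (?U \<Otimes>\<^sub>M disc)"
        using measurable_compose[OF measurable_fst U] measurable_compose[OF measurable_snd measurable_disc_borel[of "\<lambda>x. x"]]
        by auto
    qed
    have "(\<lambda>x. (\<lambda>z. indicator (ball 0 1) z *\<^sub>R h z) (snd x * cis (2 * pi * fst x))) \<in> borel_measurable (?U \<Otimes>\<^sub>M disc)"
      by measurable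
    then show ?thesis
      by (rule measurable_cong[THEN iffD1, rotated]) (auto simp: f_def space_pair_measure norm_mult)
  qed
  have nn: "(\<integral>\<^sup>+z. ennreal (cmod (f t z)) \<partial>disc) = (\<integral>\<^sup>+z. ennreal (cmod (h z)) \<partial>disc)" for t
    unfolding f_def using int by (intro disc_rotate(2)) auto
  have "integrable (?U \<Otimes>\<^sub>M disc) (case_prod f)"
  proof (rule integrableI_bounded[OF meas])
    have "(\<integral>\<^sup>+x. ennreal (norm (case_prod f x)) \<partial>(?U \<Otimes>\<^sub>M disc)) = (\<integral>\<^sup>+t. \<integral>\<^sup>+z. ennreal (cmod (f t z)) \<partial>disc \<partial>?U)"
      using meas by (subst disc.nn_integral_fst[symmetric]) auto
    also have "\<dots> = (\<integral>\<^sup>+t. (\<integral>\<^sup>+z. ennreal (cmod (h z)) \<partial>disc) \<partial>?U)" by (simp only: nn)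
    also have "\<dots> = (\<integral>\<^sup>+z. ennreal (cmod (h z)) \<partial>disc)" by (simp add: emeasure_restrict_space)
    also have "\<dots> < \<infinity>" using int by (simp add: integrable_iff_bounded)
    finally show "(\<integral>\<^sup>+x. ennreal (norm (case_prod f x)) \<partial>(?U \<Otimes>\<^sub>M disc)) < \<infinity>" .
  qed
  then have "(\<integral>z. (\<integral>t. f t z \<partial>?U) \<partial>disc) = (\<integral>t. (\<integral>z. f t z \<partial>disc) \<partial>?U)"
    by (rule P.Fubini_integral)
  also have "\<dots> = (\<integral>t. (\<integral>z. h z \<partial>disc) \<partial>?U)"
    using int by (simp add: f_def disc_rotate(1))
  also have "\<dots> = (\<integral>z. h z \<partial>disc)" by (simp add: mU)
  finally have "(\<integral>z. h z \<partial>disc) = (\<integral>z. (\<integral>t. f t z \<partial>?U) \<partial>disc)" ..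
  also have "\<dots> = (\<integral>z. h 0 \<partial>disc)"
    using h by (intro Bochner_Integration.integral_cong) (auto simp: f_def circle_mean)
  also have "\<dots> = h 0" by (simp add: measure_disc)
  finally show ?thesis .
qed

section \<open>The integral operator with the Bergman kernel\<close>

definition berg :: "(complex \<Rightarrow> complex) \<Rightarrow> complex \<Rightarrow> complex" where
  "berg F z = (\<integral>u. F u / (1 - z * cnj u)\<^sup>2 \<partial>disc)"

lemma measurable_cnj [measurable]: "cnj \<in> borel_measurable borel"
  by (intro borel_measurable_continuous_onI continuous_intros)

lemma measurable_id_disc [measurable]: "(\<lambda>u. u) \<in> borel_measurable disc"
  by (rule measurable_disc_borel) simp

lemma berg_integrable:
  assumes F: "integrable disc F" and z: "z \<in> ball 0 1"
  shows "integrable disc (\<lambda>u. F u / (1 - z * cnj u)\<^sup>2)"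
proof (rule Bochner_Integration.integrable_bound)
  have z1: "0 < 1 - cmod z" using z by simp
  show "integrable disc (\<lambda>u. (1 / (1 - cmod z)\<^sup>2) *\<^sub>R F u)" using F by simp
  show "(\<lambda>u. F u / (1 - z * cnj u)\<^sup>2) \<in> borel_measurable disc" using F by measurable
  show "AE u in disc. norm (F u / (1 - z * cnj u)\<^sup>2) \<le> norm ((1 / (1 - cmod z)\<^sup>2) *\<^sub>R F u)"
  proof (rule AE_I2)
    fix u assume u: "u \<in> space disc"
    have "(1 - cmod z)\<^sup>2 \<le> (cmod (1 - z * cnj u))\<^sup>2"
      using kernel_denominator_bounds(1)[OF z] u z1 by (intro power_mono) auto
    then have "cmod (F u) / (cmod (1 - z * cnj u))\<^sup>2 \<le> cmod (F u) / (1 - cmod z)\<^sup>2"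
      using z1 by (intro divide_left_mono mult_pos_pos) (auto intro: less_le_trans[of _ "(1 - cmod z)\<^sup>2"])
    then show "norm (F u / (1 - z * cnj u)\<^sup>2) \<le> norm ((1 / (1 - cmod z)\<^sup>2) *\<^sub>R F u)"
      by (simp add: norm_divide norm_power norm_mult)
  qed
qed

text \<open>Expand 1/(1 - x)^2 as the series of (n + 1) x^n and integrate term by term; for fixed w
  in the disc the terms are dominated by a summable sequence times |F|, so integrability of F is
  enough.\<close>

lemma berg_holomorphic:
  assumes F: "integrable disc F"
  shows "berg F holomorphic_on ball 0 1"
proof (rule power_series_holomorphic)
  fix w :: complex assume w: "w \<in> ball 0 1"
  have [measurable]: "F \<in> borel_measurable disc" using F by simp
  define f where "f n u = of_nat (Suc n) * (w * cnj u) ^ n * F u" for n u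
  have nf: "norm (f n u) \<le> (real (Suc n) * cmod w ^ n) * cmod (F u)" if "u \<in> ball 0 1" for n u
  proof -
    have "cmod (w * cnj u) ^ n \<le> cmod w ^ n"
      using that by (intro power_mono) (auto simp: norm_mult intro: mult_left_le)
    then show ?thesis
      unfolding f_def norm_mult norm_of_nat norm_power[of "w * cnj u"] by (intro mult_mono mult_left_mono) auto
  qed
  have sm: "summable (\<lambda>n. real (Suc n) * cmod w ^ n)"
    using geometric_deriv_sums[of "cmod w"] w by (auto simp: sums_iff)
  have intf: "integrable disc (f n)" for n
  proof (rule Bochner_Integration.integrable_bound)
    show "integrable disc (\<lambda>u. (real (Suc n) * cmod w ^ n) * cmod (F u))" using F by simp
    show "f n \<in> borel_measurable disc" unfolding f_def by measurable
    show "AE u in disc. norm (f n u) \<le> norm ((real (Suc n) * cmod w ^ n) * cmod (F u))"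
      using nf by (intro AE_I2) (auto simp: abs_mult)
  qed
  have "(\<lambda>n. \<integral>u. f n u \<partial>disc) sums (\<integral>u. (\<Sum>n. f n u) \<partial>disc)"
  proof (rule sums_integral[OF intf])
    show "AE u in disc. summable (\<lambda>n. norm (f n u))"
    proof (rule AE_I2)
      fix u assume "u \<in> space disc"
      then show "summable (\<lambda>n. norm (f n u))"
        using nf by (intro summable_comparison_test'[OF summable_mult2[OF sm, of "cmod (F u)"]]) auto
    qed
    show "summable (\<lambda>n. \<integral>u. norm (f n u) \<partial>disc)"
    proof (rule summable_comparison_test'[OF summable_mult2[OF sm, of "\<integral>u. cmod (F u) \<partial>disc"]])
      fix n
      have "(\<integral>u. norm (f n u) \<partial>disc) \<le> (\<integral>u. (real (Suc n) * cmod w ^ n) * cmod (F u) \<partial>disc)"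
        using nf intf F by (intro integral_mono) auto
      then show "norm (\<integral>u. norm (f n u) \<partial>disc) \<le> (real (Suc n) * cmod w ^ n) * (\<integral>u. cmod (F u) \<partial>disc)"
        by (simp add: integral_nonneg_AE)
    qed
  qed
  also have "(\<integral>u. (\<Sum>n. f n u) \<partial>disc) = berg F w"
    unfolding berg_def
  proof (rule Bochner_Integration.integral_cong[OF refl])
    fix u assume "u \<in> space disc"
    then have "cmod (w * cnj u) < 1" using w norm_mult_less[of w 1 "cnj u" 1] by simp
    from sums_mult2[OF geometric_deriv_sums[OF this], of "F u"]
    show "(\<Sum>n. f n u) = F u / (1 - w * cnj u)\<^sup>2" by (simp add: f_def sums_iff)
  qed
  also have "(\<lambda>n. \<integral>u. f n u \<partial>disc) = (\<lambda>n. (of_nat (Suc n) * (\<integral>u. cnj u ^ n * F u \<partial>disc)) * (w - 0) ^ n)"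
  proof
    fix n
    have "(\<integral>u. f n u \<partial>disc) = (\<integral>u. (of_nat (Suc n) * w ^ n) * (cnj u ^ n * F u) \<partial>disc)"
      by (intro Bochner_Integration.integral_cong) (auto simp: f_def power_mult_distrib mult_ac)
    also have "\<dots> = (of_nat (Suc n) * w ^ n) * (\<integral>u. cnj u ^ n * F u \<partial>disc)"
      by (rule integral_mult_right_zero)
    finally show "(\<integral>u. f n u \<partial>disc) = (of_nat (Suc n) * (\<integral>u. cnj u ^ n * F u \<partial>disc)) * (w - 0) ^ n"
      by (simp only: diff_zero mult_ac)
  qed
  finally show "(\<lambda>n. (of_nat (Suc n) * (\<integral>u. cnj u ^ n * F u \<partial>disc)) * (w - 0) ^ n) sums berg F w" .
qed

lemma berg_le:
  assumes F: "integrable disc F" and z: "z \<in> ball 0 1"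
  shows "ennreal (cmod (berg F z)) \<le> (\<integral>\<^sup>+u. ennreal (kern z u) * ennreal (cmod (F u)) \<partial>disc)"
proof -
  have "ennreal (cmod (berg F z)) \<le> (\<integral>\<^sup>+u. ennreal (cmod (F u / (1 - z * cnj u)\<^sup>2)) \<partial>disc)"
    unfolding berg_def by (rule integral_norm_bound_ennreal[OF berg_integrable[OF F z]])
  also have "\<dots> = (\<integral>\<^sup>+u. ennreal (kern z u) * ennreal (cmod (F u)) \<partial>disc)"
    by (intro nn_integral_cong) (auto simp: kern_def norm_divide norm_power simp flip: ennreal_mult)
  finally show ?thesis .
qed

definition sq_int :: "(complex \<Rightarrow> complex) \<Rightarrow> bool" where
  "sq_int F \<longleftrightarrow> F \<in> borel_measurable disc \<and> integrable disc (\<lambda>z. (cmod (F z))\<^sup>2)"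

lemma sq_int_nn: "sq_int F \<longleftrightarrow> F \<in> borel_measurable disc \<and> (\<integral>\<^sup>+z. ennreal ((cmod (F z))\<^sup>2) \<partial>disc) < \<infinity>"
  by (auto simp: sq_int_def integrable_iff_bounded)

lemma sq_int_integrable:
  assumes "sq_int F"
  shows "integrable disc F"
proof -
  have [measurable]: "F \<in> borel_measurable disc" and i: "integrable disc (\<lambda>z. (cmod (F z))\<^sup>2)"
    using assms by (auto simp: sq_int_def)
  have "(\<lambda>z. cmod (F z)) \<in> borel_measurable disc" by measurable
  from disc.square_integrable_imp_integrable[OF this i] have "integrable disc (\<lambda>z. norm (F z))" .
  then show ?thesis by (subst (asm) integrable_norm_iff) auto
qed

lemma sq_int_mult:
  assumes "sq_int F" "sq_int G"
  shows "integrable disc (\<lambda>z. F z * cnj (G z))"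
proof (rule Bochner_Integration.integrable_bound)
  show "integrable disc (\<lambda>z. (cmod (F z))\<^sup>2 + (cmod (G z))\<^sup>2)" using assms by (auto simp: sq_int_def)
  show "(\<lambda>z. F z * cnj (G z)) \<in> borel_measurable disc" using assms by (auto simp: sq_int_def)
  have "x * y \<le> x\<^sup>2 + y\<^sup>2" if "0 \<le> x" "0 \<le> y" for x y :: real
  proof -
    have "2 * x * y \<le> x\<^sup>2 + y\<^sup>2" by (rule sum_squares_bound)
    moreover have "0 \<le> x * y" using that by simp
    ultimately show ?thesis by linarith
  qed
  then show "AE z in disc. norm (F z * cnj (G z)) \<le> norm ((cmod (F z))\<^sup>2 + (cmod (G z))\<^sup>2)"
    by (intro AE_I2) (auto simp: norm_mult)
qed

lemma sq_int_berg:
  assumes F: "sq_int F"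
  shows "sq_int (berg F)"
proof -
  note i = sq_int_integrable[OF F]
  have m [measurable]: "berg F \<in> borel_measurable disc" "F \<in> borel_measurable disc"
    using holomorphic_measurable_disc(2)[OF berg_holomorphic[OF i]] F by (auto simp: sq_int_def)
  have "(\<integral>\<^sup>+z. ennreal ((cmod (berg F z))\<^sup>2) \<partial>disc) < \<infinity>"
    by (rule kernel_operator_L2[of "\<lambda>z. cmod (F z)"]) (use F berg_le[OF i] in \<open>auto simp: sq_int_nn\<close>)
  then show ?thesis by (simp add: sq_int_nn)
qed

text \<open>The mean value property of \<open>(h \<circ> \<psi>) \<psi>'\<close>, where \<open>\<psi>\<close> is the disc automorphism taking 0 to \<open>w\<close>; changing
  variables back turns \<open>\<psi>'\<close> into the kernel.\<close>

theorem berg_reproducing: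
  assumes h: "h holomorphic_on ball 0 1" "sq_int h" and w: "w \<in> ball 0 1"
  shows "berg h w = h w"
proof -
  define \<psi> where "\<psi> = Moebius_function 0 (- w)"
  have w1: "cmod w < 1" using w by simp
  have \<psi>: "\<psi> \<zeta> = (\<zeta> + w) / (1 + cnj w * \<zeta>)" for \<zeta> by (simp add: \<psi>_def Moebius_function_simple)
  have nz: "1 + cnj w * \<zeta> \<noteq> 0" if "\<zeta> \<in> ball 0 1" for \<zeta>
  proof
    assume "1 + cnj w * \<zeta> = 0"
    then have "cmod (cnj w * \<zeta>) = 1" by (metis add_eq_0_iff norm_minus_cancel norm_one)
    moreover have "cmod (cnj w * \<zeta>) < 1" using that w1 norm_mult_less[of "cnj w" 1 \<zeta> 1] by simp
    ultimately show False by simp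
  qed
  have hol: "\<psi> holomorphic_on ball 0 1"
    unfolding \<psi>_def using w1 by (intro Moebius_function_holomorphic) simp
  have inv: "Moebius_function 0 w (\<psi> \<zeta>) = \<zeta>" if "\<zeta> \<in> ball 0 1" for \<zeta>
    unfolding \<psi>_def using that w1 by (intro Moebius_function_compose) auto
  have inv': "\<psi> (Moebius_function 0 w z) = z" if "z \<in> ball 0 1" for z
    unfolding \<psi>_def using that w1 by (intro Moebius_function_compose) auto
  have inj: "inj_on \<psi> (ball 0 1)" using inv by (metis inj_onI)
  have img: "\<psi> ` ball 0 1 = ball 0 1"
  proof (intro equalityI subsetI)
    fix z :: complex assume "z \<in> \<psi> ` ball 0 1"
    then show "z \<in> ball 0 1" unfolding \<psi>_def using Moebius_function_norm_lt_1[of "- w"] w1 by auto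
  next
    fix z :: complex assume z: "z \<in> ball 0 1"
    then have "Moebius_function 0 w z \<in> ball 0 1" using Moebius_function_norm_lt_1[OF w1] by simp
    then show "z \<in> \<psi> ` ball 0 1" using inv'[OF z] by (metis imageI)
  qed
  \<comment> \<open>This is the derivative of the automorphism at 0, so the mean value at 0 yields c
    times h(w).\<close>
  define c where "c = 1 - (cmod w)\<^sup>2"
  have c: "0 < c" using w1 by (simp add: c_def power_less_one_iff abs_square_less_1)
  have cw: "of_real c = 1 - cnj w * w"
    using complex_norm_square[of w] by (simp only: c_def of_real_diff of_real_1 mult.commute)
  have d: "deriv \<psi> \<zeta> = of_real c / (1 + cnj w * \<zeta>)\<^sup>2" if "\<zeta> \<in> ball 0 1" for \<zeta>
  proof (rule DERIV_imp_deriv)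
    have "((\<lambda>\<zeta>. (\<zeta> + w) / (1 + cnj w * \<zeta>)) has_field_derivative
        (1 * (1 + cnj w * \<zeta>) - (\<zeta> + w) * cnj w) / ((1 + cnj w * \<zeta>) * (1 + cnj w * \<zeta>))) (at \<zeta>)"
      using nz[OF that] by (intro DERIV_divide) (auto intro!: derivative_eq_intros)
    moreover have "1 * (1 + cnj w * \<zeta>) - (\<zeta> + w) * cnj w = of_real c"
      by (simp add: cw algebra_simps)
    ultimately show "(\<psi> has_field_derivative of_real c / (1 + cnj w * \<zeta>)\<^sup>2) (at \<zeta>)"
      unfolding \<psi>[abs_def] by (simp add: power2_eq_square)
  qed
  note conf = open_ball[of "0::complex" 1] hol inj
  define H where "H \<zeta> = h (\<psi> \<zeta>) * deriv \<psi> \<zeta>" for \<zeta>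
  have holH: "H holomorphic_on ball 0 1"
    unfolding H_def using img
    by (intro holomorphic_intros holomorphic_on_compose_gen[OF hol h(1), unfolded o_def] holomorphic_deriv[OF hol]) auto
  have hm: "h \<in> borel_measurable disc" using h(2) by (simp add: sq_int_def)
  have "(\<integral>\<^sup>+\<zeta>. ennreal ((cmod (H \<zeta>))\<^sup>2) \<partial>disc) = (\<integral>\<^sup>+z. ennreal ((cmod (h z))\<^sup>2) \<partial>disc)"
    using conformal_nn_integral[OF conf, of "\<lambda>z. ennreal ((cmod (h z))\<^sup>2)"] hm
    by (simp add: img H_def norm_mult power_mult_distrib ennreal_mult mult.commute)
  then have sqH: "sq_int H"
    using h(2) holomorphic_measurable_disc(2)[OF holH] by (simp add: sq_int_nn)
  have "(\<integral>z. h z * (of_real c / (1 - w * cnj z)\<^sup>2) \<partial>disc)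
     = (\<integral>\<zeta>. (cmod (deriv \<psi> \<zeta>))\<^sup>2 *\<^sub>R (h (\<psi> \<zeta>) * (of_real c / (1 - w * cnj (\<psi> \<zeta>))\<^sup>2)) \<partial>disc)"
    using conformal_integral[OF conf, of "\<lambda>z. h z * (of_real c / (1 - w * cnj z)\<^sup>2)"] hm
    by (simp add: img)
  also have "\<dots> = (\<integral>\<zeta>. H \<zeta> \<partial>disc)"
  proof (rule Bochner_Integration.integral_cong[OF refl])
    fix \<zeta> assume "\<zeta> \<in> space disc"
    then have \<zeta>: "\<zeta> \<in> ball 0 1" by simp
    \<comment> \<open>The squared denominator is the conjugate of c times the derivative of \<psi>.
      It cancels the conjugate factor of the Jacobian and leaves the integrand H.\<close>
    have "1 - cnj w * \<psi> \<zeta> = of_real c / (1 + cnj w * \<zeta>)"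
      using nz[OF \<zeta>] by (simp add: \<psi> cw field_simps)
    then have "(1 - cnj w * \<psi> \<zeta>)\<^sup>2 = of_real c * deriv \<psi> \<zeta>"
      by (simp add: d[OF \<zeta>] power_divide power2_eq_square)
    then have "cnj ((1 - cnj w * \<psi> \<zeta>)\<^sup>2) = of_real c * cnj (deriv \<psi> \<zeta>)" by simp
    then have "(1 - w * cnj (\<psi> \<zeta>))\<^sup>2 = of_real c * cnj (deriv \<psi> \<zeta>)" by simp
    moreover have "deriv \<psi> \<zeta> \<noteq> 0" using nz[OF \<zeta>] c by (simp add: d[OF \<zeta>])
    moreover have "complex_of_real ((cmod (deriv \<psi> \<zeta>))\<^sup>2) = deriv \<psi> \<zeta> * cnj (deriv \<psi> \<zeta>)" by (rule complex_norm_square)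
    ultimately show "(cmod (deriv \<psi> \<zeta>))\<^sup>2 *\<^sub>R (h (\<psi> \<zeta>) * (of_real c / (1 - w * cnj (\<psi> \<zeta>))\<^sup>2)) = H \<zeta>"
      using c by (simp add: H_def scaleR_conv_of_real)
  qed
  also have "\<dots> = H 0" by (rule disc_mean_value[OF holH sq_int_integrable[OF sqH]])
  also have "\<dots> = of_real c * h w" by (simp add: H_def d \<psi>)
  also have "(\<integral>z. h z * (of_real c / (1 - w * cnj z)\<^sup>2) \<partial>disc) = of_real c * berg h w"
    unfolding berg_def by (subst integral_mult_right_zero[symmetric]) (auto intro!: Bochner_Integration.integral_cong)
  finally show ?thesis using c by simp
qed

text \<open>Fubini moves the operator onto h, where it acts as the identity by the reproducing
  property. Exchanging the integrals requires absolute convergence, which comes from the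
  \<open>L^2\<close> bound for the operator with the positive kernel.\<close>

theorem berg_orthogonal:
  assumes F: "sq_int F" and h: "h holomorphic_on ball 0 1" "sq_int h"
  shows "(\<integral>z. (F z - berg F z) * cnj (h z) \<partial>disc) = 0"
proof -
  note iF = sq_int_integrable[OF F] and ih = sq_int_integrable[OF h(2)]
  have [measurable]: "F \<in> borel_measurable disc" "h \<in> borel_measurable disc" using F h by (auto simp: sq_int_def)
  define f where "f z u = F u / (1 - z * cnj u)\<^sup>2 * cnj (h z)" for z u
  have [measurable]: "fst \<in> borel_measurable (disc \<Otimes>\<^sub>M disc)" "snd \<in> borel_measurable (disc \<Otimes>\<^sub>M disc)"
    using measurable_compose[OF measurable_fst measurable_id_disc]
      measurable_compose[OF measurable_snd measurable_id_disc] by auto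
  have meas: "case_prod f \<in> borel_measurable (disc \<Otimes>\<^sub>M disc)"
    unfolding f_def case_prod_beta by measurable
  \<comment> \<open>Inside the disc the integral is finite because the kernel is bounded in u for
    fixed z, so \<open>enn2real\<close> loses nothing there.\<close>
  define G where "G z = enn2real (\<integral>\<^sup>+u. ennreal (kern z u) * ennreal (cmod (F u)) \<partial>disc)" for z
  have GF: "ennreal (G z) = (\<integral>\<^sup>+u. ennreal (kern z u) * ennreal (cmod (F u)) \<partial>disc)" if "z \<in> ball 0 1" for z
  proof -
    have "(\<integral>\<^sup>+u. ennreal (kern z u) * ennreal (cmod (F u)) \<partial>disc) = (\<integral>\<^sup>+u. ennreal (cmod (F u / (1 - z * cnj u)\<^sup>2)) \<partial>disc)"
      by (intro nn_integral_cong) (auto simp: kern_def norm_divide norm_power simp flip: ennreal_mult)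
    also have "\<dots> < \<infinity>" using berg_integrable[OF iF that] by (simp add: integrable_iff_bounded)
    finally show ?thesis by (simp add: G_def less_top)
  qed
  have [measurable]: "G \<in> borel_measurable disc" unfolding G_def by measurable
  have "(\<integral>\<^sup>+z. ennreal ((G z)\<^sup>2) \<partial>disc) < \<infinity>"
    by (rule kernel_operator_L2[of "\<lambda>z. cmod (F z)"]) (use F GF in \<open>auto simp: sq_int_nn G_def\<close>)
  then have sqG: "sq_int (\<lambda>z. of_real (G z))" by (simp add: sq_int_nn G_def)
  have "integrable (disc \<Otimes>\<^sub>M disc) (case_prod f)"
  proof (rule integrableI_bounded[OF meas])
    have "(\<integral>\<^sup>+x. ennreal (norm (case_prod f x)) \<partial>(disc \<Otimes>\<^sub>M disc)) = (\<integral>\<^sup>+z. \<integral>\<^sup>+u. ennreal (cmod (f z u)) \<partial>disc \<partial>disc)"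
      using meas by (subst disc.nn_integral_fst[symmetric]) auto
    also have "\<dots> = (\<integral>\<^sup>+z. ennreal (norm (of_real (G z) * cnj (h z))) \<partial>disc)"
    proof (rule nn_integral_cong)
      fix z assume z: "z \<in> space disc"
      have [measurable]: "(\<lambda>u. kern z u) \<in> borel_measurable disc"
        using measurable_compose[OF measurable_Pair1'[OF z] measurable_kern] by simp
      have "(\<integral>\<^sup>+u. ennreal (cmod (f z u)) \<partial>disc) = (\<integral>\<^sup>+u. ennreal (kern z u) * ennreal (cmod (F u)) * ennreal (cmod (h z)) \<partial>disc)"
        by (intro nn_integral_cong) (auto simp: f_def kern_def norm_divide norm_mult norm_power simp flip: ennreal_mult)
      also have "\<dots> = ennreal (G z) * ennreal (cmod (h z))"
        using GF[of z] z by (subst nn_integral_multc) auto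
      also have "\<dots> = ennreal (norm (of_real (G z) * cnj (h z)))"
        by (simp add: norm_mult G_def flip: ennreal_mult)
      finally show "(\<integral>\<^sup>+u. ennreal (cmod (f z u)) \<partial>disc) = ennreal (norm (of_real (G z) * cnj (h z)))" .
    qed
    also have "\<dots> < \<infinity>" using sq_int_mult[OF sqG h(2)] by (simp add: integrable_iff_bounded)
    finally show "(\<integral>\<^sup>+x. ennreal (norm (case_prod f x)) \<partial>(disc \<Otimes>\<^sub>M disc)) < \<infinity>" .
  qed
  then have fub: "(\<integral>u. (\<integral>z. f z u \<partial>disc) \<partial>disc) = (\<integral>z. (\<integral>u. f z u \<partial>disc) \<partial>disc)"
    by (rule disc_pair.Fubini_integral)
  have inner: "(\<integral>u. f z u \<partial>disc) = berg F z * cnj (h z)" for z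
    unfolding f_def berg_def by (rule integral_mult_left_zero)
  have outer: "(\<integral>z. f z u \<partial>disc) = F u * cnj (h u)" if "u \<in> space disc" for u
  proof -
    have "(\<integral>z. f z u \<partial>disc) = (\<integral>z. F u * cnj (h z / (1 - u * cnj z)\<^sup>2) \<partial>disc)"
      by (intro Bochner_Integration.integral_cong) (auto simp: f_def mult.commute)
    also have "\<dots> = F u * cnj (berg h u)"
      unfolding berg_def integral_mult_right_zero
      using integral_bounded_linear[OF bounded_linear_cnj berg_integrable[OF ih, of u]] that by simp
    finally show ?thesis using berg_reproducing[OF h] that by simp
  qed
  have eq: "(\<integral>u. F u * cnj (h u) \<partial>disc) = (\<integral>z. berg F z * cnj (h z) \<partial>disc)"
  proof -
    have "(\<integral>u. (\<integral>z. f z u \<partial>disc) \<partial>disc) = (\<integral>u. F u * cnj (h u) \<partial>disc)"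
      by (intro Bochner_Integration.integral_cong refl outer)
    then show ?thesis using fub unfolding inner by simp
  qed
  have "(\<integral>z. (F z - berg F z) * cnj (h z) \<partial>disc) = (\<integral>z. F z * cnj (h z) - berg F z * cnj (h z) \<partial>disc)"
    by (simp add: left_diff_distrib)
  also have "\<dots> = (\<integral>u. F u * cnj (h u) \<partial>disc) - (\<integral>z. berg F z * cnj (h z) \<partial>disc)"
    using sq_int_mult[OF F h(2)] sq_int_mult[OF sq_int_berg[OF F] h(2)] by (rule Bochner_Integration.integral_diff)
  finally show ?thesis using eq by simp
qed

section \<open>Transfer to the domain\<close>

text \<open>The infimum is that of a sequence of admissible bounds, and a countable union of null
  sets is null; hence the essential supremum is itself an admissible bound.\<close>

lemma linf_AE: "AE z in lebesgue. z \<in> E \<longrightarrow> ennreal \<bar>f z\<bar> \<le> linf E f"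
proof -
  let ?A = "{c. AE z in lebesgue. z \<in> E \<longrightarrow> ennreal \<bar>f z\<bar> \<le> c}"
  have "\<infinity> \<in> ?A" by simp
  then have "?A \<noteq> {}" by blast
  from ennreal_Inf_countable_INF[OF this] obtain c :: "nat \<Rightarrow> ennreal"
    where c: "range c \<subseteq> ?A" "Inf ?A = (INF i. c i)" by blast
  have "AE z in lebesgue. \<forall>i. z \<in> E \<longrightarrow> ennreal \<bar>f z\<bar> \<le> c i"
    using c(1) by (subst AE_all_countable) auto
  then show ?thesis
    unfolding linf_def c(2) by (rule AE_mp) (auto intro!: AE_I2 INF_greatest)
qed

lemma ennpowr_ennreal: "0 \<le> x \<Longrightarrow> ennpowr (ennreal x) r = ennreal (x powr r)"
  by (simp add: ennpowr_def)

lemma ennpowr_mono: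
  assumes "x \<le> y" "0 < r"
  shows "ennpowr x r \<le> ennpowr y r"
proof (cases "y = \<infinity>")
  case False
  then have "x \<noteq> \<infinity>" using assms by (auto simp: top_unique)
  then show ?thesis using False assms
    by (auto simp: ennpowr_def intro!: ennreal_leI powr_mono2 enn2real_mono simp: less_top)
qed (simp add: ennpowr_def)

lemma ennpowr_zero_iff: "ennpowr x r = 0 \<longleftrightarrow> x = 0"
proof (cases "x = \<infinity>")
  case False
  then show ?thesis
    by (auto simp: ennpowr_def ennreal_eq_0_iff powr_eq_0_iff enn2real_eq_0_iff)
qed (simp add: ennpowr_def)

lemma nn_integral_positive_on_set:
  assumes [measurable]: "Q \<in> sets M" "f \<in> borel_measurable M" and pos: "AE z in M. z \<in> Q \<longrightarrow> 0 < f z"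
    and zero: "(\<integral>\<^sup>+z\<in>Q. f z \<partial>M) = (0::ennreal)"
  shows "emeasure M Q = 0"
proof -
  have "AE z in M. f z * indicator Q z = 0"
    using zero by (subst (asm) nn_integral_0_iff_AE) auto
  with pos have "AE z in M. z \<notin> Q" by eventually_elim (auto simp: indicator_def)
  then show ?thesis using AE_iff_null_sets[of Q M] by auto
qed

section \<open>Correspondence of functions on the disc and on the domain\<close>

locale conformal_disc =
  fixes \<Omega> :: "complex set" and \<psi> :: "complex \<Rightarrow> complex"
  assumes bounded: "bounded \<Omega>" and hol: "\<psi> holomorphic_on ball 0 1" and inj: "inj_on \<psi> (ball 0 1)"
    and img: "\<psi> ` ball 0 1 = \<Omega>"
begin

lemmas conf = open_ball[of "0::complex" 1] hol inj

definition jac :: "complex \<Rightarrow> real" where "jac z = (cmod (deriv \<psi> z))\<^sup>2"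

definition pull :: "(complex \<Rightarrow> complex) \<Rightarrow> complex \<Rightarrow> complex" where
  "pull f z = f (\<psi> z) * deriv \<psi> z"

lemma open_\<Omega>: "open \<Omega>"
  using conformal_image_open[OF conf] by (simp add: img)

lemma measurable_\<psi> [measurable]: "\<psi> \<in> disc \<rightarrow>\<^sub>M area_on \<Omega>"
  using conformal_measurable[OF conf] by (simp add: img)

lemma measurable_deriv [measurable]: "deriv \<psi> \<in> borel_measurable disc"
  by (rule holomorphic_measurable_disc(2)[OF holomorphic_deriv[OF hol]]) simp

lemma measurable_jac [measurable]: "jac \<in> borel_measurable disc"
  unfolding jac_def by measurable

lemma jac_pos: "z \<in> ball 0 1 \<Longrightarrow> 0 < jac z"
  using conformal_deriv_nonzero[OF conf, of z] by (simp add: jac_def)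

lemma nn_integral_\<Omega>:
  "f \<in> borel_measurable (area_on \<Omega>) \<Longrightarrow>
    (\<integral>\<^sup>+z\<in>\<Omega>. f z \<partial>dA) = (\<integral>\<^sup>+z. ennreal (jac z) * f (\<psi> z) \<partial>disc)"
  using conformal_nn_integral[OF conf, of f] open_\<Omega> by (simp add: img jac_def nn_integral_restrict_space)

lemma L2_on_iff: "f \<in> L2_on \<Omega> \<longleftrightarrow> f \<in> borel_measurable (area_on \<Omega>) \<and> sq_int (pull f)"
proof -
  have "set_borel_measurable dA \<Omega> f \<longleftrightarrow> f \<in> borel_measurable (area_on \<Omega>)"
    using open_\<Omega> unfolding set_borel_measurable_def by (subst borel_measurable_restrict_space_iff) auto
  moreover have "set_integrable dA \<Omega> (\<lambda>z. (cmod (f z))\<^sup>2) \<longleftrightarrow> sq_int (pull f)"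
    if m [measurable]: "f \<in> borel_measurable (area_on \<Omega>)"
  proof -
    have pm: "pull f \<in> borel_measurable disc" unfolding pull_def by measurable
    have "set_integrable dA \<Omega> (\<lambda>z. (cmod (f z))\<^sup>2) \<longleftrightarrow> integrable (area_on \<Omega>) (\<lambda>z. (cmod (f z))\<^sup>2)"
      using open_\<Omega> unfolding set_integrable_def by (subst integrable_restrict_space) auto
    also have "\<dots> \<longleftrightarrow> (\<integral>\<^sup>+z. ennreal ((cmod (f z))\<^sup>2) \<partial>area_on \<Omega>) < \<infinity>"
      by (simp add: integrable_iff_bounded)
    also have "(\<integral>\<^sup>+z. ennreal ((cmod (f z))\<^sup>2) \<partial>area_on \<Omega>) = (\<integral>\<^sup>+z. ennreal ((cmod (pull f z))\<^sup>2) \<partial>disc)"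
      using conformal_nn_integral[OF conf, of "\<lambda>z. ennreal ((cmod (f z))\<^sup>2)"] m
      by (simp add: img pull_def norm_mult power_mult_distrib ennreal_mult mult.commute)
    finally show ?thesis using pm by (simp add: sq_int_nn)
  qed
  ultimately show ?thesis by (auto simp: L2_on_def)
qed

lemma inner_pull:
  assumes [measurable]: "a \<in> borel_measurable (area_on \<Omega>)" "b \<in> borel_measurable (area_on \<Omega>)"
  shows "(LINT z:\<Omega>|dA. a z * cnj (b z)) = (\<integral>z. pull a z * cnj (pull b z) \<partial>disc)"
proof -
  have "(LINT z:\<Omega>|dA. a z * cnj (b z)) = (\<integral>z. a z * cnj (b z) \<partial>area_on \<Omega>)"
    using open_\<Omega> unfolding set_lebesgue_integral_def by (subst integral_restrict_space) auto
  also have "\<dots> = (\<integral>z. (cmod (deriv \<psi> z))\<^sup>2 *\<^sub>R (a (\<psi> z) * cnj (b (\<psi> z))) \<partial>disc)"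
    using conformal_integral[OF conf, of "\<lambda>z. a z * cnj (b z)"] by (simp add: img)
  also have "\<dots> = (\<integral>z. pull a z * cnj (pull b z) \<partial>disc)"
  proof (rule Bochner_Integration.integral_cong[OF refl])
    fix z
    show "(cmod (deriv \<psi> z))\<^sup>2 *\<^sub>R (a (\<psi> z) * cnj (b (\<psi> z))) = pull a z * cnj (pull b z)"
      using complex_norm_square[of "deriv \<psi> z"] by (simp only: scaleR_conv_of_real pull_def complex_cnj_mult) (simp add: mult_ac)
  qed
  finally show ?thesis .
qed

lemma holomorphic_measurable_\<Omega>: "h holomorphic_on \<Omega> \<Longrightarrow> h \<in> borel_measurable (area_on \<Omega>)"
proof -
  assume "h holomorphic_on \<Omega>"
  then have "(\<lambda>z. indicator \<Omega> z *\<^sub>R h z) \<in> borel_measurable borel"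
    using open_\<Omega> by (intro borel_measurable_continuous_on_indicator) (auto intro: holomorphic_on_imp_continuous_on)
  then have "(\<lambda>z. indicator \<Omega> z *\<^sub>R h z) \<in> borel_measurable dA"
    by (auto simp: measurable_completion dA_def)
  then show ?thesis using open_\<Omega> by (subst borel_measurable_restrict_space_iff) auto
qed

lemma pull_holomorphic: "h holomorphic_on \<Omega> \<Longrightarrow> pull h holomorphic_on ball 0 1"
  unfolding pull_def[abs_def] using img
  by (intro holomorphic_intros holomorphic_on_compose_gen[OF hol, unfolded o_def] holomorphic_deriv[OF hol]) auto

text \<open>Surjectivity of the pull-back on Bergman spaces, by composing with the inverse map and
  multiplying by its derivative.\<close>

lemma push_exists:
  assumes H: "H holomorphic_on ball 0 1" "sq_int H"
  shows "\<exists>g\<in>bergman_space \<Omega>. \<forall>z\<in>ball 0 1. pull g z = H z"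
proof -
  obtain k where k: "k holomorphic_on \<Omega>" "\<And>z. z \<in> ball 0 1 \<Longrightarrow> deriv \<psi> z * deriv k (\<psi> z) = 1"
      "\<And>z. z \<in> ball 0 1 \<Longrightarrow> k (\<psi> z) = z"
    using holomorphic_has_inverse[OF hol open_ball inj] unfolding img by metis
  define g where "g x = H (k x) * deriv k x" for x
  have kimg: "k ` \<Omega> \<subseteq> ball 0 1" using k(3) unfolding img[symmetric] by auto
  have g: "g holomorphic_on \<Omega>" unfolding g_def
    by (intro holomorphic_intros holomorphic_on_compose_gen[OF k(1) H(1) kimg, unfolded o_def] holomorphic_deriv[OF k(1) open_\<Omega>])
  have pg: "pull g z = H z" if "z \<in> ball 0 1" for z
    using k(2,3)[OF that] by (simp add: pull_def g_def mult.assoc) (simp add: mult.commute)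
  have gm: "g \<in> borel_measurable (area_on \<Omega>)" by (rule holomorphic_measurable_\<Omega>[OF g])
  have "(\<integral>\<^sup>+z. ennreal ((cmod (pull g z))\<^sup>2) \<partial>disc) = (\<integral>\<^sup>+z. ennreal ((cmod (H z))\<^sup>2) \<partial>disc)"
    by (rule nn_integral_cong) (simp add: pg)
  moreover have "pull g \<in> borel_measurable disc"
    by (rule holomorphic_measurable_disc(2)[OF pull_holomorphic[OF g]])
  ultimately have "sq_int (pull g)" using H(2) by (simp add: sq_int_nn)
  then show ?thesis using g gm pg by (auto simp: bergman_space_def L2_on_iff)
qed

text \<open>Since \<open>bergman_proj\<close> is a choice, existence comes first: the function on
  the domain corresponding to \<open>berg (pull f)\<close> satisfies the orthogonality relations.
  Whatever function is chosen then agrees with it, because the two differ by an element of the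
  Bergman space that is orthogonal to itself.\<close>

theorem pull_bergman_proj:
  assumes f: "f \<in> L2_on \<Omega>"
  shows "bergman_proj \<Omega> f \<in> bergman_space \<Omega>"
    and "AE z in disc. pull (bergman_proj \<Omega> f) z = berg (pull f) z"
proof -
  let ?F = "pull f" and ?g = "bergman_proj \<Omega> f"
  have fm [measurable]: "f \<in> borel_measurable (area_on \<Omega>)" and F: "sq_int ?F" using f by (auto simp: L2_on_iff)
  have spaceD: "h \<in> borel_measurable (area_on \<Omega>)" "pull h holomorphic_on ball 0 1" "sq_int (pull h)"
    if "h \<in> bergman_space \<Omega>" for h
    using that pull_holomorphic[of h] by (auto simp: bergman_space_def L2_on_iff)
  have bF: "berg ?F holomorphic_on ball 0 1" "sq_int (berg ?F)"
    using berg_holomorphic[OF sq_int_integrable[OF F]] sq_int_berg[OF F] by auto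
  have inner: "(LINT z:\<Omega>|dA. (f z - g z) * cnj (h z)) = (\<integral>z. (?F z - pull g z) * cnj (pull h z) \<partial>disc)"
    if "g \<in> bergman_space \<Omega>" "h \<in> bergman_space \<Omega>" for g h
    using inner_pull[of "\<lambda>z. f z - g z" h] spaceD(1)[OF that(1)] spaceD(1)[OF that(2)]
    by (simp add: pull_def[of "\<lambda>z. f z - g z"] pull_def[of f] pull_def[of g] left_diff_distrib)
  obtain g0 where g0: "g0 \<in> bergman_space \<Omega>" "\<And>z. z \<in> ball 0 1 \<Longrightarrow> pull g0 z = berg ?F z"
    using push_exists[OF bF] by blast
  have "(LINT z:\<Omega>|dA. (f z - g0 z) * cnj (h z)) = 0" if h: "h \<in> bergman_space \<Omega>" for h
  proof -
    have "(LINT z:\<Omega>|dA. (f z - g0 z) * cnj (h z)) = (\<integral>z. (?F z - berg ?F z) * cnj (pull h z) \<partial>disc)"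
      unfolding inner[OF g0(1) h] by (intro Bochner_Integration.integral_cong) (auto simp: g0(2))
    then show ?thesis using berg_orthogonal[OF F spaceD(2,3)[OF h]] by simp
  qed
  then have "\<exists>g. g \<in> bergman_space \<Omega> \<and> (\<forall>h\<in>bergman_space \<Omega>. (LINT z:\<Omega>|dA. (f z - g z) * cnj (h z)) = 0)"
    using g0(1) by blast
  from someI_ex[OF this] have g: "?g \<in> bergman_space \<Omega>"
    and orth: "\<And>h. h \<in> bergman_space \<Omega> \<Longrightarrow> (LINT z:\<Omega>|dA. (f z - ?g z) * cnj (h z)) = 0"
    unfolding bergman_proj_def by auto
  show "?g \<in> bergman_space \<Omega>" by (rule g)
  \<comment> \<open>H is holomorphic and square integrable, hence comes from an admissible test
    function on the domain; testing with it gives a vanishing \<open>L^2\<close> norm.\<close>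
  define H where "H z = pull ?g z - berg ?F z" for z
  have holH: "H holomorphic_on ball 0 1"
    unfolding H_def using spaceD(2)[OF g] bF(1) by (intro holomorphic_intros)
  have sqH: "sq_int H"
  proof -
    have le: "(cmod (H z))\<^sup>2 \<le> 2 * (cmod (pull ?g z))\<^sup>2 + 2 * (cmod (berg ?F z))\<^sup>2" for z
    proof -
      have "(cmod (H z))\<^sup>2 \<le> (cmod (pull ?g z) + cmod (berg ?F z))\<^sup>2"
        unfolding H_def by (intro power_mono norm_triangle_ineq4) auto
      also have "\<dots> \<le> 2 * (cmod (pull ?g z))\<^sup>2 + 2 * (cmod (berg ?F z))\<^sup>2"
        using sum_squares_bound[of "cmod (pull ?g z)" "cmod (berg ?F z)"] by (simp add: power2_sum)
      finally show ?thesis .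
    qed
    have "integrable disc (\<lambda>z. (cmod (H z))\<^sup>2)"
    proof (rule Bochner_Integration.integrable_bound)
      show "integrable disc (\<lambda>z. 2 * (cmod (pull ?g z))\<^sup>2 + 2 * (cmod (berg ?F z))\<^sup>2)"
        using spaceD(3)[OF g] bF(2) by (auto simp: sq_int_def)
      show "(\<lambda>z. (cmod (H z))\<^sup>2) \<in> borel_measurable disc"
        using holomorphic_measurable_disc(2)[OF holH] by measurable
      show "AE z in disc. norm ((cmod (H z))\<^sup>2) \<le> norm (2 * (cmod (pull ?g z))\<^sup>2 + 2 * (cmod (berg ?F z))\<^sup>2)"
        using le by (intro AE_I2) auto
    qed
    then show ?thesis using holomorphic_measurable_disc(2)[OF holH] by (simp add: sq_int_def)
  qed
  obtain h where h: "h \<in> bergman_space \<Omega>" "\<And>z. z \<in> ball 0 1 \<Longrightarrow> pull h z = H z"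
    using push_exists[OF holH sqH] by blast
  have "(\<integral>z. (?F z - pull ?g z) * cnj (pull h z) \<partial>disc) = 0" using orth[OF h(1)] inner[OF g h(1)] by simp
  moreover have "(\<integral>z. (?F z - pull ?g z) * cnj (pull h z) \<partial>disc) = (\<integral>z. (?F z - berg ?F z) * cnj (H z) - H z * cnj (H z) \<partial>disc)"
    by (intro Bochner_Integration.integral_cong) (auto simp: h(2) H_def algebra_simps)
  moreover have "\<dots> = (\<integral>z. (?F z - berg ?F z) * cnj (H z) \<partial>disc) - (\<integral>z. H z * cnj (H z) \<partial>disc)"
  proof (rule Bochner_Integration.integral_diff)
    have "integrable disc (\<lambda>z. ?F z * cnj (H z) - berg ?F z * cnj (H z))"
      using sq_int_mult[OF F sqH] sq_int_mult[OF bF(2) sqH] by (rule Bochner_Integration.integrable_diff)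
    then show "integrable disc (\<lambda>z. (?F z - berg ?F z) * cnj (H z))" by (simp add: left_diff_distrib)
  qed (rule sq_int_mult[OF sqH sqH])
  ultimately have "(\<integral>z. H z * cnj (H z) \<partial>disc) = 0" using berg_orthogonal[OF F holH sqH] by simp
  moreover have "(\<integral>z. H z * cnj (H z) \<partial>disc) = of_real (\<integral>z. (cmod (H z))\<^sup>2 \<partial>disc)"
    unfolding complex_norm_square[symmetric] by (rule integral_complex_of_real)
  ultimately have "(\<integral>z. (cmod (H z))\<^sup>2 \<partial>disc) = 0" by simp
  then have "AE z in disc. (cmod (H z))\<^sup>2 = 0"
    using sqH by (subst (asm) integral_nonneg_eq_0_iff_AE) (auto simp: sq_int_def)
  then show "AE z in disc. pull ?g z = berg ?F z" by (rule AE_mp) (auto intro!: AE_I2 simp: H_def)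
qed

end

section \<open>Weights, norms and characteristics under the pull-back\<close>

lemma ennpowr_1 [simp]: "ennpowr x 1 = x"
  by (cases x) (auto simp: ennpowr_def)

lemma nn_integral_disc_dA: "Q \<subseteq> ball 0 1 \<Longrightarrow> (\<integral>\<^sup>+z\<in>Q. f z \<partial>dA) = (\<integral>\<^sup>+z\<in>Q. f z \<partial>disc)"
  by (subst nn_integral_restrict_space) (auto intro!: nn_integral_cong simp: indicator_def)

lemma AE_disc_iff: "(AE z in disc. P z) \<longleftrightarrow> (AE z in lebesgue. z \<in> ball 0 1 \<longrightarrow> P z)"
  by (subst AE_restrict_space_iff) (auto simp: AE_dA_iff)

context conformal_disc
begin

text \<open>The value 1 is only taken on a null set and outside the disc; it makes the weight positive everywhere.\<close>

definition pull_weight :: "real \<Rightarrow> (complex \<Rightarrow> real) \<Rightarrow> complex \<Rightarrow> real" where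
  "pull_weight p \<sigma> z = (if z \<in> ball 0 1 \<and> 0 < \<sigma> (\<psi> z) then jac z powr (1 - p / 2) * \<sigma> (\<psi> z) else 1)"

definition pull_dual :: "real \<Rightarrow> (complex \<Rightarrow> real) \<Rightarrow> complex \<Rightarrow> real" where
  "pull_dual p \<sigma> z = pull_weight p \<sigma> z powr (- 1 / (p - 1))"

lemma pull_weight_pos: "0 < pull_weight p \<sigma> z"
  using jac_pos[of z] by (auto simp: pull_weight_def)

lemma pull_dual_pos: "0 < pull_dual p \<sigma> z"
  using pull_weight_pos[of p \<sigma> z] by (simp add: pull_dual_def)

lemma pull_weight_dual:
  assumes "1 < p"
  shows "pull_weight p \<sigma> z * pull_dual p \<sigma> z powr (p - 1) = 1"
proof -
  have "- 1 / (p - 1) * (p - 1) = - 1" using assms by simp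
  then have "pull_dual p \<sigma> z powr (p - 1) = pull_weight p \<sigma> z powr (- 1)" by (simp only: pull_dual_def powr_powr)
  then show ?thesis using pull_weight_pos[of p \<sigma> z] by (simp add: powr_minus)
qed

lemma jac_nonneg [simp]: "0 \<le> jac z"
  by (simp add: jac_def)

context
  fixes \<sigma> :: "complex \<Rightarrow> real" and p :: real
  assumes p: "1 < p" and \<sigma>: "weight_on \<Omega> \<sigma>"
begin

lemma measurable_\<sigma> [measurable]: "\<sigma> \<in> borel_measurable (area_on \<Omega>)"
proof -
  have "\<sigma> \<in> borel_measurable dA" using \<sigma> by (simp add: weight_on_def dA_def)
  then show ?thesis by (rule measurable_restrict_space1)
qed

lemma measurable_pull_weight [measurable]: "pull_weight p \<sigma> \<in> borel_measurable disc"
proof -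
  have "(\<lambda>z. if 0 < \<sigma> (\<psi> z) then jac z powr (1 - p / 2) * \<sigma> (\<psi> z) else 1) \<in> borel_measurable disc"
    by measurable
  then show ?thesis by (rule measurable_cong[THEN iffD1, rotated]) (auto simp: pull_weight_def)
qed

lemma measurable_pull_dual [measurable]: "pull_dual p \<sigma> \<in> borel_measurable disc"
  unfolding pull_dual_def by measurable

lemma AE_\<sigma>_pos: "AE z in disc. 0 < \<sigma> (\<psi> z)"
proof -
  have "AE z in area_on \<Omega>. 0 < \<sigma> z"
    using \<sigma> open_\<Omega> by (subst AE_restrict_space_iff) (auto simp: weight_on_def AE_dA_iff)
  then have "AE z in area_on (\<psi> ` ball 0 1). 0 < \<sigma> z" unfolding img .
  then show ?thesis by (rule conformal_AE[OF conf])
qed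

text \<open>The pulled-back function carries \<open>jac powr (p / 2)\<close>, while the change of
  variables supplies one power of \<open>jac\<close>; this forces the exponent 1 - p/2 in the
  weight. Positivity of \<sigma> holds only almost everywhere, so the integrands agree only almost
  everywhere.\<close>

lemma wnorm_pull:
  assumes [measurable]: "f \<in> borel_measurable (area_on \<Omega>)"
  shows "(\<integral>\<^sup>+z\<in>\<Omega>. ennreal (cmod (f z) powr p * \<sigma> z) \<partial>dA) = (\<integral>\<^sup>+z. ennreal (cmod (pull f z) powr p * pull_weight p \<sigma> z) \<partial>disc)"
proof -
  have "(\<integral>\<^sup>+z\<in>\<Omega>. ennreal (cmod (f z) powr p * \<sigma> z) \<partial>dA)
      = (\<integral>\<^sup>+z. ennreal (jac z) * ennreal (cmod (f (\<psi> z)) powr p * \<sigma> (\<psi> z)) \<partial>disc)"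
    by (rule nn_integral_\<Omega>) measurable
  also have "\<dots> = (\<integral>\<^sup>+z. ennreal (cmod (pull f z) powr p * pull_weight p \<sigma> z) \<partial>disc)"
  proof (rule nn_integral_cong_AE)
    have "AE z in disc. z \<in> ball 0 1" by (rule AE_I2) simp
    with AE_\<sigma>_pos show "AE z in disc. ennreal (jac z) * ennreal (cmod (f (\<psi> z)) powr p * \<sigma> (\<psi> z))
        = ennreal (cmod (pull f z) powr p * pull_weight p \<sigma> z)"
    proof eventually_elim
      case (elim z)
      have j: "0 < jac z" using jac_pos elim(2) by blast
      have "cmod (deriv \<psi> z) = jac z powr (1 / 2)" by (simp add: jac_def powr_half_sqrt)
      then have "cmod (pull f z) powr p = cmod (f (\<psi> z)) powr p * jac z powr (p / 2)"
        by (simp add: pull_def norm_mult powr_mult powr_powr)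
      moreover have "jac z powr (p / 2) * jac z powr (1 - p / 2) = jac z"
        using j by (simp flip: powr_add)
      ultimately have "cmod (pull f z) powr p * pull_weight p \<sigma> z = jac z * (cmod (f (\<psi> z)) powr p * \<sigma> (\<psi> z))"
        using elim by (simp add: pull_weight_def)
      then show ?case using j by (simp add: ennreal_mult')
    qed
  qed
  finally show ?thesis .
qed

lemma nn_integral_image:
  assumes Q: "Q \<in> sets disc" and [measurable]: "g \<in> borel_measurable (area_on \<Omega>)"
  shows "(\<integral>\<^sup>+z\<in>\<psi> ` Q. g z \<partial>dA) = (\<integral>\<^sup>+z\<in>Q. ennreal (jac z) * g (\<psi> z) \<partial>disc)"
proof -
  have Q': "Q \<in> sets lebesgue" "Q \<subseteq> ball 0 1" using Q by (auto simp: sets_restrict_space_iff)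
  have sub: "\<psi> ` Q \<subseteq> \<Omega>" using Q'(2) img by auto
  have [measurable]: "\<psi> ` Q \<in> sets (area_on \<Omega>)"
    using emeasure_holomorphic_image(1)[OF conf Q'] sub open_\<Omega> by (auto simp: sets_restrict_space_iff)
  have "(\<integral>\<^sup>+z\<in>\<psi> ` Q. g z \<partial>dA) = (\<integral>\<^sup>+z\<in>\<Omega>. (g z * indicator (\<psi> ` Q) z) \<partial>dA)"
    using sub by (intro nn_integral_cong) (auto simp: indicator_def)
  also have "\<dots> = (\<integral>\<^sup>+z. ennreal (jac z) * (g (\<psi> z) * indicator (\<psi> ` Q) (\<psi> z)) \<partial>disc)"
    by (rule nn_integral_\<Omega>) measurable
  also have "\<dots> = (\<integral>\<^sup>+z\<in>Q. ennreal (jac z) * g (\<psi> z) \<partial>disc)"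
  proof (rule nn_integral_cong)
    fix z assume "z \<in> space disc"
    then have "\<psi> z \<in> \<psi> ` Q \<longleftrightarrow> z \<in> Q" using inj_on_image_mem_iff[OF inj _ Q'(2)] by simp
    then show "ennreal (jac z) * (g (\<psi> z) * indicator (\<psi> ` Q) (\<psi> z)) = ennreal (jac z) * g (\<psi> z) * indicator Q z"
      by (auto simp: indicator_def)
  qed
  finally show ?thesis .
qed

text \<open>The Jacobian integrates to the area of the domain; this is where boundedness
  enters.\<close>

lemma total_jac: "(\<integral>\<^sup>+z. ennreal (jac z) \<partial>disc) < \<infinity>"
proof -
  have "(\<integral>\<^sup>+z. ennreal (jac z) \<partial>disc) = emeasure dA \<Omega>"
    using nn_integral_\<Omega>[of "\<lambda>_. 1"] open_\<Omega> by simp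
  also have "\<dots> < \<infinity>"
    using open_\<Omega> emeasure_bounded_finite[OF bounded] by (simp add: emeasure_dA ennreal_mult_less_top)
  finally show ?thesis .
qed

text \<open>The B_1 condition in real numbers: V is the area of the image of the box, and L is the
  essential supremum of the reciprocal Jacobian. Both are shown finite and nonzero, so that they can
  be raised to powers and divided by.\<close>

lemma jac_box:
  assumes Q: "Q \<in> carleson_boxes" and m: "0 < measure disc Q" and B: "Bp_disc 1 jac < \<infinity>"
  obtains V L where "0 < V" "(\<integral>\<^sup>+z\<in>Q. ennreal (jac z) \<partial>disc) = ennreal V" "0 < L"
    "AE z in disc. z \<in> Q \<longrightarrow> 1 / jac z \<le> L" "V * L \<le> enn2real (Bp_disc 1 jac) * measure disc Q"
proof -
  obtain \<theta> l where "Q = carleson_box \<theta> l" using Q by (auto simp: carleson_boxes_def)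
  then have Qd [measurable]: "Q \<in> sets disc" and sub: "Q \<subseteq> ball 0 1" using carleson_box_subset by auto
  let ?m = "measure disc Q"
  have "(\<integral>\<^sup>+z\<in>Q. ennreal (jac z) \<partial>disc) \<le> (\<integral>\<^sup>+z. ennreal (jac z) \<partial>disc)"
    by (intro nn_integral_mono) (auto simp: indicator_def)
  then obtain V where V: "0 \<le> V" "(\<integral>\<^sup>+z\<in>Q. ennreal (jac z) \<partial>disc) = ennreal V"
    using total_jac by (cases "\<integral>\<^sup>+z\<in>Q. ennreal (jac z) \<partial>disc") (auto simp: top_unique)
  have V0: "V \<noteq> 0"
  proof
    assume "V = 0"
    then have "emeasure disc Q = 0"
      using V sub jac_pos by (intro nn_integral_positive_on_set[of Q disc "\<lambda>z. ennreal (jac z)"]) (auto intro!: AE_I2)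
    then show False using m by (simp add: measure_def)
  qed
  let ?L = "linf Q (\<lambda>z. 1 / jac z)"
  have avg: "avg 1 (\<lambda>_. 1) Q jac = ennreal (V / ?m)"
  proof -
    have "(\<integral>\<^sup>+z\<in>Q. ennreal (\<bar>jac z\<bar> powr 1 * 1) \<partial>dA) = ennreal V"
      using sub by (simp add: nn_integral_disc_dA V(2))
    moreover have "(\<integral>\<^sup>+z\<in>Q. ennreal 1 \<partial>dA) = ennreal ?m"
      using sub Qd by (simp add: sets_restrict_space_iff disc.emeasure_eq_measure flip: emeasure_disc)
    ultimately show ?thesis using V m by (simp add: avg_def divide_ennreal)
  qed
  have le: "ennreal (V / ?m) * ?L \<le> Bp_disc 1 jac"
    unfolding Bp_disc_def Bp_char_def by (rule SUP_upper2[OF Q]) (simp add: avg)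
  have "?L \<noteq> \<infinity>"
  proof
    assume "?L = \<infinity>"
    then show False using le B V V0 m by (auto simp: ennreal_mult_top top_unique ennreal_mult_eq_top_iff)
  qed
  then obtain L where L: "0 \<le> L" "?L = ennreal L" by (cases ?L) auto
  have ae: "AE z in disc. z \<in> Q \<longrightarrow> 1 / jac z \<le> L"
    unfolding AE_disc_iff using linf_AE[of Q "\<lambda>z. 1 / jac z"]
    by eventually_elim (use L in \<open>auto simp: ennreal_le_iff2\<close>)
  have "L \<noteq> 0"
  proof
    assume "L = 0"
    have "AE z in disc. z \<in> ball 0 1" by (rule AE_I2) simp
    with ae have "AE z in disc. z \<notin> Q"
    proof eventually_elim
      case (elim z)
      with jac_pos[of z] \<open>L = 0\<close> show ?case by (auto simp: divide_le_0_iff)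
    qed
    then have "emeasure disc Q = 0" using AE_iff_null_sets[of Q disc] by auto
    then show False using m by (simp add: measure_def)
  qed
  have "ennreal (V / ?m * L) \<le> Bp_disc 1 jac" using le V L m by (subst ennreal_mult) auto
  then have "V / ?m * L \<le> enn2real (Bp_disc 1 jac)"
    using B V L m by (cases "Bp_disc 1 jac") auto
  then have "V * L \<le> enn2real (Bp_disc 1 jac) * ?m" using m by (simp add: field_simps)
  then show ?thesis using that[of V L] V V0 L \<open>L \<noteq> 0\<close> ae by auto
qed

text \<open>Needed because 0 times infinity is 0 in \<open>ennreal\<close>: an infinite
  characteristic of \<sigma> makes the right side of the theorem infinite only if the other factor
  is nonzero.\<close>

lemma Bp_disc_pos:
  assumes "Bp_disc 1 jac < \<infinity>"
  shows "0 < enn2real (Bp_disc 1 jac)"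
proof -
  have bx: "ball 0 1 \<in> carleson_boxes" unfolding carleson_boxes_def using carleson_box_1 by force
  have m: "0 < measure disc (ball 0 1)" by (simp add: measure_disc)
  obtain V L where "0 < V" "(\<integral>\<^sup>+z\<in>ball 0 1. ennreal (jac z) \<partial>disc) = ennreal V" "0 < L"
    "AE z in disc. z \<in> ball 0 1 \<longrightarrow> 1 / jac z \<le> L" "V * L \<le> enn2real (Bp_disc 1 jac) * measure disc (ball 0 1)"
    by (rule jac_box[OF bx m assms])
  then have "0 < V * L" "V * L \<le> enn2real (Bp_disc 1 jac)" by (auto simp: measure_disc)
  then show ?thesis by linarith
qed

text \<open>With r = 1/(p - 1), the weight is \<open>(1 / jac) powr (p / 2)\<close> and its dual
  \<open>(1 / jac) powr (p / 2 * r)\<close> times a density pulled back from the domain. Both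
  exponents are nonnegative for every p > 1, so the upper bound L suffices. After the power p - 1
  each contributes \<open>L powr (p / 2)\<close>. The averages on the domain supply
  \<open>V powr p\<close>, and V L is at most the B_1 characteristic times the area of the
  box.\<close>

theorem Bp_bound_pull:
  assumes B: "Bp_disc 1 jac < \<infinity>" and D: "Bp_dom \<psi> p \<sigma> < \<infinity>"
  shows "Bp_bound p (pull_weight p \<sigma>) (pull_dual p \<sigma>) (enn2real (Bp_disc 1 jac) powr p * enn2real (Bp_dom \<psi> p \<sigma>))"
  unfolding Bp_bound_def
proof (intro allI impI)
  fix \<theta> l :: real assume l: "0 < l \<and> l \<le> 1"
  define Q where "Q = carleson_box \<theta> l"
  define B' where "B' = enn2real (Bp_disc 1 jac)"
  define D' where "D' = enn2real (Bp_dom \<psi> p \<sigma>)"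
  let ?m = "measure disc Q"
  have Q: "Q \<in> carleson_boxes" using l by (auto simp: Q_def carleson_boxes_def)
  have Qd [measurable]: "Q \<in> sets disc" and sub: "Q \<subseteq> ball 0 1" using carleson_box_subset by (auto simp: Q_def)
  have B'0: "0 \<le> B'" "0 \<le> D'" by (auto simp: B'_def D'_def)
  have "\<exists>W T. 0 \<le> W \<and> 0 \<le> T \<and> (\<integral>\<^sup>+z\<in>Q. ennreal (pull_weight p \<sigma> z) \<partial>disc) = ennreal W \<and>
      (\<integral>\<^sup>+z\<in>Q. ennreal (pull_dual p \<sigma> z) \<partial>disc) = ennreal T \<and> W * T powr (p - 1) \<le> B' powr p * D' * ?m powr p"
  proof (cases "?m = 0")
    \<comment> \<open>On a null box all integrals vanish. Splitting off this case avoids a lower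
      bound for the area of a general Carleson box.\<close>
    case True
    then have "emeasure disc Q = 0" by (simp add: disc.emeasure_eq_measure)
    then have "AE z in disc. z \<notin> Q" using AE_iff_null_sets[of Q disc] by (auto simp: null_sets_def)
    then have "(\<integral>\<^sup>+z\<in>Q. g z \<partial>disc) = ennreal 0" for g
    proof -
      assume ae: "AE z in disc. z \<notin> Q"
      have "(\<integral>\<^sup>+z\<in>Q. g z \<partial>disc) = (\<integral>\<^sup>+z. 0 \<partial>disc)"
        using ae by (intro nn_integral_cong_AE) auto
      then show ?thesis by simp
    qed
    then show ?thesis
      using True by (intro exI[of _ 0]) auto
  next
    case False
    then have m: "0 < ?m" by (simp add: zero_less_measure_iff)
    obtain V L where V: "0 < V" "(\<integral>\<^sup>+z\<in>Q. ennreal (jac z) \<partial>disc) = ennreal V" and L: "0 < L"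
      and ae: "AE z in disc. z \<in> Q \<longrightarrow> 1 / jac z \<le> L" and VL: "V * L \<le> B' * ?m"
      unfolding B'_def by (rule jac_box[OF Q m B])
    define r where "r = 1 / (p - 1)"
    have r: "0 < r" "r * (p - 1) = 1" "1 / r = p - 1" using p by (auto simp: r_def)
    define x where "x z = ennreal (jac z) * ennreal \<bar>\<sigma> (\<psi> z)\<bar>" for z
    define y where "y z = ennreal (jac z) * ennreal (\<bar>1 / \<sigma> (\<psi> z)\<bar> powr r)" for z
    have [measurable]: "x \<in> borel_measurable disc" "y \<in> borel_measurable disc" unfolding x_def y_def by measurable
    have aeb: "AE z in disc. z \<in> ball 0 1" by (rule AE_I2) simp
    \<comment> \<open>Finiteness of a product in \<open>ennreal\<close> bounds both factors only
      when neither is 0; hence positivity comes before finiteness.\<close>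
    have X0: "(\<integral>\<^sup>+z\<in>Q. x z \<partial>disc) \<noteq> 0" and Y0: "(\<integral>\<^sup>+z\<in>Q. y z \<partial>disc) \<noteq> 0"
    proof -
      have px: "AE z in disc. z \<in> Q \<longrightarrow> 0 < x z" using AE_\<sigma>_pos aeb
        by eventually_elim (auto simp: x_def jac_pos ennreal_zero_less_mult_iff)
      have py: "AE z in disc. z \<in> Q \<longrightarrow> 0 < y z" using AE_\<sigma>_pos aeb
        by eventually_elim (auto simp: y_def jac_pos ennreal_zero_less_mult_iff)
      have "emeasure disc Q \<noteq> 0" using m by (simp add: disc.emeasure_eq_measure)
      then show "(\<integral>\<^sup>+z\<in>Q. x z \<partial>disc) \<noteq> 0" "(\<integral>\<^sup>+z\<in>Q. y z \<partial>disc) \<noteq> 0"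
        using nn_integral_positive_on_set[OF Qd _ px] nn_integral_positive_on_set[OF Qd _ py] by auto
    qed
    have avg1: "avg 1 (\<lambda>_. 1) (\<psi> ` Q) \<sigma> = (\<integral>\<^sup>+z\<in>Q. x z \<partial>disc) / ennreal V"
    proof -
      have "(\<integral>\<^sup>+z\<in>\<psi> ` Q. ennreal (\<bar>\<sigma> z\<bar> powr 1 * 1) \<partial>dA) = (\<integral>\<^sup>+z\<in>Q. x z \<partial>disc)"
        by (subst nn_integral_image) (auto simp: x_def)
      moreover have "(\<integral>\<^sup>+z\<in>\<psi> ` Q. ennreal 1 \<partial>dA) = ennreal V"
        by (subst nn_integral_image) (auto simp: V(2))
      ultimately show ?thesis by (simp add: avg_def)
    qed
    have avg2: "avg (1 / (p - 1)) (\<lambda>_. 1) (\<psi> ` Q) (\<lambda>z. 1 / \<sigma> z) = ennpowr (\<integral>\<^sup>+z\<in>Q. y z \<partial>disc) (p - 1) / ennreal (V powr (p - 1))"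
    proof -
      have "(\<integral>\<^sup>+z\<in>\<psi> ` Q. ennreal (\<bar>1 / \<sigma> z\<bar> powr r * 1) \<partial>dA) = (\<integral>\<^sup>+z\<in>Q. y z \<partial>disc)"
        by (subst nn_integral_image) (auto simp: y_def)
      moreover have "(\<integral>\<^sup>+z\<in>\<psi> ` Q. ennreal 1 \<partial>dA) = ennreal V"
        by (subst nn_integral_image) (auto simp: V(2))
      ultimately show ?thesis using V(1) unfolding avg_def r_def[symmetric] r(3) by (simp add: ennpowr_ennreal)
    qed
    have le: "(\<integral>\<^sup>+z\<in>Q. x z \<partial>disc) / ennreal V * (ennpowr (\<integral>\<^sup>+z\<in>Q. y z \<partial>disc) (p - 1) / ennreal (V powr (p - 1))) \<le> Bp_dom \<psi> p \<sigma>"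
      unfolding Bp_dom_def Bp_char_def avg1[symmetric] avg2[symmetric]
      by (rule SUP_upper2[of "\<psi> ` Q"]) (use Q p in auto)
    have "(\<integral>\<^sup>+z\<in>Q. x z \<partial>disc) \<noteq> \<infinity> \<and> (\<integral>\<^sup>+z\<in>Q. y z \<partial>disc) \<noteq> \<infinity>"
    proof (rule ccontr)
      assume "\<not> ?thesis"
      then have "(\<integral>\<^sup>+z\<in>Q. x z \<partial>disc) / ennreal V * (ennpowr (\<integral>\<^sup>+z\<in>Q. y z \<partial>disc) (p - 1) / ennreal (V powr (p - 1))) = \<infinity>"
        using X0 Y0 V(1) by (auto simp: ennreal_mult_eq_top_iff ennreal_divide_eq_top_iff ennreal_divide_eq_0_iff ennpowr_zero_iff ennpowr_def enn2real_eq_0_iff)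
      with le D show False by (simp add: top_unique)
    qed
    then obtain X Y where XY: "0 \<le> X" "(\<integral>\<^sup>+z\<in>Q. x z \<partial>disc) = ennreal X" "0 \<le> Y" "(\<integral>\<^sup>+z\<in>Q. y z \<partial>disc) = ennreal Y"
      by (metis enn2real_nonneg ennreal_enn2real infinity_ennreal_def less_top)
    have "ennreal (X / V * (Y powr (p - 1) / V powr (p - 1))) \<le> Bp_dom \<psi> p \<sigma>"
      using le XY V(1) by (simp add: ennpowr_ennreal divide_ennreal flip: ennreal_mult)
    then have "X / V * (Y powr (p - 1) / V powr (p - 1)) \<le> D'"
      using D XY V(1) unfolding D'_def by (cases "Bp_dom \<psi> p \<sigma>") auto
    moreover have "V * V powr (p - 1) = V powr p" using V(1) by (simp add: powr_diff)
    ultimately have XYD: "X * Y powr (p - 1) \<le> D' * V powr p" using V(1) by (simp add: field_simps)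
    \<comment> \<open>One estimate for both the weight and its dual, with c = p/2 and c = p/2 * r
      respectively.\<close>
    have bound: "\<exists>W. 0 \<le> W \<and> W \<le> L powr c * Z \<and> (\<integral>\<^sup>+z\<in>Q. ennreal (u z) \<partial>disc) = ennreal W"
      if [measurable]: "t \<in> borel_measurable disc" and Z: "0 \<le> Z" "(\<integral>\<^sup>+z\<in>Q. t z \<partial>disc) = ennreal Z"
        and pt: "\<And>z. z \<in> Q \<Longrightarrow> 0 < \<sigma> (\<psi> z) \<Longrightarrow> ennreal (u z) = ennreal ((1 / jac z) powr c) * t z"
        and c: "0 \<le> c" for t u c Z
    proof -
      have "(\<integral>\<^sup>+z\<in>Q. ennreal (u z) \<partial>disc) \<le> (\<integral>\<^sup>+z. ennreal (L powr c) * (t z * indicator Q z) \<partial>disc)"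
      proof (rule nn_integral_mono_AE)
        show "AE z in disc. ennreal (u z) * indicator Q z \<le> ennreal (L powr c) * (t z * indicator Q z)"
          using ae AE_\<sigma>_pos
        proof eventually_elim
          case (elim z)
          show ?case
          proof (cases "z \<in> Q")
            case True
            have "(1 / jac z) powr c \<le> L powr c"
              using elim(1) True c jac_pos[of z] sub by (intro powr_mono2) (auto simp: jac_def)
            then show ?thesis using pt[OF True elim(2)] True by (simp add: mult_right_mono ennreal_leI)
          qed simp
        qed
      qed
      also have "\<dots> = ennreal (L powr c) * ennreal Z" by (subst nn_integral_cmult) (auto simp: Z)
      also have "\<dots> = ennreal (L powr c * Z)" using Z by (simp add: ennreal_mult)
      finally have *: "(\<integral>\<^sup>+z\<in>Q. ennreal (u z) \<partial>disc) \<le> ennreal (L powr c * Z)" .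
      then show ?thesis using Z by (cases "\<integral>\<^sup>+z\<in>Q. ennreal (u z) \<partial>disc") (auto simp: top_unique)
    qed
    have "\<exists>W. 0 \<le> W \<and> W \<le> L powr (p / 2) * X \<and> (\<integral>\<^sup>+z\<in>Q. ennreal (pull_weight p \<sigma> z) \<partial>disc) = ennreal W"
    proof (rule bound[of x])
      fix z assume z: "z \<in> Q" "0 < \<sigma> (\<psi> z)"
      have j: "0 < jac z" using z sub jac_pos by auto
      have "jac z powr (1 - p / 2) = (1 / jac z) powr (p / 2) * jac z"
        using j by (simp add: powr_diff powr_divide)
      then have "pull_weight p \<sigma> z = (1 / jac z) powr (p / 2) * (jac z * \<sigma> (\<psi> z))"
        using z sub by (auto simp: pull_weight_def)
      then show "ennreal (pull_weight p \<sigma> z) = ennreal ((1 / jac z) powr (p / 2)) * x z"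
        using z j by (simp add: x_def ennreal_mult less_imp_le)
    qed (use XY p in auto)
    then obtain W where W: "0 \<le> W" "W \<le> L powr (p / 2) * X" "(\<integral>\<^sup>+z\<in>Q. ennreal (pull_weight p \<sigma> z) \<partial>disc) = ennreal W" by blast
    have "\<exists>T. 0 \<le> T \<and> T \<le> L powr (p / 2 * r) * Y \<and> (\<integral>\<^sup>+z\<in>Q. ennreal (pull_dual p \<sigma> z) \<partial>disc) = ennreal T"
    proof (rule bound[of y])
      fix z assume z: "z \<in> Q" "0 < \<sigma> (\<psi> z)"
      have j: "0 < jac z" using z sub jac_pos by auto
      \<comment> \<open>Equivalent to r (p - 1) = 1. Its effect is that the dual weight also
        contains exactly one full power of the Jacobian, the one consumed by the change of
        variables.\<close>
      have e: "(1 - p / 2) * (- r) = 1 - p / 2 * r" using p by (simp add: r_def field_simps)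
      have "pull_dual p \<sigma> z = (jac z powr (1 - p / 2) * \<sigma> (\<psi> z)) powr (- r)"
        using z sub by (auto simp: pull_dual_def pull_weight_def r_def)
      also have "\<dots> = jac z powr (1 - p / 2 * r) * \<sigma> (\<psi> z) powr (- r)"
        using j z by (simp only: powr_mult powr_powr e powr_ge_zero less_imp_le)
      also have "jac z powr (1 - p / 2 * r) = (1 / jac z) powr (p / 2 * r) * jac z"
        using j by (simp add: powr_diff powr_divide)
      also have "\<sigma> (\<psi> z) powr (- r) = \<bar>1 / \<sigma> (\<psi> z)\<bar> powr r"
        using z by (simp add: powr_minus powr_divide inverse_eq_divide)
      finally have "pull_dual p \<sigma> z = (1 / jac z) powr (p / 2 * r) * (jac z * \<bar>1 / \<sigma> (\<psi> z)\<bar> powr r)" by simp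
      then show "ennreal (pull_dual p \<sigma> z) = ennreal ((1 / jac z) powr (p / 2 * r)) * y z"
        using j by (simp add: y_def ennreal_mult less_imp_le)
    qed (use XY p r in auto)
    then obtain T where T: "0 \<le> T" "T \<le> L powr (p / 2 * r) * Y" "(\<integral>\<^sup>+z\<in>Q. ennreal (pull_dual p \<sigma> z) \<partial>disc) = ennreal T" by blast
    have "W * T powr (p - 1) \<le> (L powr (p / 2) * X) * (L powr (p / 2 * r) * Y) powr (p - 1)"
      using W T p XY by (intro mult_mono powr_mono2) auto
    also have "(L powr (p / 2 * r) * Y) powr (p - 1) = L powr (p / 2) * Y powr (p - 1)"
      using XY r by (simp add: powr_mult powr_powr mult.assoc)
    also have "(L powr (p / 2) * X) * (L powr (p / 2) * Y powr (p - 1)) = (L powr (p / 2) * L powr (p / 2)) * (X * Y powr (p - 1))"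
      by (simp only: mult_ac)
    also have "L powr (p / 2) * L powr (p / 2) = L powr p" by (simp flip: powr_add)
    also have "L powr p * (X * Y powr (p - 1)) \<le> L powr p * (D' * V powr p)"
      using XYD by (intro mult_left_mono) auto
    also have "\<dots> = D' * (V * L) powr p" using V(1) L by (simp add: powr_mult)
    also have "\<dots> \<le> D' * (B' * ?m) powr p"
      using VL V(1) L p B'0 by (intro mult_left_mono powr_mono2) auto
    also have "\<dots> = B' powr p * D' * ?m powr p" using B'0 by (simp add: powr_mult)
    finally show ?thesis
      using W T by blast
  qed
  then show "\<exists>W T. 0 \<le> W \<and> 0 \<le> T \<and>
      (\<integral>\<^sup>+z\<in>carleson_box \<theta> l. ennreal (pull_weight p \<sigma> z) \<partial>disc) = ennreal W \<and>
      (\<integral>\<^sup>+z\<in>carleson_box \<theta> l. ennreal (pull_dual p \<sigma> z) \<partial>disc) = ennreal T \<and>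
      W * T powr (p - 1) \<le> enn2real (Bp_disc 1 jac) powr p * enn2real (Bp_dom \<psi> p \<sigma>) * measure disc (carleson_box \<theta> l) powr p"
    unfolding Q_def B'_def D'_def .
qed

theorem bergman_opnorm_bound:
  assumes B: "Bp_disc 1 jac < \<infinity>"
  shows "bergman_opnorm \<Omega> p \<sigma> \<le> ennreal (disc_const p) * ennpowr (ennpowr (Bp_disc 1 jac) p * Bp_dom \<psi> p \<sigma>) (max 1 (1 / (p - 1)))"
proof (cases "Bp_dom \<psi> p \<sigma> = \<infinity>")
  \<comment> \<open>If the characteristic of \<sigma> is infinite, so is the right side, because the
    B_1 characteristic and the constant are positive.\<close>
  case True
  have "Bp_disc 1 jac \<noteq> 0" using Bp_disc_pos[OF B] by auto
  then have "ennpowr (Bp_disc 1 jac) p * Bp_dom \<psi> p \<sigma> = \<infinity>"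
    using True by (simp add: ennreal_mult_top ennpowr_zero_iff)
  then show ?thesis using disc_const_pos[OF p] by (simp add: ennpowr_def ennreal_mult_top)
next
  case False
  then have D: "Bp_dom \<psi> p \<sigma> < \<infinity>" by (simp add: less_top)
  define K where "K = enn2real (Bp_disc 1 jac) powr p * enn2real (Bp_dom \<psi> p \<sigma>)"
  have K0: "0 \<le> K" by (simp add: K_def)
  have Keq: "ennpowr (Bp_disc 1 jac) p * Bp_dom \<psi> p \<sigma> = ennreal K"
    using B False by (simp add: K_def ennpowr_def ennreal_mult less_top)
  define R where "R = disc_const p * K powr max 1 (1 / (p - 1))"
  have R0: "0 \<le> R" using disc_const_pos[OF p] by (simp add: R_def)
  have rhs: "ennreal (disc_const p) * ennpowr (ennpowr (Bp_disc 1 jac) p * Bp_dom \<psi> p \<sigma>) (max 1 (1 / (p - 1))) = ennreal R"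
    using disc_const_pos[OF p] K0 by (simp add: Keq ennpowr_ennreal R_def ennreal_mult)
  have "wnorm p \<sigma> \<Omega> (bergman_proj \<Omega> f) / wnorm p \<sigma> \<Omega> f \<le> ennreal R"
    if f: "f \<in> L2_on \<Omega>" and f0: "0 < wnorm p \<sigma> \<Omega> f" "wnorm p \<sigma> \<Omega> f < \<infinity>" for f
  proof -
    have fm: "f \<in> borel_measurable (area_on \<Omega>)" and F: "sq_int (pull f)" using f by (auto simp: L2_on_iff)
    note P = pull_bergman_proj[OF f]
    have gm: "bergman_proj \<Omega> f \<in> borel_measurable (area_on \<Omega>)" using P(1) by (auto simp: bergman_space_def L2_on_iff)
    let ?A = "\<integral>\<^sup>+z. ennreal (cmod (pull f z) powr p * pull_weight p \<sigma> z) \<partial>disc"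
    let ?A' = "\<integral>\<^sup>+z. ennreal (cmod (berg (pull f) z) powr p * pull_weight p \<sigma> z) \<partial>disc"
    have wf: "wnorm p \<sigma> \<Omega> f = ennpowr ?A (1 / p)" by (simp add: wnorm_def wnorm_pull[OF fm])
    have "(\<integral>\<^sup>+z. ennreal (cmod (pull (bergman_proj \<Omega> f) z) powr p * pull_weight p \<sigma> z) \<partial>disc) = ?A'"
      using P(2) by (intro nn_integral_cong_AE) auto
    then have wg: "wnorm p \<sigma> \<Omega> (bergman_proj \<Omega> f) = ennpowr ?A' (1 / p)" by (simp add: wnorm_def wnorm_pull[OF gm])
    \<comment> \<open>The supremum defining the operator norm runs over functions of positive finite
      norm, which makes the division by \<open>wnorm p \<sigma> \<Omega> f\<close> an ordinary real
      division.\<close>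
    have "?A \<noteq> \<infinity>" using f0(2) wf by (auto simp: ennpowr_def)
    moreover have "?A \<noteq> 0" using f0(1) wf ennpowr_zero_iff[of ?A] by auto
    ultimately obtain a where a: "0 < a" "?A = ennreal a" by (cases ?A) (auto simp: order_less_le)
    note iF = sq_int_integrable[OF F]
    have [measurable]: "pull f \<in> borel_measurable disc" "berg (pull f) \<in> borel_measurable disc"
      using F sq_int_berg[OF F] by (auto simp: sq_int_def)
    have "?A' \<le> ennreal (R powr p * a)"
      unfolding R_def
      by (rule kernel_operator_bound[OF p measurable_pull_weight measurable_pull_dual pull_weight_pos pull_dual_pos pull_weight_dual[OF p] K0 Bp_bound_pull[OF B D, folded K_def], of "\<lambda>z. cmod (pull f z)"])
         (use a berg_le[OF iF] in auto)
    then have "wnorm p \<sigma> \<Omega> (bergman_proj \<Omega> f) \<le> ennpowr (ennreal (R powr p * a)) (1 / p)"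
      unfolding wg using p by (intro ennpowr_mono) auto
    also have "\<dots> = ennreal (R * a powr (1 / p))"
      using R0 a p by (simp add: ennpowr_ennreal powr_mult powr_powr)
    finally have "wnorm p \<sigma> \<Omega> (bergman_proj \<Omega> f) / wnorm p \<sigma> \<Omega> f \<le> ennreal (R * a powr (1 / p)) / ennreal (a powr (1 / p))"
      unfolding wf a(2) using a(1) by (simp add: ennpowr_ennreal divide_right_mono_ennreal)
    also have "\<dots> = ennreal R" using a(1) R0 by (simp add: divide_ennreal)
    finally show ?thesis .
  qed
  then show ?thesis unfolding rhs bergman_opnorm_def by (intro SUP_least) auto
qed

end

end

theorem theorem1p1:
  "\<exists>C :: real \<Rightarrow> real. \<forall>p > 1. 0 < C p \<and>
     (\<forall>(\<Omega> :: complex set) (\<psi> :: complex \<Rightarrow> complex) (\<sigma> :: complex \<Rightarrow> real).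
        open \<Omega> \<and> connected \<Omega> \<and> bounded \<Omega> \<and> simply_connected \<Omega> \<and>
        \<psi> holomorphic_on ball 0 1 \<and> inj_on \<psi> (ball 0 1) \<and> \<psi> ` ball 0 1 = \<Omega> \<and>
        Bp_disc 1 (\<lambda>z. (cmod (deriv \<psi> z))\<^sup>2) < \<infinity> \<and>
        weight_on \<Omega> \<sigma>
        \<longrightarrow> bergman_opnorm \<Omega> p \<sigma> \<le>
            ennreal (C p) * ennpowr (ennpowr (Bp_disc 1 (\<lambda>z. (cmod (deriv \<psi> z))\<^sup>2)) p * Bp_dom \<psi> p \<sigma>)
                                    (max 1 (1 / (p - 1))))"
proof (intro exI[of _ disc_const] allI impI conjI)
  fix p :: real assume p: "1 < p"
  then show "0 < disc_const p" by (rule disc_const_pos)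
  fix \<Omega> :: "complex set" and \<psi> :: "complex \<Rightarrow> complex" and \<sigma> :: "complex \<Rightarrow> real"
  assume a: "open \<Omega> \<and> connected \<Omega> \<and> bounded \<Omega> \<and> simply_connected \<Omega> \<and>
        \<psi> holomorphic_on ball 0 1 \<and> inj_on \<psi> (ball 0 1) \<and> \<psi> ` ball 0 1 = \<Omega> \<and>
        Bp_disc 1 (\<lambda>z. (cmod (deriv \<psi> z))\<^sup>2) < \<infinity> \<and> weight_on \<Omega> \<sigma>"
  interpret conformal_disc \<Omega> \<psi> using a by unfold_locales auto
  have jac: "jac = (\<lambda>z. (cmod (deriv \<psi> z))\<^sup>2)" by (simp add: fun_eq_iff jac_def)
  show "bergman_opnorm \<Omega> p \<sigma> \<le>
            ennreal (disc_const p) * ennpowr (ennpowr (Bp_disc 1 (\<lambda>z. (cmod (deriv \<psi> z))\<^sup>2)) p * Bp_dom \<psi> p \<sigma>)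
                                    (max 1 (1 / (p - 1)))"
    using bergman_opnorm_bound[OF p, of \<sigma>] a unfolding jac by blast
qed

end
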